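(* Let $q \in S(\emptyset)$ be relatively $\mathcal{P}$-internal via the $\emptyset$-definable function $\pi$, with associated $\emptyset$-type-definable groupoid $\mathcal{G} = \mathcal{G}(q,\pi/\mathcal{P})$. If $\mathcal{G}$ is retractable, then there is a complete type $p \in S(\emptyset)$, internal to $\mathcal{P}$ and weakly orthogonal to $\pi(q)$, and an $\emptyset$-definable bijection between $q(\mathbb{M})$ and $(p \otimes \pi(q))(\mathbb{M})$.
   Context: Work in a monster model $\mathbb{M}$ of a stable theory eliminating imaginaries, with $\mathrm{acl}(\emptyset)=\emptyset$ (i.e. elements algebraic over $\emptyset$ are regarded as $\emptyset$-definable, so complete types over $\emptyset$ are stationary). $\mathcal{P}$ is a family of partial types over $\emptyset$; one also writes $\mathcal{P}$ for the set of tuples realizing some partial type in $\mathcal{P}$. $\Phi(\mathbb{M})$ denotes the set of realizations of $\Phi$. A stationary type $s$ over $C$ is $\mathcal{P}$-internal if there are $B \supseteq C$, $a \models s$ independent of $B$ over $C$, and a tuple $\overline{c}$ of realizations of $\mathcal{P}$ with $a \in \mathrm{dcl}(\overline{c},B)$. $\pi$ is an $\emptyset$-definable function whose domain contains $q(\mathbb{M})$; $\pi(q)$ is the type over $\emptyset$ of $\pi(a)$ for $a \models q$. $q$ is relatively $\mathcal{P}$-internal via $\pi$ if for any $a\models q$, $q_{\pi(a)} := \mathrm{tp}(a/\pi(a))$ is stationary and $\mathcal{P}$-internal. The groupoid $\mathcal{G}(q,\pi/\mathcal{P})$ has as objects the realizations of $\pi(q)$, and $\mathrm{Mor}(\pi(a),\pi(b))$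 is the set of bijections $q_{\pi(a)}(\mathbb{M}) \to q_{\pi(b)}(\mathbb{M})$ induced by automorphisms of $\mathbb{M}$ fixing $\mathcal{P}$ pointwise and taking $\pi(a)$ to $\pi(b)$. This groupoid is identified with an $\emptyset$-type-definable groupoid (it is isomorphic to one, with relatively $\emptyset$-definable action $(\sigma,a)\mapsto\sigma(a)$ on $q(\mathbb{M})$). A groupoid is connected if $\mathrm{Mor}(a,b) \neq \emptyset$ for all objects $a,b$. An $\emptyset$-type-definable groupoid is retractable if it is connected and there is an $\emptyset$-definable partial function $g(x,y)=g_{x,y}$ with $g_{a,b} \in \mathrm{Mor}(a,b)$ for all objects $a,b$, and $g_{b,c} \circ g_{a,b} = g_{a,c}$ for all objects $a,b,c$. For stationary types $p,s$ over the same set, $p \otimes s$ is the type of $(a,b)$ with $a\models p$, $b\models s$ independent over that set. Types $p,s$ over $\emptyset$ are weakly orthogonal if $p(x)\cup s(y)$ determines a complete type over $\emptyset$. *)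

theory Defs
  imports Main "HOL-Library.FuncSet"
begin

section \<open>Many-sorted first-order logic\<close>

text \<open>Variables are de Bruijn indices into a list of elements (and of sorts).  The universe of a
  structure is the whole type \<open>'m\<close>, partitioned by \<open>sort_of\<close>; one-sorted structures are the case of
  a one-element type \<open>'s\<close>.\<close>

datatype 'f tm = Var nat | App 'f "'f tm list"

datatype ('f, 'r, 's) fm =
    Eq "'f tm" "'f tm"
  | Rel 'r "'f tm list"
  | Neg "('f, 'r, 's) fm"
  | Conj "('f, 'r, 's) fm" "('f, 'r, 's) fm"
  | Exi 's "('f, 'r, 's) fm"

record ('f, 'r, 's, 'm) fo_struct =
  fun_dom :: "'f \<Rightarrow> 's list"
  fun_ran :: "'f \<Rightarrow> 's"
  rel_dom :: "'r \<Rightarrow> 's list"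
  sort_of :: "'m \<Rightarrow> 's"
  fun_int :: "'f \<Rightarrow> 'm list \<Rightarrow> 'm"
  rel_int :: "'r \<Rightarrow> 'm list \<Rightarrow> bool"

abbreviation sorts :: "('f, 'r, 's, 'm) fo_struct \<Rightarrow> 'm list \<Rightarrow> 's list" where
  "sorts M xs \<equiv> map (sort_of M) xs"

definition wf_struct :: "('f, 'r, 's, 'm) fo_struct \<Rightarrow> bool" where
  "wf_struct M \<longleftrightarrow>
     (\<forall>f xs. sorts M xs = fun_dom M f \<longrightarrow> sort_of M (fun_int M f xs) = fun_ran M f)"

inductive has_sort ::
    "('f, 'r, 's, 'm) fo_struct \<Rightarrow> 's list \<Rightarrow> 'f tm \<Rightarrow> 's \<Rightarrow> bool" for M \<Gamma> where
  "i < length \<Gamma> \<Longrightarrow> has_sort M \<Gamma> (Var i) (\<Gamma> ! i)"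
| "list_all2 (has_sort M \<Gamma>) ts (fun_dom M f) \<Longrightarrow> has_sort M \<Gamma> (App f ts) (fun_ran M f)"

primrec wf_fm :: "('f, 'r, 's, 'm) fo_struct \<Rightarrow> 's list \<Rightarrow> ('f, 'r, 's) fm \<Rightarrow> bool" where
  "wf_fm M \<Gamma> (Eq t u) \<longleftrightarrow> (\<exists>s. has_sort M \<Gamma> t s \<and> has_sort M \<Gamma> u s)"
| "wf_fm M \<Gamma> (Rel r ts) \<longleftrightarrow> list_all2 (has_sort M \<Gamma>) ts (rel_dom M r)"
| "wf_fm M \<Gamma> (Neg \<phi>) \<longleftrightarrow> wf_fm M \<Gamma> \<phi>"
| "wf_fm M \<Gamma> (Conj \<phi> \<psi>) \<longleftrightarrow> wf_fm M \<Gamma> \<phi> \<and> wf_fm M \<Gamma> \<psi>"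
| "wf_fm M \<Gamma> (Exi s \<phi>) \<longleftrightarrow> wf_fm M (s # \<Gamma>) \<phi>"

primrec tm_val :: "('f, 'r, 's, 'm) fo_struct \<Rightarrow> 'm list \<Rightarrow> 'f tm \<Rightarrow> 'm" where
  "tm_val M e (Var i) = e ! i"
| "tm_val M e (App f ts) = fun_int M f (map (tm_val M e) ts)"

primrec sat :: "('f, 'r, 's, 'm) fo_struct \<Rightarrow> 'm list \<Rightarrow> ('f, 'r, 's) fm \<Rightarrow> bool" where
  "sat M e (Eq t u) \<longleftrightarrow> tm_val M e t = tm_val M e u"
| "sat M e (Rel r ts) \<longleftrightarrow> rel_int M r (map (tm_val M e) ts)"
| "sat M e (Neg \<phi>) \<longleftrightarrow> \<not> sat M e \<phi>"
| "sat M e (Conj \<phi> \<psi>) \<longleftrightarrow> sat M e \<phi> \<and> sat M e \<psi>"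
| "sat M e (Exi s \<phi>) \<longleftrightarrow> (\<exists>m. sort_of M m = s \<and> sat M (m # e) \<phi>)"


section \<open>Types, definable sets and automorphisms\<close>

text \<open>A formula \<open>\<phi>(x, b)\<close> with parameters \<open>b\<close> is a pair \<open>(\<phi>, b)\<close>, evaluated at \<open>x\<close> in the
  environment \<open>x @ b\<close>.  A partial type carries the list of sorts of its variables, because
  a formula does not determine them.\<close>

type_synonym ('f, 'r, 's, 'm) pfm = "('f, 'r, 's) fm \<times> 'm list"
type_synonym ('f, 'r, 's, 'm) ptype = "'s list \<times> ('f, 'r, 's, 'm) pfm set"

definition pfms ::
    "('f, 'r, 's, 'm) fo_struct \<Rightarrow> 'm set \<Rightarrow> 's list \<Rightarrow> ('f, 'r, 's, 'm) pfm set" where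
  "pfms M A ss = {(\<phi>, b). set b \<subseteq> A \<and> wf_fm M (ss @ sorts M b) \<phi>}"

definition psat :: "('f, 'r, 's, 'm) fo_struct \<Rightarrow> 'm list \<Rightarrow> ('f, 'r, 's, 'm) pfm \<Rightarrow> bool" where
  "psat M x \<chi> \<longleftrightarrow> sat M (x @ snd \<chi>) (fst \<chi>)"

definition rlz :: "('f, 'r, 's, 'm) fo_struct \<Rightarrow> ('f, 'r, 's, 'm) ptype \<Rightarrow> 'm list set" where
  "rlz M p = {x. sorts M x = fst p \<and> (\<forall>\<chi>\<in>snd p. psat M x \<chi>)}"

definition partial_type ::
    "('f, 'r, 's, 'm) fo_struct \<Rightarrow> 'm set \<Rightarrow> ('f, 'r, 's, 'm) ptype \<Rightarrow> bool" where
  "partial_type M A p \<longleftrightarrow> snd p \<subseteq> pfms M A (fst p) \<and>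
     (\<forall>\<Delta>. finite \<Delta> \<and> \<Delta> \<subseteq> snd p \<longrightarrow> rlz M (fst p, \<Delta>) \<noteq> {})"

definition complete_type ::
    "('f, 'r, 's, 'm) fo_struct \<Rightarrow> 'm set \<Rightarrow> ('f, 'r, 's, 'm) ptype \<Rightarrow> bool" where
  "complete_type M A p \<longleftrightarrow> partial_type M A p \<and>
     (\<forall>(\<phi>, b)\<in>pfms M A (fst p). (\<phi>, b) \<in> snd p \<or> (Neg \<phi>, b) \<in> snd p)"

definition tp ::
    "('f, 'r, 's, 'm) fo_struct \<Rightarrow> 'm set \<Rightarrow> 'm list \<Rightarrow> ('f, 'r, 's, 'm) ptype" where
  "tp M A a = (sorts M a, {\<chi> \<in> pfms M A (sorts M a). psat M a \<chi>})"

definition definable ::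
    "('f, 'r, 's, 'm) fo_struct \<Rightarrow> 'm set \<Rightarrow> 's list \<Rightarrow> 'm list set \<Rightarrow> bool" where
  "definable M A ss X \<longleftrightarrow> (\<exists>\<chi>\<in>pfms M A ss. X = rlz M (ss, {\<chi>}))"

definition type_definable ::
    "('f, 'r, 's, 'm) fo_struct \<Rightarrow> 'm set \<Rightarrow> 's list \<Rightarrow> 'm list set \<Rightarrow> bool" where
  "type_definable M A ss X \<longleftrightarrow> (\<exists>\<Phi>. \<Phi> \<subseteq> pfms M A ss \<and> X = rlz M (ss, \<Phi>))"

definition rel_definable ::
    "('f, 'r, 's, 'm) fo_struct \<Rightarrow> 'm set \<Rightarrow> 's list \<Rightarrow> 'm list set \<Rightarrow> 'm list set \<Rightarrow> bool" where
  "rel_definable M A ss X Y \<longleftrightarrow> (\<exists>D. definable M A ss D \<and> Y = X \<inter> D)"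

definition definable_pfun ::
    "('f, 'r, 's, 'm) fo_struct \<Rightarrow> 'm set \<Rightarrow> 's list \<Rightarrow> 's list \<Rightarrow> ('m list \<rightharpoonup> 'm list) \<Rightarrow> bool" where
  "definable_pfun M A ss ts f \<longleftrightarrow>
     (\<forall>x y. f x = Some y \<longrightarrow> sorts M x = ss \<and> sorts M y = ts) \<and>
     definable M A (ss @ ts) {x @ y |x y. f x = Some y}"

definition definable_bijection_between ::
    "('f, 'r, 's, 'm) fo_struct \<Rightarrow> 'm set \<Rightarrow> 'm list set \<Rightarrow> 'm list set \<Rightarrow> bool" where
  "definable_bijection_between M A X Y \<longleftrightarrow>
     (\<exists>ss ts f. definable_pfun M A ss ts f \<and> X \<subseteq> dom f \<and> bij_betw (\<lambda>x. the (f x)) X Y)"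

definition dcl :: "('f, 'r, 's, 'm) fo_struct \<Rightarrow> 'm set \<Rightarrow> 'm set" where
  "dcl M A = {m. definable M A [sort_of M m] {[m]}}"

definition acl :: "('f, 'r, 's, 'm) fo_struct \<Rightarrow> 'm set \<Rightarrow> 'm set" where
  "acl M A = {m. \<exists>X. definable M A [sort_of M m] X \<and> finite X \<and> [m] \<in> X}"

definition automorphisms :: "('f, 'r, 's, 'm) fo_struct \<Rightarrow> ('m \<Rightarrow> 'm) set" where
  "automorphisms M = {\<sigma>. bij \<sigma> \<and> (\<forall>m. sort_of M (\<sigma> m) = sort_of M m) \<and>
     (\<forall>f xs. sorts M xs = fun_dom M f \<longrightarrow> \<sigma> (fun_int M f xs) = fun_int M f (map \<sigma> xs)) \<and>
     (\<forall>r xs. sorts M xs = rel_dom M r \<longrightarrow> rel_int M r (map \<sigma> xs) = rel_int M r xs)}"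

definition elementary_on :: "('f, 'r, 's, 'm) fo_struct \<Rightarrow> 'm set \<Rightarrow> ('m \<Rightarrow> 'm) \<Rightarrow> bool" where
  "elementary_on M A h \<longleftrightarrow> (\<forall>a. set a \<subseteq> A \<longrightarrow> tp M {} (map h a) = tp M {} a)"


section \<open>Monster models, stability and elimination of imaginaries\<close>

definition small :: "'k rel \<Rightarrow> 'm set \<Rightarrow> bool" where
  "small \<kappa> A \<longleftrightarrow> (card_of A, \<kappa>) \<in> ordLess"

text \<open>A monster model is \<open>\<kappa>\<close>-saturated and strongly \<open>\<kappa>\<close>-homogeneous for a cardinal
  \<open>\<kappa> > |L| + \<aleph>\<^sub>0\<close>; small means of cardinality less than \<open>\<kappa>\<close>.
  The ambient theory is the complete theory of \<open>M\<close>.\<close>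

definition monster_model :: "'k rel \<Rightarrow> ('f, 'r, 's, 'm) fo_struct \<Rightarrow> bool" where
  "monster_model \<kappa> M \<longleftrightarrow> wf_struct M \<and> Card_order \<kappa> \<and>
     small \<kappa> (UNIV :: ('f, 'r, 's) fm set) \<and>
     (\<forall>A p. small \<kappa> A \<and> partial_type M A p \<longrightarrow> rlz M p \<noteq> {}) \<and>
     (\<forall>A h. small \<kappa> A \<and> elementary_on M A h \<longrightarrow> (\<exists>\<sigma>\<in>automorphisms M. \<forall>a\<in>A. \<sigma> a = h a))"

definition order_property ::
    "('f, 'r, 's, 'm) fo_struct \<Rightarrow> 's list \<Rightarrow> 's list \<Rightarrow> ('f, 'r, 's) fm \<Rightarrow> bool" where
  "order_property M ss ts \<phi> \<longleftrightarrow> (\<exists>(a :: nat \<Rightarrow> 'm list) b.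
     (\<forall>i. sorts M (a i) = ss) \<and> (\<forall>j. sorts M (b j) = ts) \<and>
     (\<forall>i j. sat M (a i @ b j) \<phi> \<longleftrightarrow> i < j))"

definition stable_theory :: "('f, 'r, 's, 'm) fo_struct \<Rightarrow> bool" where
  "stable_theory M \<longleftrightarrow> (\<forall>ss ts \<phi>. wf_fm M (ss @ ts) \<phi> \<longrightarrow> \<not> order_property M ss ts \<phi>)"

text \<open>Every class of a \<open>\<emptyset>\<close>-definable equivalence relation \<open>E\<close> on tuples of sorts \<open>ss\<close> is of the
  form \<open>\<theta>(M, b)\<close> for a formula \<open>\<theta>(x, z)\<close> over \<open>\<emptyset>\<close> and a unique tuple \<open>b\<close>.\<close>

definition eliminates_imaginaries :: "('f, 'r, 's, 'm) fo_struct \<Rightarrow> bool" where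
  "eliminates_imaginaries M \<longleftrightarrow> (\<forall>ss E a.
     equiv {x. sorts M x = ss} E \<and> definable M {} (ss @ ss) {x @ y |x y. (x, y) \<in> E} \<and>
     sorts M a = ss \<longrightarrow>
     (\<exists>ts \<theta>. wf_fm M (ss @ ts) \<theta> \<and>
       (\<exists>!b. sorts M b = ts \<and> E `` {a} = {x. sorts M x = ss \<and> sat M (x @ b) \<theta>})))"


section \<open>Forking independence, stationarity and internality\<close>

definition divides ::
    "('f, 'r, 's, 'm) fo_struct \<Rightarrow> 'm set \<Rightarrow> 's list \<Rightarrow> ('f, 'r, 's, 'm) pfm \<Rightarrow> bool" where
  "divides M C ss \<chi> \<longleftrightarrow> (\<exists>(d :: nat \<Rightarrow> 'm list) k.
     (\<forall>i. d i \<in> rlz M (tp M C (snd \<chi>))) \<and>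
     (\<forall>I. finite I \<and> card I = k \<longrightarrow> rlz M (ss, {(fst \<chi>, d i) |i. i \<in> I}) = {}))"

definition forks :: "('f, 'r, 's, 'm) fo_struct \<Rightarrow> 'm set \<Rightarrow> ('f, 'r, 's, 'm) ptype \<Rightarrow> bool" where
  "forks M C p \<longleftrightarrow> (\<exists>\<Delta> \<Psi>. finite \<Delta> \<and> \<Delta> \<subseteq> snd p \<and>
     finite \<Psi> \<and> \<Psi> \<subseteq> pfms M UNIV (fst p) \<and> (\<forall>\<psi>\<in>\<Psi>. divides M C (fst p) \<psi>) \<and>
     (\<forall>x\<in>rlz M (fst p, \<Delta>). \<exists>\<psi>\<in>\<Psi>. psat M x \<psi>))"

text \<open>\<open>indep M a C B\<close>: the tuple \<open>a\<close> is independent of \<open>B\<close> over \<open>C\<close>.\<close>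

definition indep :: "('f, 'r, 's, 'm) fo_struct \<Rightarrow> 'm list \<Rightarrow> 'm set \<Rightarrow> 'm set \<Rightarrow> bool" where
  "indep M a C B \<longleftrightarrow> \<not> forks M C (tp M (C \<union> B) a)"

definition stationary ::
    "'k rel \<Rightarrow> ('f, 'r, 's, 'm) fo_struct \<Rightarrow> 'm set \<Rightarrow> ('f, 'r, 's, 'm) ptype \<Rightarrow> bool" where
  "stationary \<kappa> M C s \<longleftrightarrow> complete_type M C s \<and>
     (\<forall>B a a'. small \<kappa> B \<and> C \<subseteq> B \<and> a \<in> rlz M s \<and> a' \<in> rlz M s \<and>
        indep M a C B \<and> indep M a' C B \<longrightarrow> tp M B a = tp M B a')"

definition family_rlz ::
    "('f, 'r, 's, 'm) fo_struct \<Rightarrow> ('f, 'r, 's, 'm) ptype set \<Rightarrow> 'm list set" where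
  "family_rlz M P = (\<Union>\<Phi>\<in>P. rlz M \<Phi>)"

definition internal :: "'k rel \<Rightarrow> ('f, 'r, 's, 'm) fo_struct \<Rightarrow> ('f, 'r, 's, 'm) ptype set \<Rightarrow>
    'm set \<Rightarrow> ('f, 'r, 's, 'm) ptype \<Rightarrow> bool" where
  "internal \<kappa> M P C s \<longleftrightarrow> (\<exists>B a cs. small \<kappa> B \<and> C \<subseteq> B \<and> a \<in> rlz M s \<and> indep M a C B \<and>
     set cs \<subseteq> family_rlz M P \<and> set a \<subseteq> dcl M (set (concat cs) \<union> B))"

text \<open>The definite descriptions in the next definitions single out the unique value when the type
  is complete (and, for \<open>tensor\<close>, when \<open>p\<close> and \<open>s\<close> are stationary).\<close>

definition tensor :: "('f, 'r, 's, 'm) fo_struct \<Rightarrow> 'm set \<Rightarrow>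
    ('f, 'r, 's, 'm) ptype \<Rightarrow> ('f, 'r, 's, 'm) ptype \<Rightarrow> ('f, 'r, 's, 'm) ptype" where
  "tensor M C p s =
     (THE r. \<exists>a\<in>rlz M p. \<exists>b\<in>rlz M s. indep M a C (set b) \<and> r = tp M C (a @ b))"

definition pushforward :: "('f, 'r, 's, 'm) fo_struct \<Rightarrow> ('m list \<rightharpoonup> 'm list) \<Rightarrow>
    ('f, 'r, 's, 'm) ptype \<Rightarrow> ('f, 'r, 's, 'm) ptype" where
  "pushforward M f q = (THE r. \<exists>a\<in>rlz M q. r = tp M {} (the (f a)))"

definition fibre_type :: "('f, 'r, 's, 'm) fo_struct \<Rightarrow> ('m list \<rightharpoonup> 'm list) \<Rightarrow>
    ('f, 'r, 's, 'm) ptype \<Rightarrow> 'm list \<Rightarrow> ('f, 'r, 's, 'm) ptype" where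
  "fibre_type M f q c = (THE s. \<exists>a\<in>rlz M q. f a = Some c \<and> s = tp M (set c) a)"

definition weakly_orthogonal :: "('f, 'r, 's, 'm) fo_struct \<Rightarrow>
    ('f, 'r, 's, 'm) ptype \<Rightarrow> ('f, 'r, 's, 'm) ptype \<Rightarrow> bool" where
  "weakly_orthogonal M p s \<longleftrightarrow> (\<exists>r. complete_type M {} r \<and> fst r = fst p @ fst s \<and>
     rlz M r = {a @ b |a b. a \<in> rlz M p \<and> b \<in> rlz M s})"

definition relatively_internal :: "'k rel \<Rightarrow> ('f, 'r, 's, 'm) fo_struct \<Rightarrow>
    ('f, 'r, 's, 'm) ptype set \<Rightarrow> ('f, 'r, 's, 'm) ptype \<Rightarrow> ('m list \<rightharpoonup> 'm list) \<Rightarrow> bool" where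
  "relatively_internal \<kappa> M P q f \<longleftrightarrow>
     (\<exists>ts. definable_pfun M {} (fst q) ts f) \<and> rlz M q \<subseteq> dom f \<and>
     (\<forall>a\<in>rlz M q. let C = set (the (f a)) in
        stationary \<kappa> M C (tp M C a) \<and> internal \<kappa> M P C (tp M C a))"


section \<open>Groupoids\<close>

record ('o, 'a) grpd =
  Ob :: "'o set"
  Ar :: "'a set"
  src :: "'a \<Rightarrow> 'o"
  tgt :: "'a \<Rightarrow> 'o"
  cmp :: "'a \<Rightarrow> 'a \<Rightarrow> 'a"  \<comment> \<open>\<open>cmp G g f\<close> is \<open>g\<close> after \<open>f\<close>\<close>

definition Mor :: "('o, 'a) grpd \<Rightarrow> 'o \<Rightarrow> 'o \<Rightarrow> 'a set" where
  "Mor G a b = {f \<in> Ar G. src G f = a \<and> tgt G f = b}"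

definition identity_at :: "('o, 'a) grpd \<Rightarrow> 'o \<Rightarrow> 'a \<Rightarrow> bool" where
  "identity_at G a e \<longleftrightarrow> e \<in> Mor G a a \<and>
     (\<forall>f\<in>Ar G. (src G f = a \<longrightarrow> cmp G f e = f) \<and> (tgt G f = a \<longrightarrow> cmp G e f = f))"

definition groupoid :: "('o, 'a) grpd \<Rightarrow> bool" where
  "groupoid G \<longleftrightarrow>
     (\<forall>f\<in>Ar G. src G f \<in> Ob G \<and> tgt G f \<in> Ob G) \<and>
     (\<forall>f\<in>Ar G. \<forall>g\<in>Ar G. tgt G f = src G g \<longrightarrow> cmp G g f \<in> Mor G (src G f) (tgt G g)) \<and>
     (\<forall>f\<in>Ar G. \<forall>g\<in>Ar G. \<forall>h\<in>Ar G. tgt G f = src G g \<and> tgt G g = src G h \<longrightarrow>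
        cmp G h (cmp G g f) = cmp G (cmp G h g) f) \<and>
     (\<forall>a\<in>Ob G. \<exists>e. identity_at G a e) \<and>
     (\<forall>f\<in>Ar G. \<exists>g\<in>Mor G (tgt G f) (src G f).
        identity_at G (src G f) (cmp G g f) \<and> identity_at G (tgt G f) (cmp G f g))"

definition connected_groupoid :: "('o, 'a) grpd \<Rightarrow> bool" where
  "connected_groupoid G \<longleftrightarrow> (\<forall>a\<in>Ob G. \<forall>b\<in>Ob G. Mor G a b \<noteq> {})"

definition groupoid_iso :: "('a \<Rightarrow> 'b) \<Rightarrow> ('o, 'a) grpd \<Rightarrow> ('o, 'b) grpd \<Rightarrow> bool" where
  "groupoid_iso F G H \<longleftrightarrow> Ob G = Ob H \<and> bij_betw F (Ar G) (Ar H) \<and>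
     (\<forall>f\<in>Ar G. src H (F f) = src G f \<and> tgt H (F f) = tgt G f) \<and>
     (\<forall>f\<in>Ar G. \<forall>g\<in>Ar G. tgt G f = src G g \<longrightarrow> F (cmp G g f) = cmp H (F g) (F f))"

definition type_definable_groupoid ::
    "('f, 'r, 's, 'm) fo_struct \<Rightarrow> 'm set \<Rightarrow> ('m list, 'm list) grpd \<Rightarrow> bool" where
  "type_definable_groupoid M A G \<longleftrightarrow> groupoid G \<and> (\<exists>os as.
     type_definable M A os (Ob G) \<and> type_definable M A as (Ar G) \<and>
     rel_definable M A (as @ os) {f @ c |f c. f \<in> Ar G \<and> c \<in> Ob G} {f @ src G f |f. f \<in> Ar G} \<and>
     rel_definable M A (as @ os) {f @ c |f c. f \<in> Ar G \<and> c \<in> Ob G} {f @ tgt G f |f. f \<in> Ar G} \<and>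
     rel_definable M A (as @ as @ as)
       {g @ f @ h |g f h. g \<in> Ar G \<and> f \<in> Ar G \<and> h \<in> Ar G \<and> tgt G f = src G g}
       {g @ f @ cmp G g f |g f. g \<in> Ar G \<and> f \<in> Ar G \<and> tgt G f = src G g})"

definition retractable :: "('f, 'r, 's, 'm) fo_struct \<Rightarrow> ('m list, 'm list) grpd \<Rightarrow> bool" where
  "retractable M G \<longleftrightarrow> connected_groupoid G \<and> (\<exists>ss ts g. definable_pfun M {} ss ts g \<and>
     (\<forall>a\<in>Ob G. \<forall>b\<in>Ob G. a @ b \<in> dom g \<and> the (g (a @ b)) \<in> Mor G a b) \<and>
     (\<forall>a\<in>Ob G. \<forall>b\<in>Ob G. \<forall>c\<in>Ob G.
        cmp G (the (g (b @ c))) (the (g (a @ b))) = the (g (a @ c))))"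

text \<open>An arrow \<open>(c, h, d)\<close> is a bijection \<open>h\<close> from the fibre over \<open>c\<close> to the fibre over \<open>d\<close>; as a
  HOL function \<open>h\<close> is made \<open>undefined\<close> off the fibre, so that automorphisms which agree on
  the fibre and have the same effect on \<open>c\<close> induce the same arrow.\<close>

definition binding_groupoid :: "('f, 'r, 's, 'm) fo_struct \<Rightarrow> ('f, 'r, 's, 'm) ptype set \<Rightarrow>
    ('f, 'r, 's, 'm) ptype \<Rightarrow> ('m list \<rightharpoonup> 'm list) \<Rightarrow>
    ('m list, 'm list \<times> ('m list \<Rightarrow> 'm list) \<times> 'm list) grpd" where
  "binding_groupoid M P q f = \<lparr>
     Ob = rlz M (pushforward M f q),
     Ar = {(c, restrict (map \<sigma>) (rlz M (fibre_type M f q c)), d) |c \<sigma> d.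
             c \<in> rlz M (pushforward M f q) \<and> d \<in> rlz M (pushforward M f q) \<and>
             \<sigma> \<in> automorphisms M \<and> (\<forall>t\<in>family_rlz M P. map \<sigma> t = t) \<and> map \<sigma> c = d},
     src = fst,
     tgt = (\<lambda>h. snd (snd h)),
     cmp = (\<lambda>h' h. (fst h,
       compose (rlz M (fibre_type M f q (fst h))) (fst (snd h')) (fst (snd h)), snd (snd h')))\<rparr>"

text \<open>The identification of the groupoid of \<open>q\<close> with the \<open>\<emptyset>\<close>-type-definable groupoid \<open>G\<close>: an
  isomorphism, identical on objects, for which the induced action on the realizations of \<open>q\<close> is
  relatively \<open>\<emptyset>\<close>-definable.\<close>

definition represents_binding_groupoid :: "('f, 'r, 's, 'm) fo_struct \<Rightarrow>
    ('f, 'r, 's, 'm) ptype set \<Rightarrow> ('f, 'r, 's, 'm) ptype \<Rightarrow> ('m list \<rightharpoonup> 'm list) \<Rightarrow>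
    ('m list, 'm list) grpd \<Rightarrow> bool" where
  "represents_binding_groupoid M P q f G \<longleftrightarrow> type_definable_groupoid M {} G \<and>
     (\<exists>F. groupoid_iso F G (binding_groupoid M P q f) \<and>
       (\<exists>as. type_definable M {} as (Ar G) \<and>
         rel_definable M {} (as @ fst q @ fst q)
           {h @ x @ y |h x y. h \<in> Ar G \<and> x \<in> rlz M q \<and> y \<in> rlz M q}
           {h @ x @ fst (snd (F h)) x |h x. h \<in> Ar G \<and> x \<in> rlz M (fibre_type M f q (src G h))}))"

end

theory Submission
  imports Defs "HOL-Library.Infinite_Set"
begin

text \<open>Write \<open>Q\<close> for the set of realizations of \<open>q\<close>.  A retraction \<open>g\<close> identifies all fibres of \<open>\<pi>\<close> on
\<open>Q\<close> coherently: if \<open>A c d\<close> denotes the bijection from the fibre over \<open>c\<close> to the fibre over \<open>d\<close>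
given by \<open>g\<close>, then the cocycle identity makes \<open>y = A (\<pi> x) (\<pi> y) x\<close> an equivalence relation on
\<open>Q\<close>, each class of which meets each fibre in exactly one point.  So once the class of \<open>x\<close> has a
name \<open>f x\<close>, the map \<open>x \<mapsto> (f x, \<pi> x)\<close> is a bijection from \<open>Q\<close> onto the set of all pairs of a name
and an object.  With \<open>p\<close> the type of a name, all such pairs have the same type because all
elements of \<open>Q\<close> do, which is the weak orthogonality of \<open>p\<close> and \<open>\<pi>(q)\<close>.  Naming classes needs
a \<open>\<emptyset>\<close>-definable equivalence relation on the whole sort, whereas the above is only relatively
definable on \<open>Q\<close>.  By compactness there is a definable \<open>\<Theta> \<supseteq> Q\<close> on which related elements are
related to the same elements of \<open>\<Theta>\<close>, and ``related to the same elements of \<open>\<Theta>\<close>'' is an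
equivalence relation everywhere (\<open>complement_of_retraction\<close>).

Two points need the theory of forking.  The tensor product is only the expected type if
some realization of \<open>p\<close> is independent of some realization of \<open>\<pi>(q)\<close>; and internality of \<open>p\<close> asks for a
realization of \<open>p\<close> independent of a set \<open>B\<close> of parameters.  Both come from
\<open>nonforking_extension\<close>: in a stable theory a type over \<open>\<emptyset>\<close> has a realization independent of any
given small set.  By compactness this says that no nonempty \<open>\<emptyset>\<close>-definable set \<open>X\<close> is covered by
finitely many formulas dividing over \<open>\<emptyset>\<close> (\<open>not_covered_by_dividing\<close>).  Suppose it were.  Measure
sets by a rank that exceeds \<open>m\<close> if the set meets all terms of some \<open>k\<close>-inconsistent sequence of
instances of one of these formulas in sets of rank at least \<open>m\<close>.  A finite union has rank at
least \<open>m\<close> only if one of its parts does, so one of the covering formulas cuts \<open>X\<close> in a set of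
the same rank; its conjugates do so too, as \<open>X\<close> is invariant, and so the rank of \<open>X\<close> can be
raised by one, for ever.  Large rank gives binary splitting trees, these give ladders, and
ladders of all finite lengths give the order property by compactness.

For internality, let \<open>B\<close> and \<open>a\<close> witness that the fibre type over \<open>c\<close> is internal, and let
\<open>d\<close> realize \<open>p\<close> independently of \<open>B\<close>.  Then \<open>d\<close> is also independent of \<open>B\<close> over
\<open>c\<close>, and hence so is the unique \<open>y \<in> Q\<close> with coordinates \<open>(d, c)\<close>, which is the image of \<open>d\<close> under
a function definable over \<open>c\<close>.  By stationarity \<open>y\<close> and \<open>a\<close> have the same type over \<open>B\<close>, so \<open>y\<close>,
and with it \<open>d = f y\<close>, is definable over \<open>B\<close> and realizations of \<open>P\<close> (\<open>internal_coordinate\<close>).\<close>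

section \<open>Ranks of set families and ladders\<close>

text \<open>Shelah's dividing rank, on arbitrary sets.  The members of \<open>\<S>\<close> are meant to be the
\<open>k\<close>-inconsistent sequences of instances of some formulas.\<close>

primrec dividing_rank_ge :: "(nat \<Rightarrow> 'a set) set \<Rightarrow> nat \<Rightarrow> 'a set \<Rightarrow> bool" where
  "dividing_rank_ge \<S> 0 X \<longleftrightarrow> X \<noteq> {}"
| "dividing_rank_ge \<S> (Suc m) X \<longleftrightarrow> (\<exists>S\<in>\<S>. \<forall>j. dividing_rank_ge \<S> m (X \<inter> S j))"

lemma dividing_rank_ge_mono: "dividing_rank_ge \<S> m X \<Longrightarrow> X \<subseteq> Y \<Longrightarrow> dividing_rank_ge \<S> m Y"
proof (induction m arbitrary: X Y)
  case (Suc m)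
  then obtain S where "S \<in> \<S>" "\<forall>j. dividing_rank_ge \<S> m (X \<inter> S j)" by auto
  moreover have "X \<inter> S j \<subseteq> Y \<inter> S j" for j using Suc.prems by auto
  ultimately have "\<forall>j. dividing_rank_ge \<S> m (Y \<inter> S j)" using Suc.IH by blast
  then show ?case using \<open>S \<in> \<S>\<close> by auto
qed auto

text \<open>If a sequence witnesses the rank of \<open>X \<union> Y\<close>, then one of the two sets keeps the required rank
at infinitely many terms, and the subsequence of these terms is again a witness.\<close>

lemma dividing_rank_ge_Un:
  assumes sub: "\<And>S r. S \<in> \<S> \<Longrightarrow> strict_mono r \<Longrightarrow> S \<circ> r \<in> \<S>"
  shows "dividing_rank_ge \<S> m (X \<union> Y) \<Longrightarrow> dividing_rank_ge \<S> m X \<or> dividing_rank_ge \<S> m Y"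
proof (induction m arbitrary: X Y)
  case (Suc m)
  then obtain S where S: "S \<in> \<S>" "\<And>j. dividing_rank_ge \<S> m ((X \<union> Y) \<inter> S j)" by auto
  have half: "dividing_rank_ge \<S> (Suc m) Z" if inf: "infinite {j. dividing_rank_ge \<S> m (Z \<inter> S j)}" for Z
  proof -
    define r where "r = enumerate {j. dividing_rank_ge \<S> m (Z \<inter> S j)}"
    have "strict_mono r" unfolding r_def by (rule strict_mono_enumerate[OF inf])
    then have "S \<circ> r \<in> \<S>" by (rule sub[OF S(1)])
    moreover have "dividing_rank_ge \<S> m (Z \<inter> (S \<circ> r) j)" for j
      using enumerate_in_set[OF inf, of j] by (simp add: r_def)
    ultimately show ?thesis unfolding dividing_rank_ge.simps by blast
  qed
  have "dividing_rank_ge \<S> m (X \<inter> S j) \<or> dividing_rank_ge \<S> m (Y \<inter> S j)" for j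
    using Suc.IH[of "X \<inter> S j" "Y \<inter> S j"] S(2)[of j] by (simp add: Int_Un_distrib2)
  then have "UNIV = {j. dividing_rank_ge \<S> m (X \<inter> S j)} \<union> {j. dividing_rank_ge \<S> m (Y \<inter> S j)}" by auto
  then have "infinite {j. dividing_rank_ge \<S> m (X \<inter> S j)} \<or> infinite {j. dividing_rank_ge \<S> m (Y \<inter> S j)}"
    by (metis finite_UnI infinite_UNIV_nat)
  then show ?case using half by blast
qed auto

lemma dividing_rank_ge_UN:
  assumes sub: "\<And>S r. S \<in> \<S> \<Longrightarrow> strict_mono r \<Longrightarrow> S \<circ> r \<in> \<S>"
    and "finite I" "dividing_rank_ge \<S> m (\<Union>i\<in>I. X i)"
  shows "\<exists>i\<in>I. dividing_rank_ge \<S> m (X i)"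
  using assms(2,3)
proof (induction I rule: finite_induct)
  case empty
  then have "dividing_rank_ge \<S> m {}" by simp
  moreover have "\<not> dividing_rank_ge \<S> k ({} :: 'a set)" for k by (induction k) auto
  ultimately show ?case by blast
next
  case (insert i I)
  then show ?case using dividing_rank_ge_Un[OF sub, of m "X i" "\<Union>i\<in>I. X i"] by auto
qed

lemma dividing_rank_ge_image:
  assumes "\<And>S. S \<in> \<S> \<Longrightarrow> \<exists>S'\<in>\<S>. \<forall>j. f ` S j \<subseteq> S' j"
  shows "dividing_rank_ge \<S> m X \<Longrightarrow> dividing_rank_ge \<S> m (f ` X)"
proof (induction m arbitrary: X)
  case (Suc m)
  then obtain S where S: "S \<in> \<S>" "\<And>j. dividing_rank_ge \<S> m (f ` (X \<inter> S j))" by auto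
  obtain S' where S': "S' \<in> \<S>" "\<And>j. f ` S j \<subseteq> S' j" using assms[OF S(1)] by blast
  have "dividing_rank_ge \<S> m (f ` X \<inter> S' j)" for j
    by (rule dividing_rank_ge_mono[OF S(2)[of j]]) (use S'(2)[of j] in auto)
  then show ?case using S'(1) by auto
qed simp

text \<open>Binary splitting: \<open>X\<close> carries a complete binary tree of the given height in which every node is cut
in two by a member of \<open>\<F>\<close>.\<close>

primrec splits :: "'a set set \<Rightarrow> nat \<Rightarrow> 'a set \<Rightarrow> bool" where
  "splits \<F> 0 X \<longleftrightarrow> X \<noteq> {}"
| "splits \<F> (Suc m) X \<longleftrightarrow> (\<exists>S\<in>\<F>. splits \<F> m (X \<inter> S) \<and> splits \<F> m (X - S))"

lemma splits_mono: "splits \<F> m X \<Longrightarrow> X \<subseteq> Y \<Longrightarrow> splits \<F> m Y"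
proof (induction m arbitrary: X Y)
  case (Suc m)
  then obtain S where S: "S \<in> \<F>" "splits \<F> m (X \<inter> S)" "splits \<F> m (X - S)" by auto
  have "X \<inter> S \<subseteq> Y \<inter> S" "X - S \<subseteq> Y - S" using Suc.prems by auto
  then show ?case using S Suc.IH unfolding splits.simps by blast
qed auto

lemma splits_nonempty: "splits \<F> m X \<Longrightarrow> X \<noteq> {}"
  by (induction m arbitrary: X) auto

text \<open>Some term of the witnessing sequence must leave a complement of rank at least \<open>m\<close>.  Otherwise
what is left of \<open>X\<close> can be intersected with one term after the other and keep rank at least \<open>m\<close>,
since the rank of a union is attained by a part; but after \<open>K\<close> such steps nothing is left.\<close>

lemma dividing_rank_ge_imp_splits:
  assumes sub: "\<And>S r. S \<in> \<S> \<Longrightarrow> strict_mono r \<Longrightarrow> S \<circ> r \<in> \<S>"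
    and inc: "\<And>S. S \<in> \<S> \<Longrightarrow> (\<Inter>j<K. S j) = {}"
    and F: "\<And>S j. S \<in> \<S> \<Longrightarrow> S j \<in> \<F>"
  shows "dividing_rank_ge \<S> m X \<Longrightarrow> splits \<F> m X"
proof (induction m arbitrary: X)
  case (Suc m)
  then obtain S where S: "S \<in> \<S>" "\<And>j. dividing_rank_ge \<S> m (X \<inter> S j)" by auto
  have "\<exists>j. dividing_rank_ge \<S> m (X - S j)"
  proof (rule ccontr)
    assume no: "\<not> ?thesis"
    have "dividing_rank_ge \<S> m (X \<inter> (\<Inter>j<l. S j))" for l
    proof (induction l)
      case 0
      show ?case using dividing_rank_ge_mono[OF S(2)[of 0]] by auto
    next
      case (Suc l)
      let ?Y = "X \<inter> (\<Inter>j<l. S j)"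
      have "?Y = (?Y \<inter> S l) \<union> (?Y - S l)" by auto
      then have "dividing_rank_ge \<S> m (?Y \<inter> S l) \<or> dividing_rank_ge \<S> m (?Y - S l)"
        using dividing_rank_ge_Un[OF sub, of m "?Y \<inter> S l" "?Y - S l"] Suc by auto
      moreover have "\<not> dividing_rank_ge \<S> m (?Y - S l)"
        using no dividing_rank_ge_mono[of \<S> m "?Y - S l" "X - S l"] by blast
      ultimately have "dividing_rank_ge \<S> m (?Y \<inter> S l)" by blast
      moreover have "?Y \<inter> S l = X \<inter> (\<Inter>j<Suc l. S j)" by (auto simp: less_Suc_eq)
      ultimately show ?case by simp
    qed
    from this[of K] have "splits \<F> m {}" using Suc.IH inc[OF S(1)] by fastforce
    then show False using splits_nonempty by blast
  qed
  then show ?case using S F Suc.IH by (auto intro!: bexI)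
qed auto

text \<open>Regard \<open>\<F>\<close> and \<open>\<G>\<close> as two colours of the nodes of a tree.  If the root has the first colour and
neither side contains a tree of height \<open>n\<close> in the second, then both sides contain one of height
\<open>m - 1\<close> in the first, and the root joins these.\<close>

lemma splits_Un:
  "splits (\<F> \<union> \<G>) (m + n) X \<Longrightarrow> splits \<F> m X \<or> splits \<G> n X"
proof (induction "m + n" arbitrary: m n X)
  case 0
  then show ?case by auto
next
  case (Suc N)
  show ?case
  proof (cases "m = 0 \<or> n = 0")
    case True
    then show ?thesis using splits_nonempty[OF Suc.prems] by auto
  next
    case False
    then obtain m' n' where mn: "m = Suc m'" "n = Suc n'" by (meson not0_implies_Suc)
    from Suc.prems Suc.hyps(2)[symmetric] obtain S where S: "S \<in> \<F> \<union> \<G>"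
      "splits (\<F> \<union> \<G>) N (X \<inter> S)" "splits (\<F> \<union> \<G>) N (X - S)" by auto
    have sub: "X \<inter> S \<subseteq> X" "X - S \<subseteq> X" by auto
    have 1: "N = m' + n" "N = m + n'" using mn Suc.hyps(2) by auto
    from S(1) show ?thesis
    proof
      assume "S \<in> \<F>"
      then show ?thesis using Suc.hyps(1)[OF 1(1)] S(2,3) 1(1) mn(1) splits_mono[OF _ sub(1)]
          splits_mono[OF _ sub(2)] by (metis splits.simps(2))
    next
      assume "S \<in> \<G>"
      then show ?thesis using Suc.hyps(1)[OF 1(2)] S(2,3) 1(2) mn(2) splits_mono[OF _ sub(1)]
          splits_mono[OF _ sub(2)] by (metis splits.simps(2))
    qed
  qed
qed

lemma splits_finite_UN:
  assumes "finite I" "\<And>m. splits (\<Union>i\<in>I. \<F> i) m X"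
  shows "\<exists>i\<in>I. \<forall>m. splits (\<F> i) m X"
proof (rule ccontr)
  assume "\<not> ?thesis"
  then obtain h where h: "\<And>i. i \<in> I \<Longrightarrow> \<not> splits (\<F> i) (h i) X" by metis
  have "\<exists>m. \<not> splits (\<Union>i\<in>J. \<F> i) m X" if "finite J" "J \<subseteq> I" for J
    using that
  proof (induction J rule: finite_induct)
    case empty
    show ?case by (auto intro!: exI[of _ 1])
  next
    case (insert j J)
    then obtain m where "\<not> splits (\<Union>i\<in>J. \<F> i) m X" by auto
    then have "\<not> splits (\<F> j \<union> (\<Union>i\<in>J. \<F> i)) (h j + m) X"
      using splits_Un h insert.prems by blast
    then show ?case by auto
  qed
  then show False using assms by blast
qed

text \<open>The relation \<open>R\<close> between indices is a parameter because one step of the construction of ladders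
produces either \<open>(\<le>)\<close> or the converse of \<open>(<)\<close>, and both are finally turned into \<open>(<)\<close>.\<close>

definition is_ladder ::
    "(nat \<Rightarrow> nat \<Rightarrow> bool) \<Rightarrow> 'a set set \<Rightarrow> 'a set \<Rightarrow> nat \<Rightarrow> (nat \<Rightarrow> 'a) \<Rightarrow> (nat \<Rightarrow> 'a set) \<Rightarrow> bool" where
  "is_ladder R \<F> X n x S \<longleftrightarrow> (\<forall>i<n. x i \<in> X \<and> S i \<in> \<F>) \<and> (\<forall>i<n. \<forall>j<n. x i \<in> S j \<longleftrightarrow> R i j)"

definition ladder :: "(nat \<Rightarrow> nat \<Rightarrow> bool) \<Rightarrow> 'a set set \<Rightarrow> 'a set \<Rightarrow> nat \<Rightarrow> bool" where
  "ladder R \<F> X n \<longleftrightarrow> (\<exists>x S. is_ladder R \<F> X n x S)"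

lemma ladder_mono:
  assumes "ladder R \<F> X n" "\<F> \<subseteq> \<G>" "X \<subseteq> Y"
  shows "ladder R \<G> Y n"
proof -
  obtain x S where "is_ladder R \<F> X n x S" using assms(1) unfolding ladder_def by blast
  then have "is_ladder R \<G> Y n x S" using assms(2,3) unfolding is_ladder_def by auto
  then show ?thesis unfolding ladder_def by blast
qed

text \<open>A ladder grows at its lower end by a pair \<open>(x, S)\<close> on which all later sets, respectively
all later points, agree, in opposite senses.\<close>

lemma ladder_Suc:
  assumes "ladder R {T\<in>\<F>. x \<in> T \<longleftrightarrow> c} {y\<in>X. y \<in> S \<longleftrightarrow> \<not> c} n"
    and "x \<in> X" "S \<in> \<F>" "x \<in> S \<longleftrightarrow> R 0 0"
    and "\<And>i. R 0 (Suc i) \<longleftrightarrow> c" "\<And>i. R (Suc i) 0 \<longleftrightarrow> \<not> c" "\<And>i j. R (Suc i) (Suc j) \<longleftrightarrow> R i j"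
  shows "ladder R \<F> X (Suc n)"
proof -
  obtain y T where yT: "is_ladder R {T\<in>\<F>. x \<in> T \<longleftrightarrow> c} {y\<in>X. y \<in> S \<longleftrightarrow> \<not> c} n y T"
    using assms(1) unfolding ladder_def by blast
  have "case_nat x y i \<in> X \<and> case_nat S T i \<in> \<F>" if "i < Suc n" for i
    using that yT assms(2,3) unfolding is_ladder_def by (cases i) auto
  moreover have "case_nat x y i \<in> case_nat S T j \<longleftrightarrow> R i j" if "i < Suc n" "j < Suc n" for i j
    using that yT assms(4-) unfolding is_ladder_def by (cases i; cases j) auto
  ultimately have "is_ladder R \<F> X (Suc n) (case_nat x y) (case_nat S T)"
    unfolding is_ladder_def by simp
  then show ?thesis unfolding ladder_def by blast
qed

text \<open>Pick \<open>x \<in> X\<close> and colour the members of \<open>\<F>\<close> by whether they contain \<open>x\<close>; a tree of about half the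
height survives in one colour.  If its sets contain \<open>x\<close>, continue outside its root \<open>S\<close>, otherwise inside it.
Each step contributes a pair to one of the two kinds of ladder, and \<open>a + b\<close> bounds the number of
steps; halving the height in each step explains the recursion \<open>h \<mapsto> 2 h + 2\<close>.\<close>

lemma splits_imp_half_ladder:
  "splits \<F> (((\<lambda>h. 2 * h + 2) ^^ (a + b)) 0) X \<Longrightarrow>
     ladder (\<le>) \<F> X a \<or> ladder (\<lambda>i j. j < i) \<F> X b"
proof (induction "a + b" arbitrary: a b X \<F>)
  case 0
  then show ?case by (auto simp: ladder_def is_ladder_def)
next
  case (Suc N)
  let ?h = "((\<lambda>h. 2 * h + 2) ^^ N) 0 :: nat"
  show ?case
  proof (cases "a = 0 \<or> b = 0")
    case True
    then show ?thesis by (auto simp: ladder_def is_ladder_def)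
  next
    case False
    then obtain a' b' where ab: "a = Suc a'" "b = Suc b'" by (meson not0_implies_Suc)
    have N: "N = a' + b" "N = a + b'" using ab Suc.hyps(2) by auto
    obtain x where x: "x \<in> X" using splits_nonempty[OF Suc.prems] by auto
    let ?F = "\<lambda>c. {S\<in>\<F>. x \<in> S \<longleftrightarrow> c}"
    have F: "?F True \<union> ?F False = \<F>" by auto
    have "splits \<F> (Suc ?h + Suc ?h) X" using Suc.prems by (simp flip: Suc.hyps(2) add: mult_2)
    then have "splits (?F True) (Suc ?h) X \<or> splits (?F False) (Suc ?h) X"
      using splits_Un[of "?F True" "?F False"] unfolding F by blast
    then show ?thesis
    proof
      assume "splits (?F True) (Suc ?h) X"
      then obtain S where S: "S \<in> \<F>" "x \<in> S" "splits (?F True) ?h (X - S)" by auto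
      have "ladder (\<le>) (?F True) (X - S) a' \<or> ladder (\<lambda>i j. j < i) (?F True) (X - S) b"
        by (rule Suc.hyps(1)[OF N(1)]) (use S(3) N(1) in simp)
      moreover have "X - S = {y\<in>X. y \<in> S \<longleftrightarrow> \<not> True}" by auto
      moreover have "ladder (\<le>) \<F> X a" if "ladder (\<le>) (?F True) {y\<in>X. y \<in> S \<longleftrightarrow> \<not> True} a'"
        unfolding ab(1) by (rule ladder_Suc[OF that x S(1)]) (use S(2) in auto)
      moreover have "ladder (\<lambda>i j. j < i) \<F> X b" if "ladder (\<lambda>i j. j < i) (?F True) (X - S) b"
        by (rule ladder_mono[OF that]) auto
      ultimately show ?thesis by metis
    next
      assume "splits (?F False) (Suc ?h) X"
      then obtain S where S: "S \<in> \<F>" "x \<notin> S" "splits (?F False) ?h (X \<inter> S)" by auto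
      have "ladder (\<le>) (?F False) (X \<inter> S) a \<or> ladder (\<lambda>i j. j < i) (?F False) (X \<inter> S) b'"
        by (rule Suc.hyps(1)[OF N(2)]) (use S(3) N(2) in simp)
      moreover have "X \<inter> S = {y\<in>X. y \<in> S \<longleftrightarrow> \<not> False}" by auto
      moreover have "ladder (\<lambda>i j. j < i) \<F> X b"
        if "ladder (\<lambda>i j. j < i) (?F False) {y\<in>X. y \<in> S \<longleftrightarrow> \<not> False} b'"
        unfolding ab(2) by (rule ladder_Suc[OF that x S(1)]) (use S(2) in auto)
      moreover have "ladder (\<le>) \<F> X a" if "ladder (\<le>) (?F False) (X \<inter> S) a"
        by (rule ladder_mono[OF that]) auto
      ultimately show ?thesis by metis
    qed
  qed
qed

lemma splits_imp_ladder:
  assumes "\<And>m. splits \<F> m X"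
  shows "ladder (<) \<F> X n"
proof -
  from splits_imp_half_ladder[OF assms, of "Suc n" n] show ?thesis
  proof
    assume "ladder (\<le>) \<F> X (Suc n)"
    then obtain x S where *: "is_ladder (\<le>) \<F> X (Suc n) x S" unfolding ladder_def by blast
    have "is_ladder (<) \<F> X n (\<lambda>i. x (Suc i)) S"
      using * unfolding is_ladder_def by (auto simp: Suc_le_eq)
    then show ?thesis unfolding ladder_def by blast
  next
    assume "ladder (\<lambda>i j. j < i) \<F> X n"
    then obtain x S where *: "is_ladder (\<lambda>i j. j < i) \<F> X n x S" unfolding ladder_def by blast
    then have "x (n - Suc i) \<in> S (n - Suc j) \<longleftrightarrow> i < j" if "i < n" "j < n" for i j
      using that by (auto simp: is_ladder_def)
    then have "is_ladder (<) \<F> X n (\<lambda>i. x (n - Suc i)) (\<lambda>i. S (n - Suc i))"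
      using * unfolding is_ladder_def by simp
    then show ?thesis unfolding ladder_def by blast
  qed
qed

section \<open>Renaming of variables and automorphisms\<close>

primrec ren_tm :: "(nat \<Rightarrow> nat) \<Rightarrow> 'f tm \<Rightarrow> 'f tm" where
  "ren_tm r (Var i) = Var (r i)"
| "ren_tm r (App f ts) = App f (map (ren_tm r) ts)"

primrec ren :: "(nat \<Rightarrow> nat) \<Rightarrow> ('f, 'r, 's) fm \<Rightarrow> ('f, 'r, 's) fm" where
  "ren r (Eq t u) = Eq (ren_tm r t) (ren_tm r u)"
| "ren r (Rel R ts) = Rel R (map (ren_tm r) ts)"
| "ren r (Neg \<phi>) = Neg (ren r \<phi>)"
| "ren r (Conj \<phi> \<psi>) = Conj (ren r \<phi>) (ren r \<psi>)"
| "ren r (Exi s \<phi>) = Exi s (ren (case_nat 0 (\<lambda>i. Suc (r i))) \<phi>)"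

text \<open>\<open>r\<close> finds each entry of the first list in the second; applied to lists of sorts and to
environments alike, this is what renaming along \<open>r\<close> requires.\<close>

definition reindexes :: "(nat \<Rightarrow> nat) \<Rightarrow> 'a list \<Rightarrow> 'a list \<Rightarrow> bool" where
  "reindexes r e e' \<longleftrightarrow> (\<forall>i<length e. r i < length e' \<and> e' ! r i = e ! i)"

lemma reindexes_Cons: "reindexes r e e' \<Longrightarrow> reindexes (case_nat 0 (\<lambda>i. Suc (r i))) (m # e) (m # e')"
  unfolding reindexes_def by (auto simp: nth_Cons split: nat.splits)

lemma has_sort_ren_tm:
  assumes "has_sort M \<Gamma> t s" "reindexes r \<Gamma> \<Delta>"
  shows "has_sort M \<Delta> (ren_tm r t) s"
  using assms(1)
proof induction
  case (1 i)
  then show ?case using assms(2) has_sort.intros(1)[of "r i" \<Delta> M] by (auto simp: reindexes_def)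
next
  case (2 ts f)
  then have "list_all2 (has_sort M \<Delta>) (map (ren_tm r) ts) (fun_dom M f)"
    by (auto simp: list_all2_conv_all_nth)
  then show ?case by (auto intro: has_sort.intros)
qed

lemma tm_val_ren_tm:
  assumes "has_sort M (sorts M e) t s" "reindexes r e e'"
  shows "tm_val M e' (ren_tm r t) = tm_val M e t"
  using assms(1)
proof induction
  case (1 i)
  then show ?case using assms(2) by (auto simp: reindexes_def)
next
  case (2 ts f)
  then have "map (tm_val M e' \<circ> ren_tm r) ts = map (tm_val M e) ts"
    by (auto simp: list_all2_conv_all_nth in_set_conv_nth)
  then show ?case by (simp only: ren_tm.simps tm_val.simps map_map)
qed

lemma wf_fm_ren: "wf_fm M \<Gamma> \<phi> \<Longrightarrow> reindexes r \<Gamma> \<Delta> \<Longrightarrow> wf_fm M \<Delta> (ren r \<phi>)"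
proof (induction \<phi> arbitrary: r \<Gamma> \<Delta>)
  case (Exi s \<phi>)
  show ?case using Exi.IH[OF _ reindexes_Cons[OF Exi.prems(2)]] Exi.prems(1) by simp
qed (auto simp: list_all2_conv_all_nth intro: has_sort_ren_tm)

lemma sat_ren:
  "wf_fm M (sorts M e) \<phi> \<Longrightarrow> reindexes r e e' \<Longrightarrow> sat M e' (ren r \<phi>) \<longleftrightarrow> sat M e \<phi>"
proof (induction \<phi> arbitrary: r e e')
  case (Eq t u)
  then show ?case by (auto simp: tm_val_ren_tm)
next
  case (Rel R ts)
  then have "map (tm_val M e' \<circ> ren_tm r) ts = map (tm_val M e) ts"
    using tm_val_ren_tm[OF _ Rel.prems(2)]
    by (force simp: list_all2_conv_all_nth in_set_conv_nth)
  then show ?case by (simp only: ren.simps sat.simps map_map)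
next
  case (Exi s \<phi>)
  have "sat M (m # e') (ren (case_nat 0 (\<lambda>i. Suc (r i))) \<phi>) \<longleftrightarrow> sat M (m # e) \<phi>"
    if "sort_of M m = s" for m
    by (rule Exi.IH[OF _ reindexes_Cons]) (use Exi.prems that in auto)
  then show ?case by auto
next
  case (Conj \<phi> \<psi>)
  then show ?case by (auto simp: Conj.IH[OF _ Conj.prems(2)])
qed auto

lemma automorphisms_sort: "\<sigma> \<in> automorphisms M \<Longrightarrow> sort_of M (\<sigma> m) = sort_of M m"
  by (simp add: automorphisms_def)

lemma automorphisms_sorts [simp]: "\<sigma> \<in> automorphisms M \<Longrightarrow> sorts M (map \<sigma> x) = sorts M x"
  by (simp add: automorphisms_def)

lemma automorphisms_sort_comp [simp]: "\<sigma> \<in> automorphisms M \<Longrightarrow> map (sort_of M \<circ> \<sigma>) x = sorts M x"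
  by (simp add: automorphisms_def)

lemma automorphisms_inj: "\<sigma> \<in> automorphisms M \<Longrightarrow> map \<sigma> x = map \<sigma> y \<longleftrightarrow> x = y"
  by (simp add: automorphisms_def bij_def inj_eq)

lemma automorphisms_surj_elem: "\<sigma> \<in> automorphisms M \<Longrightarrow> \<exists>m'. \<sigma> m' = m"
  using surjD[of \<sigma> m] bij_is_surj[of \<sigma>] by (auto simp: automorphisms_def)

lemma automorphisms_surj:
  assumes "\<sigma> \<in> automorphisms M" shows "\<exists>y. map \<sigma> y = x"
proof (induction x)
  case (Cons m x)
  obtain y where "map \<sigma> y = x" using Cons by blast
  moreover obtain m' where "\<sigma> m' = m" using automorphisms_surj_elem[OF assms] by blast
  ultimately have "map \<sigma> (m' # y) = m # x" by simp
  then show ?case by (rule exI)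
qed simp

locale fo_structure =
  fixes M :: "('f, 'r, 's, 'm) fo_struct"
  assumes wf_struct: "wf_struct M"
begin

lemma tm_val_automorphism:
  assumes "has_sort M (sorts M e) t s" "\<sigma> \<in> automorphisms M"
  shows "tm_val M (map \<sigma> e) t = \<sigma> (tm_val M e t) \<and> sort_of M (tm_val M e t) = s"
  using assms(1)
proof induction
  case (1 i)
  then show ?case by simp
next
  case (2 ts f)
  have 1: "map (tm_val M (map \<sigma> e)) ts = map \<sigma> (map (tm_val M e) ts)"
    and 2: "sorts M (map (tm_val M e) ts) = fun_dom M f"
    using 2 by (auto simp: list_all2_conv_all_nth in_set_conv_nth intro!: nth_equalityI)
  have "\<sigma> (fun_int M f (map (tm_val M e) ts)) = fun_int M f (map \<sigma> (map (tm_val M e) ts))"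
    using assms(2) 2 unfolding automorphisms_def by blast
  moreover have "sort_of M (fun_int M f (map (tm_val M e) ts)) = fun_ran M f"
    using wf_struct 2 unfolding wf_struct_def by blast
  ultimately show ?case by (simp add: 1 del: map_map)
qed

lemma sat_automorphism:
  assumes "\<sigma> \<in> automorphisms M"
  shows "wf_fm M (sorts M e) \<phi> \<Longrightarrow> sat M (map \<sigma> e) \<phi> \<longleftrightarrow> sat M e \<phi>"
proof (induction \<phi> arbitrary: e)
  case (Eq t u)
  then obtain s where s: "has_sort M (sorts M e) t s" "has_sort M (sorts M e) u s" by auto
  show ?case using tm_val_automorphism[OF s(1) assms] tm_val_automorphism[OF s(2) assms] assms
    by (auto simp: automorphisms_def bij_def inj_eq)
next
  case (Rel R ts)
  then have 1: "map (tm_val M (map \<sigma> e)) ts = map \<sigma> (map (tm_val M e) ts)"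
    and 2: "sorts M (map (tm_val M e) ts) = rel_dom M R"
    using tm_val_automorphism[OF _ assms]
    by (force simp: list_all2_conv_all_nth in_set_conv_nth intro!: nth_equalityI)+
  have "rel_int M R (map \<sigma> (map (tm_val M e) ts)) = rel_int M R (map (tm_val M e) ts)"
    using assms 2 unfolding automorphisms_def by blast
  then show ?case by (simp add: 1 del: map_map)
next
  case (Exi s \<phi>)
  have step: "sat M (\<sigma> m # map \<sigma> e) \<phi> \<longleftrightarrow> sat M (m # e) \<phi>" if "sort_of M m = s" for m
    using Exi.IH[of "m # e"] Exi.prems that by simp
  show ?case
  proof
    assume "sat M (map \<sigma> e) (Exi s \<phi>)"
    then obtain m where m: "sort_of M m = s" "sat M (m # map \<sigma> e) \<phi>" by auto
    obtain m' where "\<sigma> m' = m" using automorphisms_surj_elem[OF assms] by blast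
    then show "sat M e (Exi s \<phi>)" using m step automorphisms_sort[OF assms, of m'] by auto
  next
    assume "sat M e (Exi s \<phi>)"
    then obtain m where "sort_of M m = s" "sat M (m # e) \<phi>" by auto
    then show "sat M (map \<sigma> e) (Exi s \<phi>)"
      using step automorphisms_sort[OF assms, of m] by auto
  qed
qed auto

section \<open>A calculus of definable predicates\<close>

text \<open>Definability over \<open>\<emptyset>\<close> of a predicate of several tuples.  An environment \<open>v\<close> assigns a
tuple to each block name, \<open>\<Gamma>\<close> gives the sorts of each block, and only the blocks listed in \<open>ns\<close>
matter.  Naming blocks by numbers instead of concatenating tuples keeps formulas
with quantifiers over tuples manageable.\<close>

definition definable_pred :: "(nat \<Rightarrow> 's list) \<Rightarrow> nat list \<Rightarrow> ((nat \<Rightarrow> 'm list) \<Rightarrow> bool) \<Rightarrow> bool" where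
  "definable_pred \<Gamma> ns P \<longleftrightarrow> (\<exists>\<phi>. wf_fm M (concat (map \<Gamma> ns)) \<phi> \<and>
     (\<forall>v. (\<forall>n\<in>set ns. sorts M (v n) = \<Gamma> n) \<longrightarrow> (sat M (concat (map v ns)) \<phi> \<longleftrightarrow> P v)))"

text \<open>Quantification over the block \<open>n\<close> as an operator on predicates, so that definability of a compound
predicate can be derived from its shape by the introduction rules.\<close>

definition ex_block :: "(nat \<Rightarrow> 's list) \<Rightarrow> nat \<Rightarrow> ((nat \<Rightarrow> 'm list) \<Rightarrow> bool) \<Rightarrow> (nat \<Rightarrow> 'm list) \<Rightarrow> bool" where
  "ex_block \<Gamma> n P v \<longleftrightarrow> (\<exists>y. sorts M y = \<Gamma> n \<and> P (v(n := y)))"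

lemma definable_pred_cong:
  assumes "\<And>v. (\<forall>n\<in>set ns. sorts M (v n) = \<Gamma> n) \<Longrightarrow> P v \<longleftrightarrow> Q v" "definable_pred \<Gamma> ns P"
  shows "definable_pred \<Gamma> ns Q"
proof -
  obtain \<phi> where "wf_fm M (concat (map \<Gamma> ns)) \<phi>"
    "\<forall>v. (\<forall>n\<in>set ns. sorts M (v n) = \<Gamma> n) \<longrightarrow> (sat M (concat (map v ns)) \<phi> \<longleftrightarrow> P v)"
    using assms(2) unfolding definable_pred_def by blast
  then show ?thesis unfolding definable_pred_def using assms(1) by (intro exI[of _ \<phi>]) simp
qed

text \<open>The positions of the entries of a concatenation of blocks, in a form that does not depend on the
contents of the blocks: one reindexing of positions serves all environments at once.\<close>

definition block_pos :: "(nat \<Rightarrow> nat) \<Rightarrow> nat list \<Rightarrow> (nat \<times> nat) list" where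
  "block_pos l ns = concat (map (\<lambda>n. map (Pair n) [0..<l n]) ns)"

lemma concat_block_pos:
  "\<forall>n\<in>set ns. length (g n) = l n \<Longrightarrow> concat (map g ns) = map (\<lambda>(n, i). g n ! i) (block_pos l ns)"
proof (induction ns)
  case (Cons n ns)
  then show ?case by (auto simp: block_pos_def map_concat intro: nth_equalityI)
qed (simp add: block_pos_def)

lemma reindexes_blocks:
  assumes "reindexes r (block_pos l is) (block_pos l ns)" "set is \<subseteq> set ns"
    and "\<forall>n\<in>set ns. length (g n) = l n"
  shows "reindexes r (concat (map g is)) (concat (map g ns))"
proof -
  have "\<forall>n\<in>set is. length (g n) = l n" using assms by auto
  then show ?thesis using assms(1) concat_block_pos[OF assms(3)] concat_block_pos[of "is" g l]
    by (auto simp: reindexes_def)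
qed

lemma ex_reindexes_blocks:
  assumes "set is \<subseteq> set ns"
  shows "\<exists>r. reindexes r (block_pos l is) (block_pos l ns)"
proof -
  have "set (block_pos l is) \<subseteq> set (block_pos l ns)"
    using assms by (auto simp: block_pos_def)
  then have "\<forall>i. \<exists>k. i < length (block_pos l is) \<longrightarrow>
      k < length (block_pos l ns) \<and> block_pos l ns ! k = block_pos l is ! i"
    by (metis in_set_conv_nth nth_mem subsetD)
  then show ?thesis unfolding reindexes_def by metis
qed

text \<open>In particular the order of the blocks in the list is immaterial.\<close>

lemma definable_pred_subset:
  assumes "definable_pred \<Gamma> is P" "set is \<subseteq> set ns"
  shows "definable_pred \<Gamma> ns P"
proof -
  obtain \<phi> where \<phi>: "wf_fm M (concat (map \<Gamma> is)) \<phi>"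
    "\<And>v. (\<forall>n\<in>set is. sorts M (v n) = \<Gamma> n) \<Longrightarrow> (sat M (concat (map v is)) \<phi> \<longleftrightarrow> P v)"
    using assms(1) unfolding definable_pred_def by blast
  obtain r where r: "reindexes r (block_pos (\<lambda>n. length (\<Gamma> n)) is) (block_pos (\<lambda>n. length (\<Gamma> n)) ns)"
    using ex_reindexes_blocks[OF assms(2)] by blast
  have "wf_fm M (concat (map \<Gamma> ns)) (ren r \<phi>)"
    by (rule wf_fm_ren[OF \<phi>(1)], rule reindexes_blocks[OF r assms(2)]) auto
  moreover have "sat M (concat (map v ns)) (ren r \<phi>) \<longleftrightarrow> P v"
    if v: "\<forall>n\<in>set ns. sorts M (v n) = \<Gamma> n" for v
  proof -
    have "\<forall>n\<in>set ns. length (v n) = length (\<Gamma> n)" using v by (metis length_map)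
    then have "reindexes r (concat (map v is)) (concat (map v ns))"
      by (rule reindexes_blocks[OF r assms(2)])
    moreover have v': "\<forall>n\<in>set is. sorts M (v n) = \<Gamma> n" using v assms(2) by auto
    then have "sorts M (concat (map v is)) = concat (map \<Gamma> is)"
      by (simp add: map_concat cong: map_cong)
    ultimately show ?thesis using sat_ren[of M "concat (map v is)" \<phi> r] \<phi> v' by simp
  qed
  ultimately show ?thesis unfolding definable_pred_def by blast
qed

lemma definable_pred_neg:
  assumes "definable_pred \<Gamma> ns P" shows "definable_pred \<Gamma> ns (\<lambda>v. \<not> P v)"
proof -
  obtain \<phi> where "wf_fm M (concat (map \<Gamma> ns)) \<phi>"
    "\<forall>v. (\<forall>n\<in>set ns. sorts M (v n) = \<Gamma> n) \<longrightarrow> (sat M (concat (map v ns)) \<phi> \<longleftrightarrow> P v)"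
    using assms unfolding definable_pred_def by blast
  then show ?thesis unfolding definable_pred_def by (intro exI[of _ "Neg \<phi>"]) simp
qed

lemma definable_pred_conj:
  assumes "definable_pred \<Gamma> ns P" "definable_pred \<Gamma> ns Q" shows "definable_pred \<Gamma> ns (\<lambda>v. P v \<and> Q v)"
proof -
  obtain \<phi> where "wf_fm M (concat (map \<Gamma> ns)) \<phi>"
    "\<forall>v. (\<forall>n\<in>set ns. sorts M (v n) = \<Gamma> n) \<longrightarrow> (sat M (concat (map v ns)) \<phi> \<longleftrightarrow> P v)"
    using assms(1) unfolding definable_pred_def by blast
  moreover obtain \<psi> where "wf_fm M (concat (map \<Gamma> ns)) \<psi>"
    "\<forall>v. (\<forall>n\<in>set ns. sorts M (v n) = \<Gamma> n) \<longrightarrow> (sat M (concat (map v ns)) \<psi> \<longleftrightarrow> Q v)"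
    using assms(2) unfolding definable_pred_def by blast
  ultimately show ?thesis unfolding definable_pred_def by (intro exI[of _ "Conj \<phi> \<psi>"]) simp
qed

lemma definable_pred_imp:
  assumes "definable_pred \<Gamma> ns P" "definable_pred \<Gamma> ns Q" shows "definable_pred \<Gamma> ns (\<lambda>v. P v \<longrightarrow> Q v)"
  using definable_pred_neg[OF definable_pred_conj[OF assms(1) definable_pred_neg[OF assms(2)]]] by simp

lemma definable_pred_iff:
  assumes "definable_pred \<Gamma> ns P" "definable_pred \<Gamma> ns Q" shows "definable_pred \<Gamma> ns (\<lambda>v. P v \<longleftrightarrow> Q v)"
  using definable_pred_conj[OF definable_pred_imp[OF assms] definable_pred_imp[OF assms(2,1)]] unfolding iff_conv_conj_imp .

lemma ex_formula_block:
  "wf_fm M (ss @ \<Delta>) \<phi> \<Longrightarrow> \<exists>\<psi>. wf_fm M \<Delta> \<psi> \<and>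
     (\<forall>e. sorts M e = \<Delta> \<longrightarrow> (sat M e \<psi> \<longleftrightarrow> (\<exists>y. sorts M y = ss \<and> sat M (y @ e) \<phi>)))"
proof (induction ss arbitrary: \<phi>)
  case (Cons s ss)
  then obtain \<psi> where \<psi>: "wf_fm M \<Delta> \<psi>"
    "\<And>e. sorts M e = \<Delta> \<Longrightarrow> sat M e \<psi> \<longleftrightarrow> (\<exists>y. sorts M y = ss \<and> sat M (y @ e) (Exi s \<phi>))"
    by (metis append_Cons wf_fm.simps(5))
  have "(\<exists>y. sorts M y = ss \<and> sat M (y @ e) (Exi s \<phi>)) \<longleftrightarrow>
      (\<exists>y. sorts M y = s # ss \<and> sat M (y @ e) \<phi>)" for e
    by (fastforce simp: map_eq_Cons_conv)
  then show ?case using \<psi> by auto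
qed auto

lemma definable_pred_ex_block:
  assumes "definable_pred \<Gamma> (n # ns) P" "n \<notin> set ns"
  shows "definable_pred \<Gamma> ns (ex_block \<Gamma> n P)"
proof -
  obtain \<phi> where \<phi>: "wf_fm M (\<Gamma> n @ concat (map \<Gamma> ns)) \<phi>"
    "\<And>v. (\<forall>k\<in>set (n # ns). sorts M (v k) = \<Gamma> k) \<Longrightarrow> (sat M (v n @ concat (map v ns)) \<phi> \<longleftrightarrow> P v)"
    using assms(1) unfolding definable_pred_def by auto
  obtain \<psi> where \<psi>: "wf_fm M (concat (map \<Gamma> ns)) \<psi>" "\<And>e. sorts M e = concat (map \<Gamma> ns) \<Longrightarrow>
      sat M e \<psi> \<longleftrightarrow> (\<exists>y. sorts M y = \<Gamma> n \<and> sat M (y @ e) \<phi>)"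
    using ex_formula_block[OF \<phi>(1)] by blast
  have "sat M (concat (map v ns)) \<psi> \<longleftrightarrow> ex_block \<Gamma> n P v" if v: "\<forall>k\<in>set ns. sorts M (v k) = \<Gamma> k" for v
  proof -
    have "sorts M (concat (map v ns)) = concat (map \<Gamma> ns)"
      using v by (simp add: map_concat cong: map_cong)
    moreover have "sat M (y @ concat (map v ns)) \<phi> \<longleftrightarrow> P (v(n := y))" if "sorts M y = \<Gamma> n" for y
    proof -
      have "map (v(n := y)) ns = map v ns" using assms(2) by auto
      then show ?thesis using \<phi>(2)[of "v(n := y)"] v that assms(2) by auto
    qed
    ultimately show ?thesis using \<psi>(2) unfolding ex_block_def by auto
  qed
  then show ?thesis using \<psi>(1) unfolding definable_pred_def by blast
qed

lemma definable_empty_iff: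
  "definable M {} ss X \<longleftrightarrow> (\<exists>\<phi>. wf_fm M ss \<phi> \<and> X = {x. sorts M x = ss \<and> sat M x \<phi>})"
  by (auto simp: definable_def pfms_def rlz_def psat_def)

lemma definable_pred_mem:
  assumes "definable M {} (concat (map \<Gamma> is)) X" "set is \<subseteq> set ns"
  shows "definable_pred \<Gamma> ns (\<lambda>v. concat (map v is) \<in> X)"
proof (rule definable_pred_subset[OF _ assms(2)])
  obtain \<phi> where \<phi>: "wf_fm M (concat (map \<Gamma> is)) \<phi>"
    "X = {x. sorts M x = concat (map \<Gamma> is) \<and> sat M x \<phi>}"
    using assms(1) definable_empty_iff by blast
  have "sorts M (concat (map v is)) = concat (map \<Gamma> is)"
    if "\<forall>n\<in>set is. sorts M (v n) = \<Gamma> n" for v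
    using that by (simp add: map_concat cong: map_cong)
  then show "definable_pred \<Gamma> is (\<lambda>v. concat (map v is) \<in> X)" using \<phi> unfolding definable_pred_def by auto
qed

lemma definable_pred_mem1:
  assumes "definable M {} (\<Gamma> i) X" "i \<in> set ns"
  shows "definable_pred \<Gamma> ns (\<lambda>v. v i \<in> X)"
  using definable_pred_mem[of \<Gamma> "[i]" X ns] assms by simp

lemma definable_pred_mem2:
  assumes "definable M {} (\<Gamma> i @ \<Gamma> j) X" "i \<in> set ns" "j \<in> set ns"
  shows "definable_pred \<Gamma> ns (\<lambda>v. v i @ v j \<in> X)"
  using definable_pred_mem[of \<Gamma> "[i, j]" X ns] assms by simp

lemma definable_pred_mem3:
  assumes "definable M {} (\<Gamma> i @ \<Gamma> j @ \<Gamma> k) X" "i \<in> set ns" "j \<in> set ns" "k \<in> set ns"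
  shows "definable_pred \<Gamma> ns (\<lambda>v. v i @ v j @ v k \<in> X)"
  using definable_pred_mem[of \<Gamma> "[i, j, k]" X ns] assms by simp

text \<open>Over the empty context no equation between variables is available, hence the detour through a
quantifier; its truth value depends on whether the sort is inhabited, and the excluded middle makes up for this.\<close>

lemma ex_sentence: "\<exists>\<phi> :: ('f, 'r, 's) fm. \<forall>\<Gamma> e. wf_fm M \<Gamma> \<phi> \<and> sat M e \<phi>"
proof -
  let ?\<theta> = "Exi (undefined :: 's) (Eq (Var 0) (Var 0)) :: ('f, 'r, 's) fm"
  have "has_sort M (undefined # \<Gamma>) (Var 0) undefined" for \<Gamma>
    using has_sort.intros(1)[of 0 "undefined # \<Gamma>" M] by simp
  then have "\<forall>\<Gamma> e. wf_fm M \<Gamma> (Neg (Conj ?\<theta> (Neg ?\<theta>))) \<and> sat M e (Neg (Conj ?\<theta> (Neg ?\<theta>)))"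
    by auto
  then show ?thesis by blast
qed

lemma definable_pred_True: "definable_pred \<Gamma> ns (\<lambda>v. True)"
proof -
  obtain \<phi> :: "('f, 'r, 's) fm" where "\<forall>\<Gamma> e. wf_fm M \<Gamma> \<phi> \<and> sat M e \<phi>"
    using ex_sentence by blast
  then show ?thesis unfolding definable_pred_def by (intro exI[of _ \<phi>]) simp
qed

lemma definable_pred_ball:
  assumes "finite I" "\<And>i. i \<in> I \<Longrightarrow> definable_pred \<Gamma> ns (P i)"
  shows "definable_pred \<Gamma> ns (\<lambda>v. \<forall>i\<in>I. P i v)"
  using assms
proof (induction I rule: finite_induct)
  case empty
  then show ?case by (simp add: definable_pred_True)
next
  case (insert i I)
  then have "definable_pred \<Gamma> ns (\<lambda>v. P i v \<and> (\<forall>i\<in>I. P i v))" by (intro definable_pred_conj) auto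
  then show ?case by simp
qed

lemma ex_blocks:
  "distinct ns \<Longrightarrow> sorts M x = concat (map \<Gamma> ns) \<Longrightarrow>
     \<exists>v. (\<forall>n\<in>set ns. sorts M (v n) = \<Gamma> n) \<and> x = concat (map v ns)"
proof (induction ns arbitrary: x)
  case (Cons n ns)
  then obtain y z where x: "x = y @ z" "sorts M y = \<Gamma> n" "sorts M z = concat (map \<Gamma> ns)"
    by (auto simp: map_eq_append_conv)
  then obtain v where v: "\<forall>k\<in>set ns. sorts M (v k) = \<Gamma> k" "z = concat (map v ns)"
    using Cons by auto
  have "map (v(n := y)) ns = map v ns" using Cons.prems(1) by auto
  then have "concat (map (v(n := y)) ns) = z" using v(2) by (simp only:)
  then have "x = concat (map (v(n := y)) (n # ns))" using x(1) by (simp del: fun_upd_apply) simp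
  moreover have "\<forall>k\<in>set (n # ns). sorts M ((v(n := y)) k) = \<Gamma> k" using v(1) x(2) by simp
  ultimately show ?case by blast
qed auto

lemma definable_blocks:
  assumes "definable_pred \<Gamma> ns P" "distinct ns"
  shows "definable M {} (concat (map \<Gamma> ns))
    {concat (map v ns) |v. (\<forall>n\<in>set ns. sorts M (v n) = \<Gamma> n) \<and> P v}"
proof -
  obtain \<phi> where \<phi>: "wf_fm M (concat (map \<Gamma> ns)) \<phi>"
    "\<And>v. (\<forall>n\<in>set ns. sorts M (v n) = \<Gamma> n) \<Longrightarrow> (sat M (concat (map v ns)) \<phi> \<longleftrightarrow> P v)"
    using assms(1) unfolding definable_pred_def by blast
  have "sorts M (concat (map v ns)) = concat (map \<Gamma> ns)"
    if "\<forall>n\<in>set ns. sorts M (v n) = \<Gamma> n" for v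
    using that by (simp add: map_concat cong: map_cong)
  then have "{concat (map v ns) |v. (\<forall>n\<in>set ns. sorts M (v n) = \<Gamma> n) \<and> P v} =
      {x. sorts M x = concat (map \<Gamma> ns) \<and> sat M x \<phi>}"
    using ex_blocks[OF assms(2)] \<phi>(2) by (auto simp del: map_eq_conv) blast
  then show ?thesis unfolding definable_empty_iff using \<phi>(1) by blast
qed

lemma definable_two_blocks:
  assumes "definable_pred \<Gamma> [i, j] P" "i \<noteq> j"
  shows "definable M {} (\<Gamma> i @ \<Gamma> j)
    {x @ y |x y. sorts M x = \<Gamma> i \<and> sorts M y = \<Gamma> j \<and> P (v(i := x, j := y))}"
proof -
  have P: "P w \<longleftrightarrow> P (v(i := w i, j := w j))" if "sorts M (w i) = \<Gamma> i" "sorts M (w j) = \<Gamma> j" for w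
  proof -
    obtain \<phi> where "\<And>v. (\<forall>n\<in>set [i, j]. sorts M (v n) = \<Gamma> n) \<Longrightarrow>
        (sat M (concat (map v [i, j])) \<phi> \<longleftrightarrow> P v)"
      using assms(1) unfolding definable_pred_def by blast
    from this[of w] this[of "v(i := w i, j := w j)"] show ?thesis using that assms(2) by simp
  qed
  have "{concat (map v [i, j]) |v. (\<forall>n\<in>set [i, j]. sorts M (v n) = \<Gamma> n) \<and> P v} =
      {x @ y |x y. sorts M x = \<Gamma> i \<and> sorts M y = \<Gamma> j \<and> P (v(i := x, j := y))}" (is "?L = ?R")
  proof
    show "?L \<subseteq> ?R" using P by auto
    show "?R \<subseteq> ?L"
    proof
      fix z assume "z \<in> ?R"
      then obtain x y where "z = x @ y" "sorts M x = \<Gamma> i" "sorts M y = \<Gamma> j" "P (v(i := x, j := y))"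
        by blast
      then show "z \<in> ?L" using assms(2) by (intro CollectI exI[of _ "v(i := x, j := y)"]) auto
    qed
  qed
  then show ?thesis using definable_blocks[OF assms(1)] assms(2) by simp
qed

lemma definable_automorphism:
  assumes "definable M {} ss X" "\<sigma> \<in> automorphisms M"
  shows "map \<sigma> x \<in> X \<longleftrightarrow> x \<in> X"
proof -
  obtain \<phi> where "wf_fm M ss \<phi>" "X = {x. sorts M x = ss \<and> sat M x \<phi>}"
    using assms(1) unfolding definable_empty_iff by blast
  then show ?thesis using sat_automorphism[OF assms(2), of x \<phi>] assms(2) by auto
qed

lemma definable_iff_param:
  "definable M A ss D \<longleftrightarrow> (\<exists>b X. set b \<subseteq> A \<and> definable M {} (ss @ sorts M b) X \<and>
     D = {x. sorts M x = ss \<and> x @ b \<in> X})"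
proof
  assume "definable M A ss D"
  then obtain \<phi> b where "set b \<subseteq> A" "wf_fm M (ss @ sorts M b) \<phi>" "D = rlz M (ss, {(\<phi>, b)})"
    unfolding definable_def pfms_def by auto
  then show "\<exists>b X. set b \<subseteq> A \<and> definable M {} (ss @ sorts M b) X \<and>
     D = {x. sorts M x = ss \<and> x @ b \<in> X}"
    unfolding definable_empty_iff
    by (intro exI[of _ b] exI[of _ "{x. sorts M x = ss @ sorts M b \<and> sat M x \<phi>}"])
      (auto simp: rlz_def psat_def)
next
  assume "\<exists>b X. set b \<subseteq> A \<and> definable M {} (ss @ sorts M b) X \<and>
     D = {x. sorts M x = ss \<and> x @ b \<in> X}"
  then obtain b \<phi> where "set b \<subseteq> A" "wf_fm M (ss @ sorts M b) \<phi>"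
    "D = {x. sorts M x = ss \<and> x @ b \<in> {x. sorts M x = ss @ sorts M b \<and> sat M x \<phi>}}"
    unfolding definable_empty_iff by blast
  then show "definable M A ss D"
    unfolding definable_def pfms_def
    by (intro bexI[of _ "(\<phi>, b)"]) (auto simp: rlz_def psat_def)
qed

lemma definable_fibre:
  assumes "definable_pred \<Gamma> (n # ns) P" "n \<notin> set ns" "\<forall>k\<in>set ns. sorts M (v k) = \<Gamma> k \<and> set (v k) \<subseteq> A"
  shows "definable M A (\<Gamma> n) {x. sorts M x = \<Gamma> n \<and> P (v(n := x))}"
proof -
  obtain \<phi> where \<phi>: "wf_fm M (\<Gamma> n @ concat (map \<Gamma> ns)) \<phi>"
    "\<And>v. (\<forall>k\<in>set (n # ns). sorts M (v k) = \<Gamma> k) \<Longrightarrow> (sat M (v n @ concat (map v ns)) \<phi> \<longleftrightarrow> P v)"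
    using assms(1) unfolding definable_pred_def by auto
  let ?b = "concat (map v ns)"
  have "sorts M ?b = concat (map \<Gamma> ns)"
    using assms(3) by (simp add: map_concat cong: map_cong)
  moreover have "sat M (x @ ?b) \<phi> \<longleftrightarrow> P (v(n := x))" if "sorts M x = \<Gamma> n" for x
  proof -
    have "map (v(n := x)) ns = map v ns" using assms(2) by auto
    then show ?thesis using \<phi>(2)[of "v(n := x)"] assms that by auto
  qed
  moreover have "set ?b \<subseteq> A" using assms(3) by auto
  ultimately show ?thesis
    unfolding definable_def pfms_def using \<phi>(1)
    by (intro bexI[of _ "(\<phi>, ?b)"]) (auto simp: rlz_def psat_def)
qed

lemma definable_sorts: "definable M A ss D \<Longrightarrow> x \<in> D \<Longrightarrow> sorts M x = ss"
  by (auto simp: definable_def rlz_def)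

lemma definable_mono: "definable M A ss D \<Longrightarrow> A \<subseteq> B \<Longrightarrow> definable M B ss D"
  unfolding definable_def pfms_def by blast

lemma definable_Compl:
  assumes "definable M A ss D" shows "definable M A ss ({x. sorts M x = ss} - D)"
proof -
  obtain b X where b: "set b \<subseteq> A" "definable M {} (ss @ sorts M b) X"
    "D = {x. sorts M x = ss \<and> x @ b \<in> X}" using iffD1[OF definable_iff_param assms] by blast
  define \<Gamma> where "\<Gamma> = (\<lambda>_::nat. [])(0 := ss, 1 := sorts M b)"
  have "definable_pred \<Gamma> [0, 1] (\<lambda>v. \<not> concat (map v [0, 1]) \<in> X)"
    by (intro definable_pred_neg definable_pred_mem) (use b in \<open>auto simp: \<Gamma>_def\<close>)
  from definable_fibre[OF this, of "\<lambda>_. b" A] b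
  have "definable M A ss {x. sorts M x = ss \<and> x @ b \<notin> X}" by (auto simp: \<Gamma>_def)
  moreover have "{x. sorts M x = ss} - D = {x. sorts M x = ss \<and> x @ b \<notin> X}" using b(3) by auto
  ultimately show ?thesis by simp
qed

lemma definable_Int:
  assumes "definable M A ss D" "definable M A ss E" shows "definable M A ss (D \<inter> E)"
proof -
  obtain b X where b: "set b \<subseteq> A" "definable M {} (ss @ sorts M b) X"
    "D = {x. sorts M x = ss \<and> x @ b \<in> X}"
    using iffD1[OF definable_iff_param assms(1)] by blast
  obtain c Y where c: "set c \<subseteq> A" "definable M {} (ss @ sorts M c) Y"
    "E = {x. sorts M x = ss \<and> x @ c \<in> Y}"
    using iffD1[OF definable_iff_param assms(2)] by blast
  define \<Gamma> where "\<Gamma> = (\<lambda>_::nat. [])(0 := ss, 1 := sorts M b, 2 := sorts M c)"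
  have "definable_pred \<Gamma> [0, 1, 2] (\<lambda>v. concat (map v [0, 1]) \<in> X \<and> concat (map v [0, 2]) \<in> Y)"
    by (intro definable_pred_conj definable_pred_mem) (use b c in \<open>auto simp: \<Gamma>_def\<close>)
  from definable_fibre[OF this, of "(\<lambda>_. [])(1 := b, 2 := c)" A] b c
  have "definable M A ss {x. sorts M x = ss \<and> x @ b \<in> X \<and> x @ c \<in> Y}" by (auto simp: \<Gamma>_def)
  moreover have "D \<inter> E = {x. sorts M x = ss \<and> x @ b \<in> X \<and> x @ c \<in> Y}" unfolding b(3) c(3) by blast
  ultimately show ?thesis by simp
qed

lemma definable_UNIV: "definable M A ss {x. sorts M x = ss}"
proof -
  have "definable_pred (\<lambda>_. ss) [0] (\<lambda>v. True)" by (rule definable_pred_True)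
  from definable_fibre[OF this, of "\<lambda>_. []" A] show ?thesis by simp
qed

lemma definable_Inter:
  assumes "finite \<D>" "\<And>D. D \<in> \<D> \<Longrightarrow> definable M A ss D"
  shows "definable M A ss ({x. sorts M x = ss} \<inter> \<Inter>\<D>)"
  using assms
proof (induction \<D> rule: finite_induct)
  case empty
  then show ?case by (simp add: definable_UNIV)
next
  case (insert D \<D>)
  then have "definable M A ss (D \<inter> ({x. sorts M x = ss} \<inter> \<Inter>\<D>))"
    by (intro definable_Int[of A ss D]) auto
  then show ?case by (simp add: Int_left_commute)
qed

lemma definable_diagonal: "definable M {} (ss @ ss) {x @ x |x. sorts M x = ss}"
proof -
  let ?n = "length ss"
  define \<Gamma> where "\<Gamma> = (\<lambda>_::nat. ss)"
  have "definable_pred \<Gamma> [0, 1] (\<lambda>v. \<forall>i\<in>{..<?n}. v 0 ! i = v 1 ! i)"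
  proof (rule definable_pred_ball)
    fix i assume i: "i \<in> {..<?n}"
    have "has_sort M (ss @ ss) (Var i) (ss ! i)" "has_sort M (ss @ ss) (Var (?n + i)) (ss ! i)"
      using has_sort.intros(1)[of i "ss @ ss" M] has_sort.intros(1)[of "?n + i" "ss @ ss" M] i
      by (auto simp: nth_append)
    then have "wf_fm M (ss @ ss) (Eq (Var i) (Var (?n + i)))" by auto
    moreover have "sat M (v 0 @ v 1) (Eq (Var i) (Var (?n + i))) \<longleftrightarrow> v 0 ! i = v 1 ! i"
      if "sorts M (v 0) = ss" "sorts M (v 1) = ss" for v :: "nat \<Rightarrow> 'm list"
    proof -
      have "length (v 0) = ?n" using that(1) by (metis length_map)
      then show ?thesis using i by (auto simp: nth_append)
    qed
    ultimately show "definable_pred \<Gamma> [0, 1] (\<lambda>v. v 0 ! i = v 1 ! i)"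
      unfolding definable_pred_def \<Gamma>_def by (intro exI[of _ "Eq (Var i) (Var (?n + i))"]) auto
  qed simp
  from definable_two_blocks[OF this, of "\<lambda>_. []"]
  have "definable M {} (ss @ ss)
    {x @ y |x y. sorts M x = ss \<and> sorts M y = ss \<and> (\<forall>i\<in>{..<?n}. x ! i = y ! i)}"
    by (simp add: \<Gamma>_def)
  moreover have "(\<forall>i\<in>{..<?n}. x ! i = y ! i) \<longleftrightarrow> x = y"
    if "sorts M x = ss" "sorts M y = ss" for x y
  proof -
    have "length x = ?n" "length y = ?n" using that by (metis length_map)+
    then show ?thesis by (auto intro: nth_equalityI)
  qed
  then have "{x @ y |x y. sorts M x = ss \<and> sorts M y = ss \<and> (\<forall>i\<in>{..<?n}. x ! i = y ! i)} =
      {x @ x |x. sorts M x = ss}" by blast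
  ultimately show ?thesis by simp
qed

lemma definable_pred_eq:
  assumes "\<Gamma> i = \<Gamma> j" "i \<in> set ns" "j \<in> set ns"
  shows "definable_pred \<Gamma> ns (\<lambda>v. v i = v j)"
proof (rule definable_pred_cong)
  show "definable_pred \<Gamma> ns (\<lambda>v. concat (map v [i, j]) \<in> {x @ x |x. sorts M x = \<Gamma> i})"
    by (rule definable_pred_mem) (use assms definable_diagonal in auto)
  fix v assume "\<forall>n\<in>set ns. sorts M (v n) = \<Gamma> n"
  then have "sorts M (v i) = \<Gamma> i" "length (v i) = length (v j)"
    using assms by (metis, metis length_map)
  moreover have "a = b" if "a @ b = x @ x" "length a = length b" for a b x :: "'m list"
  proof -
    have "length a = length x" using arg_cong[OF that(1), of length] that(2) by simp
    then show ?thesis using that(1) by simp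
  qed
  ultimately show "concat (map v [i, j]) \<in> {x @ x |x. sorts M x = \<Gamma> i} \<longleftrightarrow> v i = v j"
    by auto
qed

lemma definable_pred_agree:
  assumes "definable_pred \<Gamma> ns P" "\<forall>n\<in>set ns. sorts M (v n) = \<Gamma> n" "\<forall>n\<in>set ns. w n = v n"
  shows "P w \<longleftrightarrow> P v"
proof -
  obtain \<phi> where \<phi>: "\<forall>v. (\<forall>n\<in>set ns. sorts M (v n) = \<Gamma> n) \<longrightarrow> (sat M (concat (map v ns)) \<phi> \<longleftrightarrow> P v)"
    using assms(1) unfolding definable_pred_def by blast
  have "map w ns = map v ns" using assms(3) by simp
  moreover have "\<forall>n\<in>set ns. sorts M (w n) = \<Gamma> n" using assms(2,3) by simp
  ultimately show ?thesis using \<phi>[rule_format, of v] \<phi>[rule_format, of w] assms(2) by metis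
qed

lemma blocks_unique:
  "\<forall>n\<in>set ns. sorts M (v n) = \<Gamma> n \<and> sorts M (w n) = \<Gamma> n \<Longrightarrow>
     concat (map v ns) = concat (map w ns) \<Longrightarrow> \<forall>n\<in>set ns. v n = w n"
proof (induction ns)
  case (Cons n ns)
  then have "length (v n) = length (w n)" by (metis length_map list.set_intros(1))
  then have "v n = w n" "concat (map v ns) = concat (map w ns)" using Cons.prems(2) by simp_all
  moreover have "\<forall>n\<in>set ns. v n = w n"
    by (rule Cons.IH) (use Cons.prems(1) calculation(2) in simp_all)
  ultimately show ?case by simp
qed simp

lemma pfun_graph:
  assumes "definable_pfun M A ss ts f" "sorts M x = ss"
  shows "x @ y \<in> {x @ y |x y. f x = Some y} \<longleftrightarrow> f x = Some y"
proof
  assume "x @ y \<in> {x @ y |x y. f x = Some y}"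
  then obtain x' y' where *: "x @ y = x' @ y'" "f x' = Some y'" by blast
  then have "sorts M x' = ss" using assms(1) unfolding definable_pfun_def by blast
  then have "length x = length x'" using assms(2) by (metis length_map)
  then show "f x = Some y" using * by simp
qed blast

lemma pfun_automorphism:
  assumes "definable_pfun M {} ss ts f" "\<sigma> \<in> automorphisms M" "f x = Some y"
  shows "f (map \<sigma> x) = Some (map \<sigma> y)"
proof -
  have s: "sorts M x = ss" using assms(1,3) unfolding definable_pfun_def by blast
  let ?G = "{x @ y |x y. f x = Some y}"
  have "definable M {} (ss @ ts) ?G" using assms(1) unfolding definable_pfun_def by blast
  moreover have "x @ y \<in> ?G" using assms(3) by blast
  ultimately have "map \<sigma> (x @ y) \<in> ?G" using definable_automorphism[OF _ assms(2)] by blast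
  then have "map \<sigma> x @ map \<sigma> y \<in> ?G" by simp
  then show ?thesis using pfun_graph[OF assms(1), of "map \<sigma> x" "map \<sigma> y"] s assms(2) by simp
qed

lemma append_mem_blocks:
  assumes "sorts M x = ss"
  shows "x @ y \<in> {x @ y |x y. sorts M x = ss \<and> sorts M y = ts \<and> R x y} \<longleftrightarrow> sorts M y = ts \<and> R x y"
proof
  assume "x @ y \<in> {x @ y |x y. sorts M x = ss \<and> sorts M y = ts \<and> R x y}"
  then obtain x' y' where *: "x @ y = x' @ y'" "sorts M x' = ss" "sorts M y' = ts" "R x' y'" by blast
  have "length x = length x'" using *(2) assms by (metis length_map)
  then show "sorts M y = ts \<and> R x y" using * by simp
qed (use assms in blast)

lemma definable_pfun_append:
  assumes f: "definable_pfun M {} ss ts f" and h: "definable_pfun M {} ss us h"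
  shows "definable_pfun M {} ss (ts @ us)
    (\<lambda>x. case f x of None \<Rightarrow> None | Some d \<Rightarrow> map_option ((@) d) (h x))"
    (is "definable_pfun M {} ss (ts @ us) ?g")
proof -
  have g: "?g x = Some z \<longleftrightarrow> (\<exists>d c. f x = Some d \<and> h x = Some c \<and> z = d @ c)" for x z
    by (auto split: option.splits)
  define f_graph where "f_graph = {x @ y |x y. f x = Some y}"
  define h_graph where "h_graph = {x @ y |x y. h x = Some y}"
  have f_graph: "definable M {} (ss @ ts) f_graph"
    using f unfolding definable_pfun_def f_graph_def by blast
  have h_graph: "definable M {} (ss @ us) h_graph"
    using h unfolding definable_pfun_def h_graph_def by blast
  define \<Gamma> where "\<Gamma> = (\<lambda>_::nat. [])(0 := ss, 1 := ts, 2 := us)"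
  have "definable_pred \<Gamma> [0, 1, 2] (\<lambda>v. v 0 @ v 1 \<in> f_graph \<and> v 0 @ v 2 \<in> h_graph)"
    by (intro definable_pred_conj definable_pred_mem2) (use f_graph h_graph in \<open>simp_all add: \<Gamma>_def\<close>)
  from definable_blocks[OF this]
  have def: "definable M {} (ss @ ts @ us) {concat (map v [0, 1, 2]) |v.
      (\<forall>n\<in>set [0, 1, 2]. sorts M (v n) = \<Gamma> n) \<and> v 0 @ v 1 \<in> f_graph \<and> v 0 @ v 2 \<in> h_graph}"
    by (simp add: \<Gamma>_def)
  have mem: "x @ d \<in> f_graph \<longleftrightarrow> f x = Some d" "x @ c \<in> h_graph \<longleftrightarrow> h x = Some c"
    if "sorts M x = ss" for x d c
    unfolding f_graph_def h_graph_def using pfun_graph[OF f that] pfun_graph[OF h that] by simp_all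
  have sf: "sorts M x = ss" "sorts M d = ts" if "f x = Some d" for x d
    using f that unfolding definable_pfun_def by blast+
  have sh: "sorts M c = us" if "h x = Some c" for x c
    using h that unfolding definable_pfun_def by blast
  have graph: "{x @ z |x z. ?g x = Some z} = {concat (map v [0, 1, 2]) |v.
      (\<forall>n\<in>set [0, 1, 2]. sorts M (v n) = \<Gamma> n) \<and> v 0 @ v 1 \<in> f_graph \<and> v 0 @ v 2 \<in> h_graph}"
    (is "?L = ?R")
  proof
    show "?L \<subseteq> ?R"
    proof
      fix w assume "w \<in> ?L"
      then obtain x d c where *: "f x = Some d" "h x = Some c" "w = x @ d @ c" unfolding g by blast
      then show "w \<in> ?R" using sf[OF *(1)] sh[OF *(2)] mem
        by (intro CollectI exI[of _ "(\<lambda>_. [])(0 := x, 1 := d, 2 := c)"]) (simp add: \<Gamma>_def)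
    qed
    show "?R \<subseteq> ?L"
    proof
      fix w assume "w \<in> ?R"
      then obtain v :: "nat \<Rightarrow> 'm list" where v: "w = v 0 @ v 1 @ v 2" "sorts M (v 0) = ss"
        "v 0 @ v 1 \<in> f_graph" "v 0 @ v 2 \<in> h_graph" by (auto simp: \<Gamma>_def)
      then have "?g (v 0) = Some (v 1 @ v 2)" unfolding g using mem by blast
      then show "w \<in> ?L" using v(1) by blast
    qed
  qed
  show ?thesis
    unfolding definable_pfun_def
  proof (intro conjI allI impI)
    show "sorts M x = ss" "sorts M z = ts @ us" if "?g x = Some z" for x z
      using that sf sh unfolding g by auto
    show "definable M {} (ss @ ts @ us) {x @ z |x z. ?g x = Some z}" unfolding graph by (rule def)
  qed
qed

end

section \<open>Saturation and homogeneity\<close>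

lemma infinite_formulas: "infinite (UNIV :: ('f, 'r, 's) fm set)"
proof
  assume fin: "finite (UNIV :: ('f, 'r, 's) fm set)"
  have "inj (\<lambda>n. Eq (Var n) (Var n) :: ('f, 'r, 's) fm)" by (auto simp: inj_def)
  then show False using finite_imageD[of "\<lambda>n. Eq (Var n) (Var n) :: ('f, 'r, 's) fm" UNIV]
    by (metis fin finite_subset infinite_UNIV_nat subset_UNIV)
qed

lemma fst_tp [simp]: "fst (tp M A a) = sorts M a"
  by (simp add: tp_def)

lemma rlz_tp_self [simp]: "a \<in> rlz M (tp M A a)"
  by (simp add: rlz_def tp_def)

lemma rlz_tp_iff: "x \<in> rlz M (tp M A a) \<longleftrightarrow> tp M A x = tp M A a"
proof
  assume x: "x \<in> rlz M (tp M A a)"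
  then have s: "sorts M x = sorts M a" by (simp add: rlz_def tp_def)
  have "psat M x \<chi> \<longleftrightarrow> psat M a \<chi>" if \<chi>: "\<chi> \<in> pfms M A (sorts M a)" for \<chi>
  proof -
    have "(Neg (fst \<chi>), snd \<chi>) \<in> pfms M A (sorts M a)" using \<chi> by (auto simp: pfms_def)
    then show ?thesis using x \<chi> unfolding rlz_def tp_def
      by (cases "psat M a \<chi>") (force simp: psat_def)+
  qed
  then show "tp M A x = tp M A a" using s by (auto simp: tp_def)
next
  assume "tp M A x = tp M A a"
  then show "x \<in> rlz M (tp M A a)" by (metis rlz_tp_self)
qed

lemma complete_type_tp: "complete_type M A (tp M A a)"
proof -
  have "a \<in> rlz M (sorts M a, \<Delta>)" if "\<Delta> \<subseteq> snd (tp M A a)" for \<Delta>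
    using that by (auto simp: tp_def rlz_def)
  then have "partial_type M A (tp M A a)"
    unfolding partial_type_def by (auto simp: tp_def)
  moreover have "(\<phi>, b) \<in> snd (tp M A a) \<or> (Neg \<phi>, b) \<in> snd (tp M A a)"
    if "(\<phi>, b) \<in> pfms M A (sorts M a)" for \<phi> b
    using that by (auto simp: tp_def pfms_def psat_def)
  ultimately show ?thesis unfolding complete_type_def by auto
qed

lemma complete_type_eq_tp:
  assumes "complete_type M A q" "a \<in> rlz M q"
  shows "q = tp M A a"
proof -
  have s: "sorts M a = fst q" using assms(2) by (simp add: rlz_def)
  have "snd q = {\<chi> \<in> pfms M A (fst q). psat M a \<chi>}"
  proof
    show "snd q \<subseteq> {\<chi> \<in> pfms M A (fst q). psat M a \<chi>}"
      using assms by (auto simp: complete_type_def partial_type_def rlz_def)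
    show "{\<chi> \<in> pfms M A (fst q). psat M a \<chi>} \<subseteq> snd q"
    proof clarify
      fix \<phi> b assume *: "(\<phi>, b) \<in> pfms M A (fst q)" "psat M a (\<phi>, b)"
      have "(Neg \<phi>, b) \<notin> snd q" using assms(2) *(2) by (force simp: rlz_def psat_def)
      then show "(\<phi>, b) \<in> snd q" using assms(1) *(1) unfolding complete_type_def by blast
    qed
  qed
  then show ?thesis using s by (simp add: tp_def prod_eq_iff)
qed

locale monster =
  fixes \<kappa> :: "'k rel" and M :: "('f, 'r, 's, 'm) fo_struct"
  assumes monster: "monster_model \<kappa> M"
begin

sublocale fo_structure M
  using monster by unfold_locales (simp add: monster_model_def)

lemma card_order: "Card_order \<kappa>"
  and small_formulas: "small \<kappa> (UNIV :: ('f, 'r, 's) fm set)"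
  and saturated: "small \<kappa> A \<Longrightarrow> partial_type M A p \<Longrightarrow> rlz M p \<noteq> {}"
  and homogeneous: "small \<kappa> A \<Longrightarrow> elementary_on M A h \<Longrightarrow> \<exists>\<sigma>\<in>automorphisms M. \<forall>a\<in>A. \<sigma> a = h a"
  using monster unfolding monster_model_def by blast+

lemma small_finite: "finite A \<Longrightarrow> small \<kappa> A"
proof -
  assume "finite A"
  then have "(card_of A, card_of (UNIV :: ('f, 'r, 's) fm set)) \<in> ordLess"
    by (intro finite_ordLess_infinite) (simp_all add: Field_card_of card_of_well_order_on infinite_formulas)
  then show ?thesis using small_formulas ordLess_transitive unfolding small_def by blast
qed

lemma infinite_Field: "infinite (Field \<kappa>)"
proof
  assume "finite (Field \<kappa>)"
  then have "small \<kappa> (Field \<kappa>)" by (rule small_finite)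
  then show False
    using card_order card_of_Field_ordIso not_ordLess_ordIso unfolding small_def by blast
qed

lemma small_Un: "small \<kappa> A \<Longrightarrow> small \<kappa> B \<Longrightarrow> small \<kappa> (A \<union> B)"
  unfolding small_def by (rule card_of_Un_ordLess_infinite_Field[OF infinite_Field card_order])

lemma complete_type_realized:
  assumes "complete_type M {} q" shows "\<exists>a. q = tp M {} a"
proof -
  have "rlz M q \<noteq> {}" using assms saturated small_finite complete_type_def by blast
  then show ?thesis using complete_type_eq_tp[OF assms] by blast
qed

text \<open>Saturation, stated for sets instead of formulas.\<close>

lemma compactness:
  assumes "small \<kappa> A" "\<And>D. D \<in> \<D> \<Longrightarrow> definable M A ss D"
    and fip: "\<And>\<E>. finite \<E> \<Longrightarrow> \<E> \<subseteq> \<D> \<Longrightarrow> \<exists>x. sorts M x = ss \<and> (\<forall>D\<in>\<E>. x \<in> D)"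
  shows "\<exists>x. sorts M x = ss \<and> (\<forall>D\<in>\<D>. x \<in> D)"
proof -
  have "\<forall>D\<in>\<D>. \<exists>\<chi>. \<chi> \<in> pfms M A ss \<and> D = rlz M (ss, {\<chi>})"
    using assms(2) unfolding definable_def by blast
  then obtain \<chi> where \<chi>: "\<And>D. D \<in> \<D> \<Longrightarrow> \<chi> D \<in> pfms M A ss \<and> D = rlz M (ss, {\<chi> D})"
    by metis
  have mem: "x \<in> D \<longleftrightarrow> sorts M x = ss \<and> psat M x (\<chi> D)" if "D \<in> \<D>" for x D
    using \<chi>[OF that] by (auto simp: rlz_def)
  have "rlz M (ss, \<Delta>) \<noteq> {}" if fin: "finite \<Delta>" "\<Delta> \<subseteq> \<chi> ` \<D>" for \<Delta>
  proof -
    obtain \<E> where "finite \<E>" "\<E> \<subseteq> \<D>" "\<Delta> = \<chi> ` \<E>"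
      using finite_subset_image[OF fin] by metis
    then obtain x where "sorts M x = ss" "\<forall>D\<in>\<E>. x \<in> D" using fip by blast
    then have "x \<in> rlz M (ss, \<Delta>)" using mem \<open>\<E> \<subseteq> \<D>\<close> \<open>\<Delta> = \<chi> ` \<E>\<close> by (auto simp: rlz_def)
    then show ?thesis by blast
  qed
  then have "partial_type M A (ss, \<chi> ` \<D>)" using \<chi> unfolding partial_type_def by auto
  then obtain x where "x \<in> rlz M (ss, \<chi> ` \<D>)" using saturated[OF assms(1)] by blast
  then show ?thesis using mem by (auto simp: rlz_def)
qed

text \<open>Send the entries of \<open>a\<close> to those of \<open>a'\<close> and fix \<open>B\<close>.  This is well defined because the type
contains the equalities among entries of \<open>a\<close> and elements of \<open>B\<close>, and elementary because
every tuple from its domain is a reindexing of \<open>a\<close> followed by elements of \<open>B\<close>.\<close>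

lemma homogeneous_over:
  assumes "small \<kappa> B" "tp M B a = tp M B a'"
  shows "\<exists>\<sigma>\<in>automorphisms M. (\<forall>b\<in>B. \<sigma> b = b) \<and> map \<sigma> a = a'"
proof -
  have ss: "sorts M a = sorts M a'" using assms(2) by (metis fst_tp)
  then have len: "length a = length a'" by (metis length_map)
  have eqsat: "sat M (a @ b) \<phi> \<longleftrightarrow> sat M (a' @ b) \<phi>"
    if "set b \<subseteq> B" "wf_fm M (sorts M a @ sorts M b) \<phi>" for b \<phi>
  proof -
    have "(\<phi>, b) \<in> pfms M B (sorts M a)" using that by (simp add: pfms_def)
    moreover have "{\<chi> \<in> pfms M B (sorts M a). psat M a \<chi>} = {\<chi> \<in> pfms M B (sorts M a). psat M a' \<chi>}"
      using assms(2) ss by (simp add: tp_def)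
    ultimately have "psat M a (\<phi>, b) \<longleftrightarrow> psat M a' (\<phi>, b)" by blast
    then show ?thesis by (simp add: psat_def)
  qed
  have eqn: "(a @ b) ! i = (a @ b) ! j \<longleftrightarrow> (a' @ b) ! i = (a' @ b) ! j"
    if "set b \<subseteq> B" "i < length (a @ b)" "j < length (a @ b)"
      "sort_of M ((a @ b) ! i) = sort_of M ((a @ b) ! j)" for b i j
  proof -
    let ?\<Gamma> = "sorts M a @ sorts M b"
    have "?\<Gamma> = sorts M (a @ b)" by simp
    then have "?\<Gamma> ! i = ?\<Gamma> ! j" using that by (metis nth_map)
    moreover have "has_sort M ?\<Gamma> (Var i) (?\<Gamma> ! i)" "has_sort M ?\<Gamma> (Var j) (?\<Gamma> ! j)"
      using that by (auto intro: has_sort.intros)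
    ultimately have "wf_fm M ?\<Gamma> (Eq (Var i) (Var j))" by auto
    from eqsat[OF that(1) this] show ?thesis by simp
  qed
  define idx where "idx m = (SOME i. i < length a \<and> a ! i = m)" for m
  have idx: "idx m < length a \<and> a ! idx m = m" if "m \<in> set a" for m
    unfolding idx_def by (rule someI_ex) (use that in \<open>auto simp: in_set_conv_nth\<close>)
  define h where "h m = (if m \<in> set a then a' ! idx m else m)" for m
  have ha: "h (a ! i) = a' ! i" if "i < length a" for i
    using eqn[of "[]" "idx (a ! i)" i] idx[of "a ! i"] that len by (simp add: h_def)
  have hB: "h b = b" if "b \<in> B" for b
  proof (cases "b \<in> set a")
    case True
    then show ?thesis using eqn[of "[b]" "idx b" "length a"] idx[of b] that len
      by (simp add: h_def nth_append)
  qed (simp add: h_def)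
  have "elementary_on M (B \<union> set a) h"
    unfolding elementary_on_def
  proof (intro allI impI)
    fix c assume c: "set c \<subseteq> B \<union> set a"
    \<comment> \<open>The entries of \<open>c\<close> that are not entries of \<open>a\<close> lie in \<open>B\<close> and serve as parameters.\<close>
    define b where "b = filter (\<lambda>m. m \<notin> set a) c"
    have bB: "set b \<subseteq> B" using c by (auto simp: b_def)
    define pos where "pos m = (SOME i. i < length b \<and> b ! i = m)" for m
    have pos: "pos m < length b \<and> b ! pos m = m" if "m \<in> set b" for m
      unfolding pos_def by (rule someI_ex) (use that in \<open>auto simp: in_set_conv_nth\<close>)
    define r where "r i = (if c ! i \<in> set a then idx (c ! i) else length a + pos (c ! i))" for i
    have inb: "c ! i \<in> set b" if "i < length c" "c ! i \<notin> set a" for i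
      using that by (simp add: b_def)
    have r: "r i < length (a @ b) \<and> (a @ b) ! r i = c ! i \<and> (a' @ b) ! r i = h (c ! i)"
      if "i < length c" for i
    proof (cases "c ! i \<in> set a")
      case True
      then show ?thesis using idx[OF True] len by (simp add: r_def h_def nth_append)
    next
      case False
      then show ?thesis using pos[OF inb[OF that False]] len by (simp add: r_def h_def nth_append)
    qed
    have rc: "reindexes r c (a @ b)" "reindexes r (map h c) (a' @ b)"
      using r len by (simp_all add: reindexes_def)
    have sc: "reindexes r (sorts M c) (sorts M a @ sorts M b)"
      unfolding reindexes_def map_append[symmetric]
    proof (intro allI impI conjI)
      fix i assume "i < length (sorts M c)"
      then have i: "i < length c" by simp
      show "r i < length (sorts M (a @ b))" using r[OF i] by simp
      show "sorts M (a @ b) ! r i = sorts M c ! i"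
        using r[OF i] i nth_map[of "r i" "a @ b" "sort_of M"] by (simp del: map_append)
    qed
    have sab: "sorts M (a' @ b) = sorts M (a @ b)" using ss by simp
    have shc: "sorts M (map h c) = sorts M c"
    proof (rule nth_equalityI)
      fix i assume "i < length (sorts M (map h c))"
      then have i: "i < length c" by simp
      have "sorts M (map h c) ! i = sort_of M ((a' @ b) ! r i)" using r[OF i] i by simp
      also have "\<dots> = sorts M (a' @ b) ! r i" using r[OF i] len by (intro nth_map[symmetric]) simp
      also have "\<dots> = sorts M c ! i" unfolding sab using sc i by (simp add: reindexes_def)
      finally show "sorts M (map h c) ! i = sorts M c ! i" .
    qed simp
    have "sat M (map h c) \<phi> \<longleftrightarrow> sat M c \<phi>" if \<phi>: "wf_fm M (sorts M c) \<phi>" for \<phi>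
    proof -
      have "sat M (map h c) \<phi> \<longleftrightarrow> sat M (a' @ b) (ren r \<phi>)"
        using sat_ren[OF _ rc(2), of M \<phi>] \<phi> unfolding shc by simp
      also have "\<dots> \<longleftrightarrow> sat M (a @ b) (ren r \<phi>)"
        using eqsat[OF bB wf_fm_ren[OF \<phi> sc]] by simp
      also have "\<dots> \<longleftrightarrow> sat M c \<phi>" using sat_ren[OF \<phi> rc(1)] by simp
      finally show ?thesis .
    qed
    then show "tp M {} (map h c) = tp M {} c"
      unfolding tp_def shc by (auto simp: pfms_def psat_def)
  qed
  then obtain \<sigma> where \<sigma>: "\<sigma> \<in> automorphisms M" "\<forall>m\<in>B \<union> set a. \<sigma> m = h m"
    using homogeneous small_Un[OF assms(1) small_finite[OF finite_set]] by blast
  have "map \<sigma> a = a'" using \<sigma>(2) ha len by (auto intro: nth_equalityI)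
  moreover have "\<forall>b\<in>B. \<sigma> b = b" using \<sigma>(2) hB by simp
  ultimately show ?thesis using \<sigma>(1) by blast
qed

lemma tp_automorphism:
  assumes "\<sigma> \<in> automorphisms M" "\<And>b. b \<in> B \<Longrightarrow> \<sigma> b = b"
  shows "tp M B (map \<sigma> a) = tp M B a"
proof -
  have "psat M (map \<sigma> a) \<chi> \<longleftrightarrow> psat M a \<chi>" if "\<chi> \<in> pfms M B (sorts M a)" for \<chi>
  proof -
    have "\<forall>b\<in>set (snd \<chi>). \<sigma> b = b" using that assms(2) by (auto simp: pfms_def)
    then have "map \<sigma> (snd \<chi>) = snd \<chi>" by (simp add: map_idI)
    then show ?thesis using sat_automorphism[OF assms(1), of "a @ snd \<chi>" "fst \<chi>"] that
      by (auto simp: psat_def pfms_def)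
  qed
  then show ?thesis using assms(1) by (auto simp: tp_def)
qed

lemma tp_eq_iff: "tp M {} x = tp M {} a \<longleftrightarrow> (\<exists>\<sigma>\<in>automorphisms M. x = map \<sigma> a)"
  using homogeneous_over[OF small_finite, of "{}" a x] tp_automorphism[of _ "{}" a] by auto

lemma rlz_as_Inter:
  assumes "complete_type M {} q" "sorts M x = fst q"
    and "\<And>\<theta>. definable M {} (fst q) \<theta> \<Longrightarrow> rlz M q \<subseteq> \<theta> \<Longrightarrow> x \<in> \<theta>"
  shows "x \<in> rlz M q"
proof -
  have "psat M x \<chi>" if "\<chi> \<in> snd q" for \<chi>
  proof -
    have "\<chi> \<in> pfms M {} (fst q)" using assms(1) that by (auto simp: complete_type_def partial_type_def)
    then have "definable M {} (fst q) (rlz M (fst q, {\<chi>}))" unfolding definable_def by blast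
    moreover have "rlz M q \<subseteq> rlz M (fst q, {\<chi>})" using that by (auto simp: rlz_def)
    ultimately show ?thesis using assms(3) by (auto simp: rlz_def)
  qed
  then show ?thesis using assms(2) by (simp add: rlz_def)
qed

text \<open>Otherwise the failures of \<open>P\<close> inside the definable sets containing the realizations of \<open>q\<close>
would have the finite intersection property, and a common point would be a tuple of
realizations of \<open>q\<close> on which \<open>P\<close> fails.\<close>

lemma uniform_neighbourhood:
  fixes \<Gamma> :: "nat \<Rightarrow> 's list"
  assumes q: "complete_type M {} q" and P: "definable_pred \<Gamma> ns P" "distinct ns" "\<forall>n\<in>set ns. \<Gamma> n = fst q"
    and onQ: "\<And>v. \<forall>n\<in>set ns. v n \<in> rlz M q \<Longrightarrow> P v"
  shows "\<exists>\<Theta>. definable M {} (fst q) \<Theta> \<and> rlz M q \<subseteq> \<Theta> \<and> (\<forall>v. (\<forall>n\<in>set ns. v n \<in> \<Theta>) \<longrightarrow> P v)"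
proof (rule ccontr)
  assume no: "\<not> ?thesis"
  define T where "T = {\<theta>. definable M {} (fst q) \<theta> \<and> rlz M q \<subseteq> \<theta>}"
  define D where "D \<theta> = {concat (map v ns) |v. (\<forall>n\<in>set ns. sorts M (v n) = \<Gamma> n) \<and>
      (\<forall>n\<in>set ns. v n \<in> \<theta>) \<and> \<not> P v}" for \<theta>
  have "\<exists>x. sorts M x = concat (map \<Gamma> ns) \<and> (\<forall>d\<in>D ` T. x \<in> d)"
  proof (rule compactness)
    show "small \<kappa> ({} :: 'm set)" by (rule small_finite) simp
    fix d assume "d \<in> D ` T"
    then obtain \<theta> where \<theta>: "\<theta> \<in> T" "d = D \<theta>" by blast
    have "definable_pred \<Gamma> ns (\<lambda>v. (\<forall>n\<in>set ns. v n \<in> \<theta>) \<and> \<not> P v)"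
      by (intro definable_pred_conj definable_pred_neg definable_pred_ball definable_pred_mem1) (use \<theta> P in \<open>auto simp: T_def\<close>)
    then show "definable M {} (concat (map \<Gamma> ns)) d"
      unfolding \<theta>(2) D_def by (rule definable_blocks) (rule P(2))
  next
    fix \<E> assume "finite \<E>" "\<E> \<subseteq> D ` T"
    then obtain \<T> where \<T>: "\<T> \<subseteq> T" "finite \<T>" "\<E> = D ` \<T>" using finite_subset_image by metis
    define \<theta> where "\<theta> = {x. sorts M x = fst q} \<inter> \<Inter>\<T>"
    have "definable M {} (fst q) \<theta>"
      unfolding \<theta>_def by (rule definable_Inter[OF \<T>(2)]) (use \<T>(1) in \<open>auto simp: T_def\<close>)
    moreover have "rlz M q \<subseteq> \<theta>" using \<T>(1) by (auto simp: \<theta>_def T_def rlz_def)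
    ultimately obtain v where v: "\<forall>n\<in>set ns. v n \<in> \<theta>" "\<not> P v" using no by blast
    have "sorts M (v n) = \<Gamma> n" if "n \<in> set ns" for n using that v(1) P(3) by (auto simp: \<theta>_def)
    moreover from this have "sorts M (concat (map v ns)) = concat (map \<Gamma> ns)"
      by (simp add: map_concat cong: map_cong)
    moreover have "concat (map v ns) \<in> D t" if "t \<in> \<T>" for t
      unfolding D_def using that v calculation(1) by (intro CollectI exI[of _ v]) (auto simp: \<theta>_def)
    ultimately show "\<exists>x. sorts M x = concat (map \<Gamma> ns) \<and> (\<forall>d\<in>\<E>. x \<in> d)"
      unfolding \<T>(3) by blast
  qed
  then obtain x where x: "sorts M x = concat (map \<Gamma> ns)" "\<And>\<theta>. \<theta> \<in> T \<Longrightarrow> x \<in> D \<theta>" by blast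
  obtain v where v: "\<forall>n\<in>set ns. sorts M (v n) = \<Gamma> n" "x = concat (map v ns)"
    using ex_blocks[OF P(2) x(1)] by blast
  have vT: "(\<forall>n\<in>set ns. v n \<in> \<theta>) \<and> \<not> P v" if \<theta>: "\<theta> \<in> T" for \<theta>
  proof -
    obtain w where w: "x = concat (map w ns)" "\<forall>n\<in>set ns. sorts M (w n) = \<Gamma> n"
      "\<forall>n\<in>set ns. w n \<in> \<theta>" "\<not> P w" using x(2)[OF \<theta>] unfolding D_def by blast
    have "\<forall>n\<in>set ns. w n = v n"
      by (rule blocks_unique[of ns w \<Gamma> v]) (use v w(1,2) in auto)
    then show ?thesis using definable_pred_agree[OF P(1) v(1), of w] w(3,4) by auto
  qed
  have "v n \<in> rlz M q" if "n \<in> set ns" for n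
    by (rule rlz_as_Inter[OF q]) (use v(1) P(3) that vT in \<open>auto simp: T_def\<close>)
  then have "P v" using onQ by blast
  moreover have "{x. sorts M x = fst q} \<in> T" by (auto simp: T_def definable_UNIV rlz_def)
  ultimately show False using vT by blast
qed

text \<open>\<open>chain_ext ss R n N v\<close> says that the chain \<open>v 0, \<dots>, v (n - 1)\<close> can be prolonged by \<open>N\<close> further
elements; for fixed \<open>n\<close> and \<open>N\<close> this is a definable condition on the chain.\<close>

fun chain_ext :: "'s list \<Rightarrow> 'm list set \<Rightarrow> nat \<Rightarrow> nat \<Rightarrow> (nat \<Rightarrow> 'm list) \<Rightarrow> bool" where
  "chain_ext ss R n 0 v \<longleftrightarrow> (\<forall>j\<in>{..<n}. \<forall>i\<in>{..<j}. v i @ v j \<in> R)"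
| "chain_ext ss R n (Suc N) v \<longleftrightarrow> ex_block (\<lambda>_. ss) n (chain_ext ss R (Suc n) N) v"

lemma definable_pred_chain_ext:
  assumes "definable M {} (ss @ ss) R"
  shows "definable_pred (\<lambda>_. ss) [0..<n] (chain_ext ss R n N)"
proof (induction N arbitrary: n)
  case 0
  have "definable_pred (\<lambda>_. ss) [0..<n] (\<lambda>v. concat (map v [i, j]) \<in> R)" if "j < n" "i < j" for i j
    by (rule definable_pred_mem) (use that assms in auto)
  then have "definable_pred (\<lambda>_. ss) [0..<n] (\<lambda>v. \<forall>j\<in>{..<n}. \<forall>i\<in>{..<j}. v i @ v j \<in> R)"
    by (intro definable_pred_ball) auto
  then show ?case by simp
next
  case (Suc N)
  have "definable_pred (\<lambda>_. ss) (n # [0..<n]) (chain_ext ss R (Suc n) N)"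
    by (rule definable_pred_subset[OF Suc]) auto
  then have "definable_pred (\<lambda>_. ss) [0..<n] (ex_block (\<lambda>_. ss) n (chain_ext ss R (Suc n) N))"
    by (rule definable_pred_ex_block) simp
  then show ?case by (rule definable_pred_cong[rotated]) simp
qed

lemma chain_ext_Suc: "chain_ext ss R n (Suc N) v \<Longrightarrow> chain_ext ss R n N v"
proof (induction N arbitrary: n v)
  case 0
  then obtain y where "\<forall>j\<in>{..<Suc n}. \<forall>i\<in>{..<j}. (v(n := y)) i @ (v(n := y)) j \<in> R"
    by (auto simp: ex_block_def)
  then have "v i @ v j \<in> R" if "j < n" "i < j" for i j
    using that by (metis fun_upd_apply lessThan_iff less_SucI less_irrefl less_trans)
  then show ?case by simp
next
  case (Suc N)
  then obtain y where "sorts M y = ss" "chain_ext ss R (Suc n) (Suc N) (v(n := y))"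
    unfolding chain_ext.simps(2)[of ss R n] ex_block_def by blast
  then show ?case using Suc.IH unfolding chain_ext.simps(2)[of ss R n] ex_block_def by blast
qed

lemma chain_ext_le: "chain_ext ss R n N v \<Longrightarrow> N' \<le> N \<Longrightarrow> chain_ext ss R n N' v"
proof (induction N)
  case (Suc N)
  then show ?case using chain_ext_Suc[of ss R n N v] by (cases "N' = Suc N") simp_all
qed simp

lemma chain_ext_chain:
  "\<forall>i<n + N. sorts M (z i) = ss \<Longrightarrow> \<forall>j<n + N. \<forall>i<j. z i @ z j \<in> R \<Longrightarrow> chain_ext ss R n N z"
proof (induction N arbitrary: n)
  case (Suc N)
  then have "chain_ext ss R (Suc n) N (z(n := z n))" by simp
  then show ?case using Suc.prems(1) unfolding chain_ext.simps(2) ex_block_def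
    by (intro exI[of _ "z n"]) simp
qed simp

text \<open>An infinite chain is built one element at a time, keeping the chain prolongable by every finite
number of elements; the next element exists by compactness.\<close>

lemma infinite_chain:
  assumes R: "definable M {} (ss @ ss) R"
    and fin: "\<And>n. \<exists>z :: nat \<Rightarrow> 'm list. (\<forall>i<n. sorts M (z i) = ss) \<and> (\<forall>j<n. \<forall>i<j. z i @ z j \<in> R)"
  shows "\<exists>z :: nat \<Rightarrow> 'm list. (\<forall>i. sorts M (z i) = ss) \<and> (\<forall>j. \<forall>i<j. z i @ z j \<in> R)"
proof -
  let ?P = "\<lambda>n v. (\<forall>i<n. sorts M (v i) = ss) \<and> (\<forall>N. chain_ext ss R n N v)"
  have step: "\<exists>v'. ?P (Suc n) v' \<and> (\<exists>y. v' = v(n := y))" if v: "?P n v" for n v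
  proof -
    define D where "D N = {y. sorts M y = ss \<and> chain_ext ss R (Suc n) N (v(n := y))}" for N
    define A where "A = (\<Union>i<n. set (v i))"
    have "\<exists>y. sorts M y = ss \<and> (\<forall>d\<in>range D. y \<in> d)"
    proof (rule compactness)
      show "small \<kappa> A" by (rule small_finite) (simp add: A_def)
      fix d assume "d \<in> range D"
      then obtain N where N: "d = D N" by blast
      have "definable_pred (\<lambda>_. ss) (n # [0..<n]) (chain_ext ss R (Suc n) N)"
        by (rule definable_pred_subset[OF definable_pred_chain_ext[OF R]]) auto
      moreover have "\<forall>k\<in>set [0..<n]. sorts M (v k) = ss \<and> set (v k) \<subseteq> A"
        using v by (auto simp: A_def)
      ultimately show "definable M A ss d"
        using definable_fibre[of "\<lambda>_. ss" n "[0..<n]" _ v A] unfolding N D_def by simp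
    next
      fix \<E> assume "finite \<E>" "\<E> \<subseteq> range D"
      then obtain I where I: "finite I" "I \<subseteq> UNIV" "\<E> = D ` I" using finite_subset_image by metis
      obtain K where K: "\<forall>i\<in>I. i \<le> K" using I(1) finite_nat_set_iff_bounded_le by auto
      have "chain_ext ss R n (Suc K) v" using v by blast
      then obtain y where "sorts M y = ss" "chain_ext ss R (Suc n) K (v(n := y))"
        by (auto simp: ex_block_def)
      then show "\<exists>y. sorts M y = ss \<and> (\<forall>d\<in>\<E>. y \<in> d)"
        using K chain_ext_le unfolding I(3) D_def by blast
    qed
    then obtain y where "sorts M y = ss" "\<forall>N. chain_ext ss R (Suc n) N (v(n := y))"
      unfolding D_def by auto
    then show ?thesis using v by (intro exI[of _ "v(n := y)"]) (auto simp: less_Suc_eq)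
  qed
  have "\<exists>v. ?P 0 v"
  proof -
    have "chain_ext ss R 0 N v" for N v
    proof -
      obtain z where "(\<forall>i<N. sorts M (z i) = ss) \<and> (\<forall>j<N. \<forall>i<j. z i @ z j \<in> R)"
        using fin[of N] ..
      then have "chain_ext ss R 0 N z" using chain_ext_chain[of 0 N z ss R] by simp
      moreover have "definable_pred (\<lambda>_. ss) [] (chain_ext ss R 0 N)" using definable_pred_chain_ext[OF R, of 0 N] by simp
      then have "chain_ext ss R 0 N v \<longleftrightarrow> chain_ext ss R 0 N z" unfolding definable_pred_def by auto
      ultimately show ?thesis by simp
    qed
    then show ?thesis by auto
  qed
  then obtain f where f: "\<And>n. ?P n (f n)" "\<And>n. \<exists>y. f (Suc n) = (f n)(n := y)"
    using dependent_nat_choice[of ?P "\<lambda>n v v'. \<exists>y. v' = v(n := y)", OF _ step] by blast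
  have stable: "f (Suc i + k) i = f (Suc i) i" for i k
  proof (induction k)
    case (Suc k)
    obtain y where "f (Suc (Suc i + k)) = (f (Suc i + k))(Suc i + k := y)" using f(2) by blast
    then show ?case using Suc by simp
  qed simp
  define z where "z i = f (Suc i) i" for i
  have "z i @ z j \<in> R" if "i < j" for i j
  proof -
    have "chain_ext ss R (Suc j) 0 (f (Suc j))" using f(1) by blast
    then have "f (Suc j) i @ f (Suc j) j \<in> R" using that by simp
    moreover have "f (Suc j) i = z i" using stable[of i "j - i"] that by (simp add: z_def)
    ultimately show ?thesis by (simp add: z_def)
  qed
  moreover have "sorts M (z i) = ss" for i using f(1)[of "Suc i"] by (simp add: z_def)
  ultimately show ?thesis by blast
qed

section \<open>Nonforking over the empty set in stable theories\<close>

lemma definable_rlz_finite: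
  assumes "finite \<Delta>" "\<Delta> \<subseteq> pfms M A ss" shows "definable M A ss (rlz M (ss, \<Delta>))"
proof -
  have "definable M A ss ({x. sorts M x = ss} \<inter> \<Inter>((\<lambda>\<chi>. rlz M (ss, {\<chi>})) ` \<Delta>))"
    by (rule definable_Inter) (use assms in \<open>auto simp: definable_def\<close>)
  moreover have "{x. sorts M x = ss} \<inter> \<Inter>((\<lambda>\<chi>. rlz M (ss, {\<chi>})) ` \<Delta>) = rlz M (ss, \<Delta>)"
    by (auto simp: rlz_def)
  ultimately show ?thesis by simp
qed

text \<open>The pairs (point, parameter) of a ladder form a chain for the definable relation \<open>R\<close> that
holds between two pairs exactly when \<open>\<phi>\<close> is true for the first point with the second parameter and
false in the other three combinations.  Arbitrarily long chains give an infinite one,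
which is an instance of the order property.\<close>

lemma stable_no_ladder:
  assumes "stable_theory M" and \<phi>: "wf_fm M (ss @ ts) \<phi>"
    and lad: "\<And>n. ladder (<) {{x. sorts M x = ss \<and> sat M (x @ e) \<phi>} |e. sorts M e = ts} X n"
    and X: "X \<subseteq> {x. sorts M x = ss}"
  shows False
proof -
  define \<F> where "\<F> = {{x. sorts M x = ss \<and> sat M (x @ e) \<phi>} |e. sorts M e = ts}"
  define W where "W = {x. sorts M x = ss @ ts \<and> sat M x \<phi>}"
  have W: "definable M {} (ss @ ts) W" unfolding W_def definable_empty_iff using \<phi> by blast
  have Wm: "a @ b \<in> W \<longleftrightarrow> sat M (a @ b) \<phi>" if "sorts M a = ss" "sorts M b = ts" for a b
    using that by (simp add: W_def)
  define \<Gamma> where "\<Gamma> = (\<lambda>_::nat. [])(0 := ss, 1 := ts, 2 := ss, 3 := ts)"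
  define P where "P = (\<lambda>v :: nat \<Rightarrow> 'm list. v 0 @ v 3 \<in> W \<and> \<not> v 2 @ v 1 \<in> W \<and> \<not> v 0 @ v 1 \<in> W \<and> \<not> v 2 @ v 3 \<in> W)"
  have "definable_pred \<Gamma> [0, 1, 2, 3] P" unfolding P_def
    by (intro definable_pred_conj definable_pred_neg definable_pred_mem2) (use W in \<open>simp_all add: \<Gamma>_def\<close>)
  define R where "R = {concat (map v [0, 1, 2, 3]) |v. (\<forall>n\<in>set [0, 1, 2, 3]. sorts M (v n) = \<Gamma> n) \<and> P v}"
  have "definable M {} (concat (map \<Gamma> [0, 1, 2, 3])) R"
    unfolding R_def by (rule definable_blocks) (use \<open>definable_pred \<Gamma> [0, 1, 2, 3] P\<close> in auto)
  then have R: "definable M {} ((ss @ ts) @ (ss @ ts)) R" by (simp add: \<Gamma>_def)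
  have Rm: "(a @ b) @ (a' @ b') \<in> R \<longleftrightarrow>
      sat M (a @ b') \<phi> \<and> \<not> sat M (a' @ b) \<phi> \<and> \<not> sat M (a @ b) \<phi> \<and> \<not> sat M (a' @ b') \<phi>"
    if s: "sorts M a = ss" "sorts M a' = ss" "sorts M b = ts" "sorts M b' = ts" for a b a' b'
  proof
    assume "(a @ b) @ (a' @ b') \<in> R"
    then obtain v where v: "(a @ b) @ (a' @ b') = v 0 @ v 1 @ v 2 @ v 3"
      "sorts M (v 0) = ss" "sorts M (v 1) = ts" "sorts M (v 2) = ss" "sorts M (v 3) = ts" "P v"
      unfolding R_def by (auto simp: \<Gamma>_def)
    have "length a = length (v 0)" "length b = length (v 1)" "length a' = length (v 2)"
      using s v by (metis length_map)+
    then have "v 0 = a" "v 1 = b" "v 2 = a'" "v 3 = b'" using v(1) by auto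
    then show "sat M (a @ b') \<phi> \<and> \<not> sat M (a' @ b) \<phi> \<and> \<not> sat M (a @ b) \<phi> \<and> \<not> sat M (a' @ b') \<phi>"
      using v(6) s by (simp add: P_def Wm)
  next
    assume "sat M (a @ b') \<phi> \<and> \<not> sat M (a' @ b) \<phi> \<and> \<not> sat M (a @ b) \<phi> \<and> \<not> sat M (a' @ b') \<phi>"
    then show "(a @ b) @ (a' @ b') \<in> R" unfolding R_def
      using s by (intro CollectI exI[of _ "(\<lambda>_. [])(0 := a, 1 := b, 2 := a', 3 := b')"])
        (simp add: P_def Wm \<Gamma>_def)
  qed
  have "\<exists>z :: nat \<Rightarrow> 'm list. (\<forall>i<n. sorts M (z i) = ss @ ts) \<and> (\<forall>j<n. \<forall>i<j. z i @ z j \<in> R)" for n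
  proof -
    have "ladder (<) \<F> X n" using lad unfolding \<F>_def .
    then obtain x S where xS: "is_ladder (<) \<F> X n x S" unfolding ladder_def by blast
    then have "S i \<in> \<F>" if "i < n" for i using that unfolding is_ladder_def by blast
    then have ex: "\<exists>e. sorts M e = ts \<and> S i = {x. sorts M x = ss \<and> sat M (x @ e) \<phi>}" if "i < n" for i
      using that unfolding \<F>_def by blast
    define e where "e i = (SOME e. sorts M e = ts \<and> S i = {x. sorts M x = ss \<and> sat M (x @ e) \<phi>})" for i
    have e: "sorts M (e i) = ts \<and> S i = {x. sorts M x = ss \<and> sat M (x @ e i) \<phi>}" if "i < n" for i
      unfolding e_def by (rule someI_ex[OF ex[OF that]])
    have x: "sorts M (x i) = ss" if "i < n" for i using xS X that unfolding is_ladder_def by blast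
    have "sat M (x i @ e j) \<phi> \<longleftrightarrow> i < j" if "i < n" "j < n" for i j
    proof -
      have "x i \<in> S j \<longleftrightarrow> i < j" using xS that unfolding is_ladder_def by blast
      then show ?thesis using e[OF that(2)] x[OF that(1)] by simp
    qed
    then have "(x i @ e i) @ (x j @ e j) \<in> R" if "j < n" "i < j" for i j
      using e x that by (subst Rm) auto
    then show ?thesis using e x by (intro exI[of _ "\<lambda>i. x i @ e i"]) simp
  qed
  from infinite_chain[OF R this] obtain z :: "nat \<Rightarrow> 'm list"
    where z: "\<And>i. sorts M (z i) = ss @ ts" "\<And>i j. i < j \<Longrightarrow> z i @ z j \<in> R" by blast
  define a where "a i = take (length ss) (z i)" for i
  define b where "b i = drop (length ss) (z i)" for i
  have ab: "z i = a i @ b i" "sorts M (a i) = ss" "sorts M (b i) = ts" for i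
    using z(1)[of i] by (simp_all add: a_def b_def flip: take_map drop_map)
  have R': "sat M (a i @ b j) \<phi> \<and> \<not> sat M (a j @ b i) \<phi> \<and> \<not> sat M (a i @ b i) \<phi>" if "i < j" for i j
    using z(2)[OF that] Rm[OF ab(2) ab(2) ab(3) ab(3)] unfolding ab(1) by blast
  have "sat M (a i @ b j) \<phi> \<longleftrightarrow> i < j" for i j
    using R'[of i j] R'[of j i] R'[of i "Suc i"] by (cases i j rule: linorder_cases) auto
  then have "order_property M ss ts \<phi>" unfolding order_property_def using ab(2,3) by blast
  then show False using assms(1) \<phi> unfolding stable_theory_def by blast
qed

lemma sat_inst_automorphism:
  assumes "\<sigma> \<in> automorphisms M" "wf_fm M (ss @ sorts M e) \<phi>" "sorts M y = ss"
  shows "sat M (map \<sigma> y @ map \<sigma> e) \<phi> \<longleftrightarrow> sat M (y @ e) \<phi>"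
  using sat_automorphism[OF assms(1), of "y @ e" \<phi>] assms(2,3) by simp

text \<open>Take the rank with respect to the \<open>k\<close>-inconsistent sequences of instances of members of \<open>\<Psi>\<close>.  If
\<open>X\<close> has rank at least \<open>m\<close>, so has its part in some \<open>\<psi> \<in> \<Psi>\<close>, hence, by invariance of \<open>X\<close> under
automorphisms, its part in each term of the sequence of conjugates of \<open>\<psi>\<close> which witnesses dividing;
so \<open>X\<close> has rank at least \<open>m + 1\<close>.  Unbounded rank contradicts \<open>stable_no_ladder\<close>.\<close>

lemma not_covered_by_dividing:
  assumes stable: "stable_theory M" and X: "definable M {} ss X" "X \<noteq> {}"
    and \<Psi>: "finite \<Psi>" "\<Psi> \<subseteq> pfms M UNIV ss" and div: "\<forall>\<psi>\<in>\<Psi>. divides M {} ss \<psi>"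
    and cov: "X \<subseteq> (\<Union>\<psi>\<in>\<Psi>. rlz M (ss, {\<psi>}))"
  shows False
proof -
  define inconsistent where "inconsistent \<psi> k e \<longleftrightarrow>
      (\<forall>I. finite I \<and> card I = k \<longrightarrow> rlz M (ss, {(fst \<psi>, e i) |i. i \<in> I}) = {})"
    for \<psi> :: "('f, 'r, 's) fm \<times> 'm list" and k :: nat and e :: "nat \<Rightarrow> 'm list"
  have "\<forall>\<psi>\<in>\<Psi>. \<exists>d k. (\<forall>i. d i \<in> rlz M (tp M {} (snd \<psi>))) \<and> inconsistent \<psi> k d"
    using div unfolding divides_def inconsistent_def by simp
  then obtain d k where d: "\<And>\<psi> i. \<psi> \<in> \<Psi> \<Longrightarrow> d \<psi> i \<in> rlz M (tp M {} (snd \<psi>))"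
    and k: "\<And>\<psi>. \<psi> \<in> \<Psi> \<Longrightarrow> inconsistent \<psi> (k \<psi>) (d \<psi>)" by metis
  have wf: "wf_fm M (ss @ sorts M (snd \<psi>)) (fst \<psi>)" if "\<psi> \<in> \<Psi>" for \<psi>
    using \<Psi>(2) that by (auto simp: pfms_def)
  define inst where "inst \<psi> e = {x. sorts M x = ss \<and> sat M (x @ e) (fst \<psi>)}"
    for \<psi> :: "('f, 'r, 's) fm \<times> 'm list" and e :: "'m list"
  have rlz_inst: "x \<in> rlz M (ss, {(fst \<psi>, e i) |i. i \<in> I}) \<longleftrightarrow> sorts M x = ss \<and> (\<forall>i\<in>I. x \<in> inst \<psi> (e i))"
    for x \<psi> and e :: "nat \<Rightarrow> 'm list" and I
    by (auto simp: rlz_def psat_def inst_def)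
  define ok where "ok \<psi> e \<longleftrightarrow> (\<forall>j. sorts M (e j) = sorts M (snd \<psi>)) \<and>
      inconsistent \<psi> (k \<psi>) e" for \<psi> :: "('f, 'r, 's) fm \<times> 'm list" and e :: "nat \<Rightarrow> 'm list"
  define \<S> where "\<S> = {\<lambda>j. inst \<psi> (e j) |\<psi> e. \<psi> \<in> \<Psi> \<and> ok \<psi> e}"
  have \<S>I: "(\<lambda>j. inst \<psi> (e j)) \<in> \<S>" if "\<psi> \<in> \<Psi>" "ok \<psi> e" for \<psi> e
    unfolding \<S>_def using that by (intro CollectI exI[of _ \<psi>] exI[of _ e]) simp
  \<comment> \<open>The successor keeps \<open>{..<K}\<close> nonempty, so that a point in all terms has the right sorts
    even if every inconsistency bound is \<open>0\<close>.\<close>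
  define K where "K = Suc (\<Sum>\<psi>\<in>\<Psi>. k \<psi>)"
  define \<F> where "\<F> \<psi> = {{x. sorts M x = ss \<and> sat M (x @ e) (fst \<psi>)} |e. sorts M e = sorts M (snd \<psi>)}"
    for \<psi> :: "('f, 'r, 's) fm \<times> 'm list"
  have sub: "S \<circ> r \<in> \<S>" if S: "S \<in> \<S>" and r: "strict_mono r" for S and r :: "nat \<Rightarrow> nat"
  proof -
    obtain \<psi> e where S: "S = (\<lambda>j. inst \<psi> (e j))" "\<psi> \<in> \<Psi>" "ok \<psi> e" using S unfolding \<S>_def by blast
    have "rlz M (ss, {(fst \<psi>, (e \<circ> r) i) |i. i \<in> I}) = {}" if "finite I" "card I = k \<psi>" for I
    proof -
      have "card (r ` I) = k \<psi>"
        using card_image[OF inj_on_subset[OF strict_mono_imp_inj_on[OF r] subset_UNIV], of I] that by simp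
      then have "rlz M (ss, {(fst \<psi>, e i) |i. i \<in> r ` I}) = {}"
        using S(3) that(1) unfolding ok_def inconsistent_def by blast
      moreover have "{(fst \<psi>, e i) |i. i \<in> r ` I} = {(fst \<psi>, (e \<circ> r) i) |i. i \<in> I}" by auto
      ultimately show ?thesis by simp
    qed
    then have "ok \<psi> (e \<circ> r)" using S(3) unfolding ok_def inconsistent_def by simp
    from \<S>I[OF S(2) this] show ?thesis unfolding S(1) by (simp add: o_def)
  qed
  have inc: "(\<Inter>j<K. S j) = {}" if S: "S \<in> \<S>" for S
  proof (rule ccontr)
    assume "\<not> ?thesis"
    then obtain x where x: "\<And>j. j < K \<Longrightarrow> x \<in> S j" by auto
    obtain \<psi> e where S: "S = (\<lambda>j. inst \<psi> (e j))" "\<psi> \<in> \<Psi>" "ok \<psi> e" using S unfolding \<S>_def by blast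
    have "k \<psi> < K" using member_le_sum[of \<psi> \<Psi> k] S(2) \<Psi>(1) by (simp add: K_def)
    moreover have "sorts M x = ss" using x[of 0] S(1) by (simp add: K_def inst_def)
    ultimately have "x \<in> rlz M (ss, {(fst \<psi>, e i) |i. i \<in> {..<k \<psi>}})"
      unfolding rlz_inst using x S(1) by auto
    then show False using S(3) card_lessThan[of "k \<psi>"] unfolding ok_def inconsistent_def by blast
  qed
  have F: "S j \<in> (\<Union>\<psi>\<in>\<Psi>. \<F> \<psi>)" if S: "S \<in> \<S>" for S j
  proof -
    obtain \<psi> e where S: "S = (\<lambda>j. inst \<psi> (e j))" "\<psi> \<in> \<Psi>" "ok \<psi> e" using S unfolding \<S>_def by blast
    then have "S j \<in> \<F> \<psi>" unfolding \<F>_def inst_def ok_def by blast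
    then show ?thesis using S(2) by blast
  qed
  have aut: "\<exists>S'\<in>\<S>. \<forall>j. map \<sigma> ` S j \<subseteq> S' j" if S: "S \<in> \<S>" and \<sigma>: "\<sigma> \<in> automorphisms M" for S \<sigma>
  proof -
    obtain \<psi> e where S: "S = (\<lambda>j. inst \<psi> (e j))" "\<psi> \<in> \<Psi>" "ok \<psi> e" using S unfolding \<S>_def by blast
    have step: "map \<sigma> y \<in> inst \<psi> (map \<sigma> (e j)) \<longleftrightarrow> y \<in> inst \<psi> (e j)" for y j
    proof -
      have "wf_fm M (ss @ sorts M (e j)) (fst \<psi>)" using wf[OF S(2)] S(3) by (simp add: ok_def)
      then show ?thesis using sat_inst_automorphism[OF \<sigma>, of ss "e j" "fst \<psi>" y] \<sigma>
        by (auto simp: inst_def)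
    qed
    have "rlz M (ss, {(fst \<psi>, map \<sigma> (e i)) |i. i \<in> I}) = {}" if I: "finite I" "card I = k \<psi>" for I
    proof (rule ccontr)
      assume "\<not> ?thesis"
      then obtain x where x: "x \<in> rlz M (ss, {(fst \<psi>, map \<sigma> (e i)) |i. i \<in> I})" by blast
      obtain y where y: "map \<sigma> y = x" using automorphisms_surj[OF \<sigma>] by blast
      have "y \<in> rlz M (ss, {(fst \<psi>, e i) |i. i \<in> I})"
        using x step automorphisms_sorts[OF \<sigma>, of y] unfolding rlz_inst y[symmetric] by simp
      then show False using S(3) I unfolding ok_def inconsistent_def by blast
    qed
    then have "ok \<psi> (\<lambda>j. map \<sigma> (e j))" using S(3) \<sigma> unfolding ok_def inconsistent_def by simp
    then have "(\<lambda>j. inst \<psi> (map \<sigma> (e j))) \<in> \<S>" by (rule \<S>I[OF S(2)])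
    then show ?thesis using step S(1) by (intro bexI) auto
  qed
  have "dividing_rank_ge \<S> m X" for m
  proof (induction m)
    case 0
    then show ?case using X(2) by simp
  next
    case (Suc m)
    have "X \<subseteq> (\<Union>\<psi>\<in>\<Psi>. X \<inter> inst \<psi> (snd \<psi>))" using cov by (fastforce simp: rlz_def psat_def inst_def)
    then have "dividing_rank_ge \<S> m (\<Union>\<psi>\<in>\<Psi>. X \<inter> inst \<psi> (snd \<psi>))" using dividing_rank_ge_mono[OF Suc] by blast
    then obtain \<psi> where \<psi>: "\<psi> \<in> \<Psi>" "dividing_rank_ge \<S> m (X \<inter> inst \<psi> (snd \<psi>))"
      using dividing_rank_ge_UN[OF sub \<Psi>(1)] by blast
    have sd: "sorts M (d \<psi> j) = sorts M (snd \<psi>)" for j using d[OF \<psi>(1), of j] by (simp add: rlz_def tp_def)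
    have "dividing_rank_ge \<S> m (X \<inter> inst \<psi> (d \<psi> j))" for j
    proof -
      have "tp M {} (d \<psi> j) = tp M {} (snd \<psi>)" using d[OF \<psi>(1)] by (simp add: rlz_tp_iff)
      then obtain \<sigma> where \<sigma>: "\<sigma> \<in> automorphisms M" "d \<psi> j = map \<sigma> (snd \<psi>)" unfolding tp_eq_iff by blast
      have "dividing_rank_ge \<S> m (map \<sigma> ` (X \<inter> inst \<psi> (snd \<psi>)))"
        by (rule dividing_rank_ge_image[OF aut \<psi>(2)]) (use \<sigma>(1) in auto)
      moreover have "map \<sigma> ` (X \<inter> inst \<psi> (snd \<psi>)) \<subseteq> X \<inter> inst \<psi> (d \<psi> j)"
        using definable_automorphism[OF X(1) \<sigma>(1)] sat_inst_automorphism[OF \<sigma>(1) wf[OF \<psi>(1)]] \<sigma>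
        by (auto simp: inst_def)
      ultimately show ?thesis by (rule dividing_rank_ge_mono)
    qed
    moreover have "ok \<psi> (d \<psi>)" unfolding ok_def using sd k[OF \<psi>(1)] by blast
    then have "(\<lambda>j. inst \<psi> (d \<psi> j)) \<in> \<S>" by (rule \<S>I[OF \<psi>(1)])
    ultimately show ?case unfolding dividing_rank_ge.simps by (intro bexI) auto
  qed
  then have "splits (\<Union>\<psi>\<in>\<Psi>. \<F> \<psi>) m X" for m
    using dividing_rank_ge_imp_splits[where \<S> = \<S> and K = K and \<F> = "\<Union>\<psi>\<in>\<Psi>. \<F> \<psi>"] sub inc F by blast
  then obtain \<psi> where \<psi>: "\<psi> \<in> \<Psi>" "\<And>m. splits (\<F> \<psi>) m X"
    using splits_finite_UN[OF \<Psi>(1)] by blast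
  then have "ladder (<) (\<F> \<psi>) X n" for n using splits_imp_ladder by blast
  then show False unfolding \<F>_def
    using stable_no_ladder[OF stable wf[OF \<psi>(1)]] definable_sorts[OF X(1)] by blast
qed

text \<open>The complements of the \<open>B\<close>-definable sets covered by finitely many dividing formulas are consistent
with the type of \<open>d\<close>, since otherwise a definable set from that type would itself be covered.\<close>

lemma nonforking_extension:
  assumes stable: "stable_theory M" and B: "small \<kappa> B"
  shows "\<exists>d'. tp M {} d' = tp M {} d \<and> indep M d' {} B"
proof -
  define ss where "ss = sorts M d"
  define forkset where "forkset Y \<longleftrightarrow> (\<exists>\<Psi>. finite \<Psi> \<and> \<Psi> \<subseteq> pfms M UNIV ss \<and>
      (\<forall>\<psi>\<in>\<Psi>. divides M {} ss \<psi>) \<and> Y \<subseteq> (\<Union>\<psi>\<in>\<Psi>. rlz M (ss, {\<psi>})))" for Y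
  define \<D>1 where "\<D>1 = {D. definable M {} ss D \<and> d \<in> D}"
  define \<D>2 where "\<D>2 = {Y. definable M B ss Y \<and> forkset Y}"
  let ?U = "{x. sorts M x = ss}"
  have "\<exists>x. sorts M x = ss \<and> (\<forall>D\<in>\<D>1 \<union> (\<lambda>Y. ?U - Y) ` \<D>2. x \<in> D)"
  proof (rule compactness[OF B])
    fix D assume "D \<in> \<D>1 \<union> (\<lambda>Y. ?U - Y) ` \<D>2"
    then show "definable M B ss D"
      unfolding \<D>1_def \<D>2_def by (auto intro: definable_Compl definable_mono[of "{}"])
  next
    fix \<E> assume \<E>: "finite \<E>" "\<E> \<subseteq> \<D>1 \<union> (\<lambda>Y. ?U - Y) ` \<D>2"
    show "\<exists>x. sorts M x = ss \<and> (\<forall>D\<in>\<E>. x \<in> D)"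
    proof (rule ccontr)
      assume no: "\<not> ?thesis"
      define X where "X = ?U \<inter> \<Inter>(\<E> \<inter> \<D>1)"
      have X: "definable M {} ss X" unfolding X_def
        by (rule definable_Inter) (use \<E> in \<open>auto simp: \<D>1_def\<close>)
      have dX: "d \<in> X" by (auto simp: X_def \<D>1_def ss_def)
      have "\<E> - \<D>1 \<subseteq> (\<lambda>Y. ?U - Y) ` \<D>2" "finite (\<E> - \<D>1)" using \<E> by auto
      then obtain \<Y> where \<Y>: "\<Y> \<subseteq> \<D>2" "finite \<Y>" "\<E> - \<D>1 = (\<lambda>Y. ?U - Y) ` \<Y>"
        using finite_subset_image by metis
      have "\<forall>Y\<in>\<Y>. \<exists>\<Psi>. finite \<Psi> \<and> \<Psi> \<subseteq> pfms M UNIV ss \<and>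
          (\<forall>\<psi>\<in>\<Psi>. divides M {} ss \<psi>) \<and> Y \<subseteq> (\<Union>\<psi>\<in>\<Psi>. rlz M (ss, {\<psi>}))"
        using \<Y>(1) unfolding \<D>2_def forkset_def by blast
      then obtain \<Psi> where \<Psi>: "\<And>Y. Y \<in> \<Y> \<Longrightarrow> finite (\<Psi> Y) \<and> \<Psi> Y \<subseteq> pfms M UNIV ss \<and>
          (\<forall>\<psi>\<in>\<Psi> Y. divides M {} ss \<psi>) \<and> Y \<subseteq> (\<Union>\<psi>\<in>\<Psi> Y. rlz M (ss, {\<psi>}))" by metis
      have "X \<subseteq> \<Union>\<Y>"
      proof
        fix x assume x: "x \<in> X"
        then have sx: "sorts M x = ss" by (simp add: X_def)
        then obtain D where D: "D \<in> \<E>" "x \<notin> D" using no by blast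
        then have "D \<in> \<E> - \<D>1" using x by (auto simp: X_def)
        then obtain Y where "Y \<in> \<Y>" "D = ?U - Y" unfolding \<Y>(3) by blast
        then show "x \<in> \<Union>\<Y>" using D sx by blast
      qed
      then have "X \<subseteq> (\<Union>\<psi>\<in>(\<Union>Y\<in>\<Y>. \<Psi> Y). rlz M (ss, {\<psi>}))"
      proof (rule subset_trans)
        have "Y \<subseteq> (\<Union>\<psi>\<in>\<Psi> Y. rlz M (ss, {\<psi>}))" if "Y \<in> \<Y>" for Y using \<Psi>[OF that] by blast
        then show "\<Union>\<Y> \<subseteq> (\<Union>\<psi>\<in>(\<Union>Y\<in>\<Y>. \<Psi> Y). rlz M (ss, {\<psi>}))" by fastforce
      qed
      moreover have "finite (\<Union>Y\<in>\<Y>. \<Psi> Y)" "(\<Union>Y\<in>\<Y>. \<Psi> Y) \<subseteq> pfms M UNIV ss"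
        "\<forall>\<psi>\<in>(\<Union>Y\<in>\<Y>. \<Psi> Y). divides M {} ss \<psi>" using \<Psi> \<Y>(2) by auto
      moreover have "X \<noteq> {}" using dX by blast
      ultimately show False using not_covered_by_dividing[OF stable X] by blast
    qed
  qed
  then obtain d' where d0: "sorts M d' = ss" "\<forall>D\<in>\<D>1 \<union> (\<lambda>Y. ?U - Y) ` \<D>2. d' \<in> D" by blast
  have d': "sorts M d' = ss" "\<And>D. D \<in> \<D>1 \<Longrightarrow> d' \<in> D" "\<And>Y. Y \<in> \<D>2 \<Longrightarrow> d' \<notin> Y"
    using d0 by auto
  have "psat M d' \<chi>" if "\<chi> \<in> snd (tp M {} d)" for \<chi>
  proof -
    have "rlz M (ss, {\<chi>}) \<in> \<D>1"
      using that by (auto simp: \<D>1_def definable_def tp_def ss_def rlz_def)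
    then show ?thesis using d'(2) by (auto simp: rlz_def)
  qed
  then have "d' \<in> rlz M (tp M {} d)" using d'(1) by (simp add: rlz_def ss_def)
  then have "tp M {} d' = tp M {} d" by (simp add: rlz_tp_iff)
  moreover have "indep M d' {} B"
    unfolding indep_def
  proof
    assume "forks M {} (tp M ({} \<union> B) d')"
    then obtain \<Delta> \<Psi> where \<Delta>: "finite \<Delta>" "\<Delta> \<subseteq> snd (tp M B d')"
      and \<Psi>: "finite \<Psi>" "\<Psi> \<subseteq> pfms M UNIV ss" "\<forall>\<psi>\<in>\<Psi>. divides M {} ss \<psi>"
        "\<forall>x\<in>rlz M (ss, \<Delta>). \<exists>\<psi>\<in>\<Psi>. psat M x \<psi>"
      unfolding forks_def by (auto simp: d'(1))
    have "\<Delta> \<subseteq> pfms M B ss" using \<Delta>(2) d'(1) by (auto simp: tp_def)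
    then have "definable M B ss (rlz M (ss, \<Delta>))" by (rule definable_rlz_finite[OF \<Delta>(1)])
    moreover have "rlz M (ss, \<Delta>) \<subseteq> (\<Union>\<psi>\<in>\<Psi>. rlz M (ss, {\<psi>}))" using \<Psi>(4) by (force simp: rlz_def)
    ultimately have "rlz M (ss, \<Delta>) \<in> \<D>2" unfolding \<D>2_def forkset_def using \<Psi>(1-3) by blast
    moreover have "d' \<in> rlz M (ss, \<Delta>)" using \<Delta>(2) d'(1) by (auto simp: rlz_def tp_def)
    ultimately show False using d'(3) by blast
  qed
  ultimately show ?thesis by blast
qed

text \<open>A witness to dividing over \<open>C\<close> also witnesses dividing over \<open>\<emptyset>\<close>.\<close>

lemma indep_over_larger_base:
  assumes "indep M d {} B" "C \<subseteq> B" shows "indep M d C B"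
proof -
  have "C \<union> B = B" using assms(2) by blast
  moreover have "snd (tp M {} e) \<subseteq> snd (tp M C e)" for e by (auto simp: tp_def pfms_def)
  then have "rlz M (tp M C e) \<subseteq> rlz M (tp M {} e)" for e by (auto simp: rlz_def)
  then have "divides M C ss \<psi> \<Longrightarrow> divides M {} ss \<psi>" for ss \<psi>
    unfolding divides_def by (meson subsetD)
  then have "forks M {} (tp M B d)" if "forks M C (tp M B d)"
    using that unfolding forks_def by meson
  ultimately show ?thesis using assms(1) unfolding indep_def by auto
qed

text \<open>A partial function maps a common point of preimages to a common point of the sets themselves, so
taking preimages preserves inconsistency.  Here \<open>H\<close>, with parameter \<open>c\<close>, is the graph of the
function, and \<open>\<psi>'\<close> defines the preimage of \<open>\<psi>\<close>.\<close>

lemma divides_pullback: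
  assumes C: "small \<kappa> C" and H: "definable M {} (ssd @ ssa @ sorts M c) H" and c: "set c \<subseteq> C"
    and uniq: "\<forall>y x x'. sorts M y = ssd \<and> sorts M x = ssa \<and> sorts M x' = ssa \<and>
      y @ x @ c \<in> H \<and> y @ x' @ c \<in> H \<longrightarrow> x = x'"
    and \<psi>: "\<psi> \<in> pfms M UNIV ssa" "divides M C ssa \<psi>" and ne: "\<exists>a. sorts M a = ssa"
  shows "\<exists>\<psi>'\<in>pfms M UNIV ssd. divides M C ssd \<psi>' \<and>
    (\<forall>y x. sorts M y = ssd \<longrightarrow> sorts M x = ssa \<longrightarrow> y @ x @ c \<in> H \<longrightarrow> psat M x \<psi> \<longrightarrow> psat M y \<psi>')"
proof -
  obtain \<phi> e where \<phi>: "\<psi> = (\<phi>, e)" "wf_fm M (ssa @ sorts M e) \<phi>"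
    using \<psi>(1) by (auto simp: pfms_def)
  define W where "W = {x. sorts M x = ssa @ sorts M e \<and> sat M x \<phi>}"
  have W: "definable M {} (ssa @ sorts M e) W" unfolding W_def definable_empty_iff using \<phi>(2) by blast
  define \<Gamma> where "\<Gamma> = (\<lambda>_::nat. [])(0 := ssd, 1 := ssa, 2 := sorts M e, 3 := sorts M c)"
  have "definable_pred \<Gamma> [1, 0, 2, 3] (\<lambda>v. v 0 @ v 1 @ v 3 \<in> H \<and> v 1 @ v 2 \<in> W)"
    by (intro definable_pred_conj definable_pred_mem2 definable_pred_mem3) (use H W in \<open>simp_all add: \<Gamma>_def\<close>)
  then have "definable_pred \<Gamma> [0, 2, 3] (ex_block \<Gamma> 1 (\<lambda>v. v 0 @ v 1 @ v 3 \<in> H \<and> v 1 @ v 2 \<in> W))"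
    by (rule definable_pred_ex_block) simp
  then obtain \<theta> where \<theta>: "wf_fm M (ssd @ sorts M e @ sorts M c) \<theta>"
    "\<And>v :: nat \<Rightarrow> 'm list. sorts M (v 0) = ssd \<Longrightarrow> sorts M (v 2) = sorts M e \<Longrightarrow> sorts M (v 3) = sorts M c \<Longrightarrow>
      sat M (v 0 @ v 2 @ v 3) \<theta> \<longleftrightarrow>
        (\<exists>x. sorts M x = ssa \<and> v 0 @ x @ v 3 \<in> H \<and> x @ v 2 \<in> W)"
    unfolding definable_pred_def by (auto simp: \<Gamma>_def ex_block_def)
  have sat\<theta>: "sat M (y @ e' @ c) \<theta> \<longleftrightarrow> (\<exists>x. sorts M x = ssa \<and> y @ x @ c \<in> H \<and> sat M (x @ e') \<phi>)"
    if "sorts M y = ssd" "sorts M e' = sorts M e" for y e'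
    using \<theta>(2)[of "(\<lambda>_. [])(0 := y, 2 := e', 3 := c)"] that by (auto simp: W_def)
  have "divides M C ssd (\<theta>, e @ c)"
  proof -
    obtain d :: "nat \<Rightarrow> 'm list" and k where dk: "(\<forall>i. d i \<in> rlz M (tp M C e)) \<and>
      (\<forall>I. finite I \<and> card I = k \<longrightarrow> rlz M (ssa, {(\<phi>, d i) |i. i \<in> I}) = {})"
      using \<psi>(2) unfolding divides_def \<phi>(1) fst_conv snd_conv by (elim exE)
    then have d: "d i \<in> rlz M (tp M C e)" for i by blast
    have k: "rlz M (ssa, {(\<phi>, d i) |i. i \<in> I}) = {}" if "finite I" "card I = k" for I
      using dk that by blast
    have sd: "sorts M (d i) = sorts M e" for i using d[of i] by (simp add: rlz_def)
    have "d i @ c \<in> rlz M (tp M C (e @ c))" for i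
    proof -
      have "tp M C e = tp M C (d i)" using d[of i] by (simp add: rlz_tp_iff)
      then obtain \<sigma> where \<sigma>: "\<sigma> \<in> automorphisms M" "\<forall>b\<in>C. \<sigma> b = b" "map \<sigma> e = d i"
        using homogeneous_over[OF C] by blast
      have "map \<sigma> c = c" using \<sigma>(2) c by (intro map_idI) auto
      then have "map \<sigma> (e @ c) = d i @ c" using \<sigma>(3) by simp
      then show ?thesis using tp_automorphism[OF \<sigma>(1), of C "e @ c"] \<sigma>(2) by (simp add: rlz_tp_iff)
    qed
    moreover have "rlz M (ssd, {(\<theta>, d i @ c) |i. i \<in> I}) = {}" if I: "finite I" "card I = k" for I
    proof (rule ccontr)
      assume "\<not> ?thesis"
      then obtain y where y: "sorts M y = ssd" "\<And>i. i \<in> I \<Longrightarrow> sat M (y @ d i @ c) \<theta>"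
        by (auto simp: rlz_def psat_def)
      \<comment> \<open>A bound \<open>k = 0\<close> would make the whole sort empty.\<close>
      have "I \<noteq> {}"
      proof
        assume "I = {}"
        then have "rlz M (ssa, {}) = {}" using k[OF I] by simp
        then show False using ne by (auto simp: rlz_def)
      qed
      then obtain i0 where i0: "i0 \<in> I" by blast
      obtain x where x: "sorts M x = ssa" "y @ x @ c \<in> H"
        using y(2)[OF i0] sat\<theta>[OF y(1) sd] by blast
      have "sat M (x @ d i) \<phi>" if "i \<in> I" for i
        using y(2)[OF that] sat\<theta>[OF y(1) sd] uniq y(1) x by blast
      then have "x \<in> rlz M (ssa, {(\<phi>, d i) |i. i \<in> I})" using x(1) by (auto simp: rlz_def psat_def)
      then show False using k[OF I] by blast
    qed
    ultimately show ?thesis unfolding divides_def by (intro exI[of _ "\<lambda>i. d i @ c"] exI[of _ k]) simp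
  qed
  moreover have "(\<theta>, e @ c) \<in> pfms M UNIV ssd" using \<theta>(1) by (simp add: pfms_def)
  moreover have "psat M y (\<theta>, e @ c)"
    if "sorts M y = ssd" "sorts M x = ssa" "y @ x @ c \<in> H" "psat M x \<psi>" for y x
    using that sat\<theta>[OF that(1) refl] by (auto simp: psat_def \<phi>(1))
  ultimately show ?thesis by blast
qed

text \<open>If \<open>a\<close> is the image of \<open>d\<close> under a function definable over \<open>C\<close>, a formula over \<open>B\<close> and the dividing
formulas by which the type of \<open>a\<close> forks pull back to ones by which the type of \<open>d\<close> forks.\<close>

lemma indep_definable_image:
  assumes B: "small \<kappa> B" and CB: "C \<subseteq> B"
    and H: "definable M {} (sorts M d @ sorts M a @ sorts M c) H" and c: "set c \<subseteq> C"
    and uniq: "\<forall>y x x'. sorts M y = sorts M d \<and> sorts M x = sorts M a \<and> sorts M x' = sorts M a \<and>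
      y @ x @ c \<in> H \<and> y @ x' @ c \<in> H \<longrightarrow> x = x'"
    and da: "d @ a @ c \<in> H" and ind: "indep M d C B"
  shows "indep M a C B"
  unfolding indep_def
proof
  have CB': "C \<union> B = B" using CB by blast
  have C: "small \<kappa> C"
    using B CB card_of_mono1 ordLeq_ordLess_trans unfolding small_def by blast
  let ?sa = "sorts M a" and ?sd = "sorts M d"
  assume "forks M C (tp M (C \<union> B) a)"
  then have "\<exists>\<Delta> \<Psi>. finite \<Delta> \<and> \<Delta> \<subseteq> snd (tp M B a) \<and> finite \<Psi> \<and> \<Psi> \<subseteq> pfms M UNIV ?sa \<and>
      (\<forall>\<psi>\<in>\<Psi>. divides M C ?sa \<psi>) \<and> (\<forall>x\<in>rlz M (?sa, \<Delta>). \<exists>\<psi>\<in>\<Psi>. psat M x \<psi>)"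
    unfolding forks_def CB' by simp
  then obtain \<Delta> \<Psi> where \<Delta>: "finite \<Delta>" "\<Delta> \<subseteq> snd (tp M B a)"
    and \<Psi>: "finite \<Psi>" "\<Psi> \<subseteq> pfms M UNIV ?sa" "\<forall>\<psi>\<in>\<Psi>. divides M C ?sa \<psi>"
      "\<forall>x\<in>rlz M (?sa, \<Delta>). \<exists>\<psi>\<in>\<Psi>. psat M x \<psi>"
    by blast
  have "\<Delta> \<subseteq> pfms M B ?sa" using \<Delta>(2) by (auto simp: tp_def)
  then have "definable M B ?sa (rlz M (?sa, \<Delta>))" by (rule definable_rlz_finite[OF \<Delta>(1)])
  then obtain b W where b: "set b \<subseteq> B" "definable M {} (?sa @ sorts M b) W"
    "rlz M (?sa, \<Delta>) = {x. sorts M x = ?sa \<and> x @ b \<in> W}"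
    using iffD1[OF definable_iff_param, of B ?sa "rlz M (?sa, \<Delta>)"] by blast
  define \<Gamma> where "\<Gamma> = (\<lambda>_::nat. [])(0 := ?sd, 1 := ?sa, 2 := sorts M c, 3 := sorts M b)"
  have "definable_pred \<Gamma> [1, 0, 2, 3] (\<lambda>v. v 0 @ v 1 @ v 2 \<in> H \<and> v 1 @ v 3 \<in> W)"
    by (intro definable_pred_conj definable_pred_mem2 definable_pred_mem3) (use H b(2) in \<open>simp_all add: \<Gamma>_def\<close>)
  then have "definable_pred \<Gamma> [0, 2, 3] (ex_block \<Gamma> 1 (\<lambda>v. v 0 @ v 1 @ v 2 \<in> H \<and> v 1 @ v 3 \<in> W))"
    by (rule definable_pred_ex_block) simp
  from definable_fibre[OF this, of "(\<lambda>_. [])(2 := c, 3 := b)" B] c b(1) CB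
  have Y: "definable M B ?sd {y. sorts M y = ?sd \<and>
      (\<exists>x. sorts M x = ?sa \<and> y @ x @ c \<in> H \<and> x @ b \<in> W)}" (is "definable M B ?sd ?Y")
    by (simp add: \<Gamma>_def ex_block_def subset_trans)
  then obtain \<chi> where \<chi>: "\<chi> \<in> pfms M B ?sd" "?Y = rlz M (?sd, {\<chi>})"
    unfolding definable_def by blast
  have "a \<in> rlz M (?sa, \<Delta>)" using \<Delta>(2) by (auto simp: rlz_def tp_def)
  then have "d \<in> ?Y" using da b(3) by blast
  then have "\<chi> \<in> snd (tp M B d)" using \<chi> by (auto simp: tp_def rlz_def)
  have "\<forall>\<psi>\<in>\<Psi>. \<exists>\<psi>'. \<psi>' \<in> pfms M UNIV ?sd \<and> divides M C ?sd \<psi>' \<and>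
    (\<forall>y x. sorts M y = ?sd \<longrightarrow> sorts M x = ?sa \<longrightarrow> y @ x @ c \<in> H \<longrightarrow> psat M x \<psi> \<longrightarrow> psat M y \<psi>')"
  proof
    fix \<psi> assume "\<psi> \<in> \<Psi>"
    then have *: "\<psi> \<in> pfms M UNIV ?sa" "divides M C ?sa \<psi>" using \<Psi>(2,3) by blast+
    show "\<exists>\<psi>'. \<psi>' \<in> pfms M UNIV ?sd \<and> divides M C ?sd \<psi>' \<and>
      (\<forall>y x. sorts M y = ?sd \<longrightarrow> sorts M x = ?sa \<longrightarrow> y @ x @ c \<in> H \<longrightarrow> psat M x \<psi> \<longrightarrow> psat M y \<psi>')"
      using divides_pullback[OF C H c uniq *] by blast
  qed
  then obtain t where t: "\<And>\<psi>. \<psi> \<in> \<Psi> \<Longrightarrow> t \<psi> \<in> pfms M UNIV ?sd \<and> divides M C ?sd (t \<psi>) \<and>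
    (\<forall>y x. sorts M y = ?sd \<longrightarrow> sorts M x = ?sa \<longrightarrow> y @ x @ c \<in> H \<longrightarrow> psat M x \<psi> \<longrightarrow> psat M y (t \<psi>))"
    by metis
  have "\<exists>\<psi>\<in>t ` \<Psi>. psat M y \<psi>" if y: "y \<in> rlz M (?sd, {\<chi>})" for y
  proof -
    have "y \<in> ?Y" using y \<chi>(2) by simp
    then obtain x where x: "sorts M y = ?sd" "sorts M x = ?sa" "y @ x @ c \<in> H" "x @ b \<in> W" by blast
    then have "x \<in> rlz M (?sa, \<Delta>)" using b(3) by blast
    then obtain \<psi> where "\<psi> \<in> \<Psi>" "psat M x \<psi>" using \<Psi>(4) by blast
    then show ?thesis using t x by blast
  qed
  then have "forks M C (tp M B d)"
    unfolding forks_def using \<open>\<chi> \<in> snd (tp M B d)\<close> \<Psi>(1) t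
    by (intro exI[of _ "{\<chi>}"] exI[of _ "t ` \<Psi>"]) auto
  then show False using ind unfolding indep_def CB' by blast
qed

section \<open>Definable closure and quotients\<close>

lemma definable_image:
  assumes "definable M A ss D" "\<sigma> \<in> automorphisms M"
  shows "definable M (\<sigma> ` A) ss (map \<sigma> ` D)"
proof -
  obtain b X where b: "set b \<subseteq> A" "definable M {} (ss @ sorts M b) X"
    "D = {x. sorts M x = ss \<and> x @ b \<in> X}" using iffD1[OF definable_iff_param assms(1)] by blast
  have inv: "map \<sigma> x @ map \<sigma> b \<in> X \<longleftrightarrow> x @ b \<in> X" for x
    using definable_automorphism[OF b(2) assms(2), of "x @ b"] by simp
  have "map \<sigma> ` D = {x. sorts M x = ss \<and> x @ map \<sigma> b \<in> X}"
  proof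
    show "map \<sigma> ` D \<subseteq> {x. sorts M x = ss \<and> x @ map \<sigma> b \<in> X}"
      using inv automorphisms_sorts[OF assms(2)] unfolding b(3) by auto
    show "{x. sorts M x = ss \<and> x @ map \<sigma> b \<in> X} \<subseteq> map \<sigma> ` D"
    proof
      fix x assume x: "x \<in> {x. sorts M x = ss \<and> x @ map \<sigma> b \<in> X}"
      obtain y where y: "map \<sigma> y = x" using automorphisms_surj[OF assms(2)] by blast
      then have "y \<in> D" using x inv[of y] automorphisms_sorts[OF assms(2), of y] unfolding b(3) by simp
      then show "x \<in> map \<sigma> ` D" using y by blast
    qed
  qed
  moreover have "set (map \<sigma> b) \<subseteq> \<sigma> ` A" using b(1) by auto
  moreover have "definable M {} (ss @ sorts M (map \<sigma> b)) X" using b(2) assms(2) by simp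
  ultimately show ?thesis unfolding definable_iff_param[of "\<sigma> ` A"] by blast
qed

lemma dcl_automorphism:
  assumes "m \<in> dcl M A" "\<sigma> \<in> automorphisms M" shows "\<sigma> m \<in> dcl M (\<sigma> ` A)"
  using definable_image[of A "[sort_of M m]" "{[m]}" \<sigma>] assms automorphisms_sort[OF assms(2)]
  unfolding dcl_def by auto

text \<open>Parameters from the definable closure of \<open>A\<close> are eliminated one entry at a time, by quantifying
over the entry and requiring it to lie in a singleton definable over \<open>A\<close>.\<close>

lemma definable_section:
  "set y \<subseteq> dcl M A \<Longrightarrow> definable M A (sorts M y @ ts) X \<Longrightarrow>
     definable M A ts {u. sorts M u = ts \<and> y @ u \<in> X}"
proof (induction y arbitrary: X)
  case Nil
  then have "{u. sorts M u = ts \<and> [] @ u \<in> X} = X" using definable_sorts by auto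
  then show ?case using Nil by simp
next
  case (Cons m y)
  let ?s = "[sort_of M m]"
  have m: "definable M A ?s {[m]}" using Cons.prems(1) by (simp add: dcl_def)
  obtain b W where b: "set b \<subseteq> A" "definable M {} (?s @ sorts M b) W"
    "{[m]} = {x. sorts M x = ?s \<and> x @ b \<in> W}" using iffD1[OF definable_iff_param m] by blast
  obtain e Z where e: "set e \<subseteq> A" "definable M {} ((sorts M (m # y) @ ts) @ sorts M e) Z"
    "X = {x. sorts M x = sorts M (m # y) @ ts \<and> x @ e \<in> Z}"
    using iffD1[OF definable_iff_param Cons.prems(2)] by blast
  define \<Gamma> where "\<Gamma> = (\<lambda>_::nat. [])(0 := sorts M y @ ts, 1 := ?s, 2 := sorts M b, 3 := sorts M e)"
  have "definable_pred \<Gamma> [1, 0, 2, 3] (\<lambda>v. v 1 @ v 2 \<in> W \<and> v 1 @ v 0 @ v 3 \<in> Z)"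
    by (intro definable_pred_conj definable_pred_mem2 definable_pred_mem3) (use b(2) e(2) in \<open>simp_all add: \<Gamma>_def\<close>)
  then have "definable_pred \<Gamma> [0, 2, 3] (ex_block \<Gamma> 1 (\<lambda>v. v 1 @ v 2 \<in> W \<and> v 1 @ v 0 @ v 3 \<in> Z))"
    by (rule definable_pred_ex_block) simp
  from definable_fibre[OF this, of "(\<lambda>_. [])(2 := b, 3 := e)" A] b(1) e(1)
  have 1: "definable M A (sorts M y @ ts)
    {u. sorts M u = sorts M y @ ts \<and> (\<exists>w. sorts M w = ?s \<and> w @ b \<in> W \<and> w @ u @ e \<in> Z)}"
    by (simp add: \<Gamma>_def ex_block_def)
  have w: "sorts M w = ?s \<and> w @ b \<in> W \<longleftrightarrow> w = [m]" for w
    using arg_cong[OF b(3), of "\<lambda>S. w \<in> S"] by auto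
  have "{u. sorts M u = sorts M y @ ts \<and> (\<exists>w. sorts M w = ?s \<and> w @ b \<in> W \<and> w @ u @ e \<in> Z)} =
      {u. sorts M u = sorts M y @ ts \<and> [m] @ u \<in> X}" (is "?L = ?R")
  proof -
    have "(\<exists>w. sorts M w = ?s \<and> w @ b \<in> W \<and> w @ u @ e \<in> Z) \<longleftrightarrow> [m] @ u @ e \<in> Z" for u
      by (simp only: conj_assoc[symmetric] w) auto
    then show ?thesis unfolding e(3) by simp
  qed
  then have "definable M A (sorts M y @ ts) ?R" using 1 by simp
  from Cons.IH[OF _ this] Cons.prems(1)
  have "definable M A ts {u. sorts M u = ts \<and> y @ u \<in> ?R}" by simp
  moreover have "{u. sorts M u = ts \<and> y @ u \<in> ?R} = {u. sorts M u = ts \<and> (m # y) @ u \<in> X}" by auto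
  ultimately show ?case by simp
qed

lemma dcl_definable_pfun:
  assumes f: "definable_pfun M {} ss ts f" "f y = Some b" and y: "set y \<subseteq> dcl M A"
  shows "set b \<subseteq> dcl M A"
proof
  fix m assume "m \<in> set b"
  then obtain b1 b2 where b: "b = b1 @ [m] @ b2" by (metis append_Cons append_Nil split_list)
  have s: "sorts M y = ss" "sorts M b = ts" using f unfolding definable_pfun_def by blast+
  define W where "W = {x @ y |x y. f x = Some y}"
  have W: "definable M {} (ss @ ts) W" using f(1) unfolding definable_pfun_def W_def by blast
  have mem: "y @ z \<in> W \<longleftrightarrow> z = b1 @ [m] @ b2" for z
    unfolding W_def pfun_graph[OF f(1) s(1)] f(2) b by auto
  define \<Gamma> where "\<Gamma> = (\<lambda>_::nat. [])(0 := ss, 1 := [sort_of M m], 2 := sorts M b1, 3 := sorts M b2)"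
  define E where "E = ex_block \<Gamma> 2 (ex_block \<Gamma> 3 (\<lambda>v :: nat \<Rightarrow> 'm list. concat (map v [0, 2, 1, 3]) \<in> W))"
  have "definable_pred \<Gamma> [3, 2, 0, 1] (\<lambda>v. concat (map v [0, 2, 1, 3]) \<in> W)"
    by (rule definable_pred_mem) (use W s(2)[symmetric] b in \<open>simp_all add: \<Gamma>_def\<close>)
  then have "definable_pred \<Gamma> [0, 1] E" unfolding E_def by (intro definable_pred_ex_block) simp_all
  from definable_two_blocks[OF this, of "\<lambda>_. []"]
  have "definable M {} (ss @ [sort_of M m])
      {x @ u |x u. sorts M x = ss \<and> sorts M u = [sort_of M m] \<and> E ((\<lambda>_. [])(0 := x, 1 := u))}"
    by (simp add: \<Gamma>_def)
  moreover define Z where "Z = {x @ u |x u. sorts M x = ss \<and> sorts M u = [sort_of M m] \<and>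
      E ((\<lambda>_. [])(0 := x, 1 := u))}"
  ultimately have Z: "definable M {} (ss @ [sort_of M m]) Z" by simp
  have "y @ u \<in> Z \<longleftrightarrow> u = [m]" if u: "sorts M u = [sort_of M m]" for u
  proof -
    have "y @ u \<in> Z \<longleftrightarrow> E ((\<lambda>_. [])(0 := y, 1 := u))"
      unfolding Z_def append_mem_blocks[OF s(1)] using u by simp
    also have "\<dots> \<longleftrightarrow> (\<exists>c1. sorts M c1 = sorts M b1 \<and> (\<exists>c2. sorts M c2 = sorts M b2 \<and>
        y @ (c1 @ u @ c2) \<in> W))"
      unfolding E_def ex_block_def by (simp add: \<Gamma>_def)
    also have "\<dots> \<longleftrightarrow> (\<exists>c1. sorts M c1 = sorts M b1 \<and> (\<exists>c2. sorts M c2 = sorts M b2 \<and>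
        c1 @ u @ c2 = b1 @ [m] @ b2))"
      unfolding mem ..
    also have "\<dots> \<longleftrightarrow> u = [m]"
    proof
      assume "\<exists>c1. sorts M c1 = sorts M b1 \<and> (\<exists>c2. sorts M c2 = sorts M b2 \<and>
        c1 @ u @ c2 = b1 @ [m] @ b2)"
      then obtain c1 c2 where c: "sorts M c1 = sorts M b1" "c1 @ u @ c2 = b1 @ [m] @ b2" by blast
      have "length c1 = length b1" "length u = 1" using c(1) u by (auto dest: map_eq_imp_length_eq)
      then show "u = [m]" using c(2) by (cases u) auto
    qed blast
    finally show ?thesis .
  qed
  then have "{u. sorts M u = [sort_of M m] \<and> y @ u \<in> Z} = {[m]}" by auto
  moreover have "definable M A [sort_of M m] {u. sorts M u = [sort_of M m] \<and> y @ u \<in> Z}"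
    by (rule definable_section[OF y]) (use definable_mono[OF Z, of A] s(1) in simp)
  ultimately show "m \<in> dcl M A" by (simp add: dcl_def)
qed

text \<open>Elimination of imaginaries provides for a single class a formula and a unique code; the
function sending \<open>x\<close> to the unique code of its class by this formula is definable, and its domain
contains all conjugates of one element, hence all realizations of \<open>q\<close>.\<close>

lemma definable_quotient:
  assumes EI: "eliminates_imaginaries M" and q: "complete_type M {} q"
    and E: "equiv {x. sorts M x = fst q} E" "definable M {} (fst q @ fst q) {x @ y |x y. (x, y) \<in> E}"
  shows "\<exists>ts f. definable_pfun M {} (fst q) ts f \<and> rlz M q \<subseteq> dom f \<and>
    (\<forall>x\<in>rlz M q. \<forall>y\<in>rlz M q. f x = f y \<longleftrightarrow> (x, y) \<in> E)"
proof -
  let ?ss = "fst q"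
  obtain a where a: "q = tp M {} a" using complete_type_realized[OF q] by blast
  have sa: "sorts M a = ?ss" using a by simp
  have "equiv {x. sorts M x = ?ss} E \<and> definable M {} (?ss @ ?ss) {x @ y |x y. (x, y) \<in> E} \<and>
      sorts M a = ?ss" using E sa by simp
  then have "\<exists>ts \<theta>. wf_fm M (?ss @ ts) \<theta> \<and>
      (\<exists>!b. sorts M b = ts \<and> E `` {a} = {x. sorts M x = ?ss \<and> sat M (x @ b) \<theta>})"
    by (rule EI[unfolded eliminates_imaginaries_def, rule_format])
  then obtain ts \<theta> where \<theta>: "wf_fm M (?ss @ ts) \<theta>"
    "\<exists>!b. sorts M b = ts \<and> E `` {a} = {x. sorts M x = ?ss \<and> sat M (x @ b) \<theta>}"
    by (elim exE conjE)
  define W where "W = {x. sorts M x = ?ss @ ts \<and> sat M x \<theta>}"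
  have W: "definable M {} (?ss @ ts) W" unfolding W_def definable_empty_iff using \<theta>(1) by blast
  define EE where "EE = {x @ y |x y. (x, y) \<in> E}"
  have Es: "sorts M x = ?ss" "sorts M y = ?ss" if "(x, y) \<in> E" for x y
    using E(1) that unfolding equiv_def refl_on_def by auto
  have EEm: "x @ y \<in> EE \<longleftrightarrow> (x, y) \<in> E" if "sorts M x = ?ss" for x y
  proof
    assume "x @ y \<in> EE"
    then obtain x' y' where *: "x @ y = x' @ y'" "(x', y') \<in> E" unfolding EE_def by blast
    have "length x = length x'" using Es(1)[OF *(2)] that by (metis length_map)
    then show "(x, y) \<in> E" using * by simp
  qed (auto simp: EE_def)
  define code where "code x b \<longleftrightarrow> sorts M b = ts \<and> (\<forall>z. sorts M z = ?ss \<longrightarrow> ((x, z) \<in> E \<longleftrightarrow> z @ b \<in> W))" for x b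
  define \<Gamma> where "\<Gamma> = (\<lambda>_::nat. [])(0 := ?ss, 1 := ts, 2 := ?ss, 3 := ts)"
  \<comment> \<open>\<open>nc i v\<close> says that the block \<open>i\<close> does not code the class of the block \<open>0\<close>.\<close>
  define nc where "nc i = ex_block \<Gamma> 2 (\<lambda>v :: nat \<Rightarrow> 'm list. \<not> (v 0 @ v 2 \<in> EE \<longleftrightarrow> v 2 @ v i \<in> W))" for i
  have nc: "nc i v \<longleftrightarrow> \<not> code (v 0) (v i)" if "sorts M (v 0) = ?ss" "sorts M (v i) = ts" "i \<noteq> 2" for v i
    using that EEm by (auto simp: nc_def ex_block_def code_def \<Gamma>_def)
  have nc_definable: "definable_pred \<Gamma> ns (nc i)" if "0 \<in> set ns" "i \<in> set ns" "i \<in> {1, 3}" "2 \<notin> set ns" for ns i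
    unfolding nc_def
    by (intro definable_pred_ex_block definable_pred_neg definable_pred_iff definable_pred_mem2) (use that E(2) W in \<open>auto simp: \<Gamma>_def EE_def\<close>)
  define PP where "PP v \<longleftrightarrow> \<not> nc 1 v \<and> \<not> ex_block \<Gamma> 3 (\<lambda>v. \<not> nc 3 v \<and> \<not> v 3 = v 1) v" for v
  have "definable_pred \<Gamma> [0, 1] PP" unfolding PP_def
    by (intro definable_pred_conj definable_pred_neg definable_pred_ex_block nc_definable definable_pred_eq) (auto simp: \<Gamma>_def)
  from definable_two_blocks[OF this, of "\<lambda>_. []"]
  have S: "definable M {} (?ss @ ts) {x @ b |x b. sorts M x = ?ss \<and> sorts M b = ts \<and> PP ((\<lambda>_. [])(0 := x, 1 := b))}"
    by (simp add: \<Gamma>_def)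
  have PP: "PP ((\<lambda>_. [])(0 := x, 1 := b)) \<longleftrightarrow> code x b \<and> (\<forall>b'. code x b' \<longrightarrow> b' = b)"
    if "sorts M x = ?ss" "sorts M b = ts" for x b
  proof -
    have "\<not> nc 3 ((\<lambda>_. [])(0 := x, 1 := b, 3 := b')) \<longleftrightarrow> code x b'" if "sorts M b' = ts" for b'
      using nc[of "(\<lambda>_. [])(0 := x, 1 := b, 3 := b')" 3] \<open>sorts M x = ?ss\<close> that by simp
    then have "ex_block \<Gamma> 3 (\<lambda>v. \<not> nc 3 v \<and> \<not> v 3 = v 1) ((\<lambda>_. [])(0 := x, 1 := b)) \<longleftrightarrow>
        (\<exists>b'. code x b' \<and> b' \<noteq> b)"
      unfolding ex_block_def by (auto simp: \<Gamma>_def code_def)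
    moreover have "nc 1 ((\<lambda>_. [])(0 := x, 1 := b)) \<longleftrightarrow> \<not> code x b"
      using nc[of "(\<lambda>_. [])(0 := x, 1 := b)" 1] that by simp
    ultimately show ?thesis unfolding PP_def by blast
  qed
  define f where "f x = (if sorts M x = ?ss \<and> (\<exists>!b. code x b) then Some (THE b. code x b) else None)" for x
  have f: "f x = Some b \<longleftrightarrow> sorts M x = ?ss \<and> code x b \<and> (\<forall>b'. code x b' \<longrightarrow> b' = b)" for x b
    unfolding f_def by (auto intro: the_equality theI2)
  have pf: "definable_pfun M {} ?ss ts f"
    unfolding definable_pfun_def
  proof (intro conjI allI impI)
    show "sorts M x = ?ss" "sorts M b = ts" if "f x = Some b" for x b
      using that unfolding f code_def by blast+
    have "f x = Some b \<longleftrightarrow> sorts M x = ?ss \<and> sorts M b = ts \<and> PP ((\<lambda>_. [])(0 := x, 1 := b))" for x b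
      using PP[of x b] unfolding f by (auto simp: code_def)
    then show "definable M {} (?ss @ ts) {x @ y |x y. f x = Some y}" using S by simp
  qed
  have codea: "code a b \<longleftrightarrow> sorts M b = ts \<and> E `` {a} = {x. sorts M x = ?ss \<and> sat M (x @ b) \<theta>}" for b
    using Es(2) by (auto simp: code_def W_def)
  then have "\<exists>!b. code a b" using \<theta>(2) by simp
  then obtain b0 where b0: "f a = Some b0" using sa by (auto simp: f_def)
  have dom: "rlz M q \<subseteq> dom f"
  proof
    fix x assume "x \<in> rlz M q"
    then obtain \<sigma> where "\<sigma> \<in> automorphisms M" "x = map \<sigma> a"
      unfolding a rlz_tp_iff tp_eq_iff by blast
    then show "x \<in> dom f" using pfun_automorphism[OF pf _ b0] by blast
  qed
  have "f x = f y \<longleftrightarrow> (x, y) \<in> E" if xy: "x \<in> rlz M q" "y \<in> rlz M q" for x y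
  proof
    have sx: "sorts M x = ?ss" "sorts M y = ?ss" using xy by (auto simp: rlz_def)
    {
      assume fxy: "f x = f y"
      obtain b where "f x = Some b" using dom xy(1) by blast
      then have "code x b" "code y b" using fxy f by metis+
      moreover have "(y, y) \<in> E" using E(1) sx(2) unfolding equiv_def refl_on_def by blast
      ultimately show "(x, y) \<in> E" using sx(2) unfolding code_def by blast
    next
      assume E_xy: "(x, y) \<in> E"
      have "(x, z) \<in> E \<longleftrightarrow> (y, z) \<in> E" for z
        using E(1) E_xy unfolding equiv_def sym_def trans_def by blast
      then have "code x = code y" unfolding code_def by (simp add: fun_eq_iff)
      then show "f x = f y" using sx unfolding f_def by simp
    }
  qed
  then show ?thesis using pf dom by blast
qed

end

section \<open>The fibration and the action of a retraction\<close>

locale relatively_internal_type = monster \<kappa> M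
  for \<kappa> :: "'k rel" and M :: "('f, 'r, 's, 'm) fo_struct" +
  fixes P :: "('f, 'r, 's, 'm) ptype set" and q :: "('f, 'r, 's, 'm) ptype" and \<pi> :: "'m list \<rightharpoonup> 'm list"
  assumes complete: "complete_type M {} q" and rel_int: "relatively_internal \<kappa> M P q \<pi>"
begin

abbreviation "Q \<equiv> rlz M q"

text \<open>The map \<open>\<pi>\<close> as a total function; its value matters on realizations of \<open>q\<close> only.\<close>

definition pr :: "'m list \<Rightarrow> 'm list" where "pr x = the (\<pi> x)"

lemma Q_orbit: "a \<in> Q \<Longrightarrow> x \<in> Q \<longleftrightarrow> (\<exists>\<sigma>\<in>automorphisms M. x = map \<sigma> a)"
proof -
  assume a: "a \<in> Q"
  have "x \<in> Q \<longleftrightarrow> x \<in> rlz M (tp M {} a)" by (subst complete_type_eq_tp[OF complete a]) (rule refl)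
  then show ?thesis unfolding rlz_tp_iff tp_eq_iff .
qed

lemma Q_sorts: "x \<in> Q \<Longrightarrow> sorts M x = fst q"
  by (simp add: rlz_def)

lemma ex_Q: "\<exists>a. a \<in> Q"
proof -
  obtain a where "q = tp M {} a" using complete_type_realized[OF complete] ..
  then have "a \<in> Q" by simp
  then show ?thesis ..
qed

lemma pi_pfun: "\<exists>us. definable_pfun M {} (fst q) us \<pi>"
  using rel_int unfolding relatively_internal_def by blast

lemma pi_pr: "x \<in> Q \<Longrightarrow> \<pi> x = Some (pr x)"
proof -
  assume "x \<in> Q"
  then have "x \<in> dom \<pi>" using rel_int unfolding relatively_internal_def by blast
  then show ?thesis by (auto simp: pr_def)
qed

lemma pr_automorphism: "x \<in> Q \<Longrightarrow> \<sigma> \<in> automorphisms M \<Longrightarrow> pr (map \<sigma> x) = map \<sigma> (pr x)"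
proof -
  assume *: "x \<in> Q" "\<sigma> \<in> automorphisms M"
  obtain us where "definable_pfun M {} (fst q) us \<pi>" using pi_pfun ..
  from pfun_automorphism[OF this *(2) pi_pr[OF *(1)]] show ?thesis by (simp add: pr_def)
qed

lemma pushforward_eq: "a \<in> Q \<Longrightarrow> pushforward M \<pi> q = tp M {} (pr a)"
  unfolding pushforward_def
proof (rule the_equality)
  assume a: "a \<in> Q"
  show "\<exists>x\<in>Q. tp M {} (pr a) = tp M {} (the (\<pi> x))" using a pr_def by metis
  fix r assume "\<exists>x\<in>Q. r = tp M {} (the (\<pi> x))"
  then obtain x where x: "x \<in> Q" "r = tp M {} (pr x)" unfolding pr_def by blast
  obtain \<sigma> where \<sigma>: "\<sigma> \<in> automorphisms M" "x = map \<sigma> a" using Q_orbit[OF a] x(1) by blast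
  then show "r = tp M {} (pr a)" unfolding x(2) tp_eq_iff using pr_automorphism[OF a] by blast
qed

lemma rlz_pushforward: "rlz M (pushforward M \<pi> q) = pr ` Q"
proof -
  obtain a where a: "a \<in> Q" using ex_Q by blast
  have "c \<in> rlz M (pushforward M \<pi> q) \<longleftrightarrow> (\<exists>\<sigma>\<in>automorphisms M. c = map \<sigma> (pr a))" for c
    unfolding pushforward_eq[OF a] rlz_tp_iff tp_eq_iff ..
  also have "\<dots> c \<longleftrightarrow> (\<exists>\<sigma>\<in>automorphisms M. c = pr (map \<sigma> a))" for c
    using pr_automorphism[OF a] by metis
  also have "\<dots> c \<longleftrightarrow> c \<in> pr ` Q" for c using Q_orbit[OF a] by auto
  finally show ?thesis by blast
qed

text \<open>An automorphism moving \<open>a\<close> to a point of the same fibre fixes \<open>pr a\<close>, so the whole fibre is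
one type over \<open>pr a\<close>.\<close>

lemma fibre_tp: "a \<in> Q \<Longrightarrow> x \<in> rlz M (tp M (set (pr a)) a) \<longleftrightarrow> x \<in> Q \<and> pr x = pr a"
proof
  assume a: "a \<in> Q"
  assume "x \<in> rlz M (tp M (set (pr a)) a)"
  then have "tp M (set (pr a)) a = tp M (set (pr a)) x" by (simp add: rlz_tp_iff)
  then obtain \<sigma> where \<sigma>: "\<sigma> \<in> automorphisms M" "\<forall>b\<in>set (pr a). \<sigma> b = b" "map \<sigma> a = x"
    using homogeneous_over[OF small_finite[OF finite_set]] by blast
  then show "x \<in> Q \<and> pr x = pr a"
    using Q_orbit[OF a] pr_automorphism[OF a \<sigma>(1)] map_idI[of "pr a" \<sigma>] by auto
next
  assume a: "a \<in> Q"
  assume x: "x \<in> Q \<and> pr x = pr a"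
  then obtain \<sigma> where \<sigma>: "\<sigma> \<in> automorphisms M" "x = map \<sigma> a" using Q_orbit[OF a] by blast
  then have "map \<sigma> (pr a) = pr a" using x pr_automorphism[OF a] by simp
  then have "\<sigma> b = b" if "b \<in> set (pr a)" for b using that by (simp add: map_eq_conv[of \<sigma> _ id, simplified])
  then show "x \<in> rlz M (tp M (set (pr a)) a)"
    using tp_automorphism[OF \<sigma>(1), of "set (pr a)" a] \<sigma>(2) by (simp add: rlz_tp_iff)
qed

lemma fibre_type_eq:
  assumes a: "a \<in> Q" shows "fibre_type M \<pi> q (pr a) = tp M (set (pr a)) a"
  unfolding fibre_type_def
proof (rule the_equality)
  show "\<exists>x\<in>Q. \<pi> x = Some (pr a) \<and> tp M (set (pr a)) a = tp M (set (pr a)) x"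
    using a pi_pr by blast
  fix s assume "\<exists>x\<in>Q. \<pi> x = Some (pr a) \<and> s = tp M (set (pr a)) x"
  then obtain x where x: "x \<in> Q" "pr x = pr a" "s = tp M (set (pr a)) x" by (auto simp: pr_def)
  then show "s = tp M (set (pr a)) a" using fibre_tp[OF a, of x] by (simp add: rlz_tp_iff)
qed

lemma rlz_fibre: "c \<in> pr ` Q \<Longrightarrow> rlz M (fibre_type M \<pi> q c) = {x \<in> Q. pr x = c}"
proof -
  assume "c \<in> pr ` Q"
  then obtain a where a: "a \<in> Q" "c = pr a" by blast
  show ?thesis unfolding a(2) fibre_type_eq[OF a(1)] using fibre_tp[OF a(1)] by blast
qed

text \<open>A coherent system of identifications of the fibres.  The first argument is the action of a
retraction on points, the second a set defining, relatively to \<open>Q\<close>, the graph of this action.\<close>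

definition definable_transport ::
    "('m list \<Rightarrow> 'm list \<Rightarrow> 'm list \<Rightarrow> 'm list) \<Rightarrow> 'm list set \<Rightarrow> bool" where
  "definable_transport A \<epsilon> \<longleftrightarrow> definable M {} (fst q @ fst q) \<epsilon> \<and>
    (\<forall>x\<in>Q. \<forall>y\<in>Q. x @ y \<in> \<epsilon> \<longleftrightarrow> y = A (pr x) (pr y) x) \<and>
    (\<forall>c\<in>pr ` Q. \<forall>d\<in>pr ` Q. \<exists>\<sigma>\<in>automorphisms M. map \<sigma> c = d \<and>
       (\<forall>x\<in>Q. pr x = c \<longrightarrow> A c d x = map \<sigma> x)) \<and>
    (\<forall>c\<in>pr ` Q. \<forall>d\<in>pr ` Q. \<forall>e\<in>pr ` Q. \<forall>x\<in>Q. pr x = c \<longrightarrow> A d e (A c d x) = A c e x)"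

text \<open>\<open>A c d\<close> is the action of the arrow \<open>g (c @ d)\<close> in the binding groupoid.  Its graph is found from
the definable function \<open>g\<close> and the relatively definable action of arrows by quantifying
over the two objects and the arrow between them.\<close>

lemma retraction_transport:
  assumes rep: "represents_binding_groupoid M P q \<pi> G" and ret: "retractable M G"
  shows "\<exists>A \<epsilon>. definable_transport A \<epsilon>"
proof -
  let ?H = "binding_groupoid M P q \<pi>"
  let ?O = "pr ` Q"
  obtain F as where iso: "groupoid_iso F G ?H" and asA: "type_definable M {} as (Ar G)"
    and act: "rel_definable M {} (as @ fst q @ fst q)
       {h @ x @ y |h x y. h \<in> Ar G \<and> x \<in> rlz M q \<and> y \<in> rlz M q}
       {h @ x @ fst (snd (F h)) x |h x. h \<in> Ar G \<and> x \<in> rlz M (fibre_type M \<pi> q (src G h))}"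
    using rep unfolding represents_binding_groupoid_def by blast
  obtain gs hs g where g: "definable_pfun M {} gs hs g"
    "\<And>c d. c \<in> Ob G \<Longrightarrow> d \<in> Ob G \<Longrightarrow> c @ d \<in> dom g \<and> the (g (c @ d)) \<in> Mor G c d"
    "\<And>c d e. c \<in> Ob G \<Longrightarrow> d \<in> Ob G \<Longrightarrow> e \<in> Ob G \<Longrightarrow>
        cmp G (the (g (d @ e))) (the (g (c @ d))) = the (g (c @ e))"
    using ret unfolding retractable_def by blast
  have ObG: "Ob G = ?O" using iso by (simp add: groupoid_iso_def binding_groupoid_def rlz_pushforward)
  define h where "h c d = the (g (c @ d))" for c d
  have h: "h c d \<in> Ar G" "src G (h c d) = c" "tgt G (h c d) = d" "g (c @ d) = Some (h c d)"
    if "c \<in> ?O" "d \<in> ?O" for c d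
    using g(2)[of c d] that unfolding ObG Mor_def h_def by auto
  define A where "A c d = fst (snd (F (h c d)))" for c d
  have FH: "F (h c d) \<in> Ar ?H" "fst (F (h c d)) = c" "snd (snd (F (h c d))) = d"
    if "c \<in> ?O" "d \<in> ?O" for c d
    using iso h[OF that] unfolding groupoid_iso_def
    by (auto simp: binding_groupoid_def dest: bij_betwE)
  have Aaut: "\<exists>\<sigma>\<in>automorphisms M. map \<sigma> c = d \<and> (\<forall>x\<in>Q. pr x = c \<longrightarrow> A c d x = map \<sigma> x)"
    if cd: "c \<in> ?O" "d \<in> ?O" for c d
  proof -
    obtain \<sigma> where "F (h c d) = (c, restrict (map \<sigma>) (rlz M (fibre_type M \<pi> q c)), d)"
      "\<sigma> \<in> automorphisms M" "map \<sigma> c = d"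
      using FH[OF cd] unfolding binding_groupoid_def by auto
    then show ?thesis unfolding A_def by (intro bexI[of _ \<sigma>]) (auto simp: rlz_fibre[OF cd(1)])
  qed
  have Acmp: "A d e (A c d x) = A c e x"
    if cde: "c \<in> ?O" "d \<in> ?O" "e \<in> ?O" and x: "x \<in> Q" "pr x = c" for c d e x
  proof -
    have "F (cmp G (h d e) (h c d)) = cmp ?H (F (h d e)) (F (h c d))"
      using iso h[OF cde(1,2)] h[OF cde(2,3)] unfolding groupoid_iso_def by auto
    moreover have "cmp G (h d e) (h c d) = h c e" using g(3)[of c d e] cde ObG by (simp add: h_def)
    ultimately have "A c e = compose (rlz M (fibre_type M \<pi> q c)) (A d e) (A c d)"
      unfolding A_def by (simp add: binding_groupoid_def FH[OF cde(1,2)])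
    then show ?thesis using x by (simp add: compose_def rlz_fibre[OF cde(1)])
  qed
  obtain us where us: "definable_pfun M {} (fst q) us \<pi>" using pi_pfun by blast
  have sO: "sorts M c = us" if c: "c \<in> ?O" for c
  proof -
    obtain x where "x \<in> Q" "c = pr x" using c by blast
    then have "\<pi> x = Some c" using pi_pr by simp
    then show ?thesis using us unfolding definable_pfun_def by blast
  qed
  obtain a0 where a0: "a0 \<in> Q" using ex_Q by blast
  have sA: "sorts M k = as" if "k \<in> Ar G" for k
  proof -
    obtain \<Phi> where "Ar G = rlz M (as, \<Phi>)" using asA unfolding type_definable_def by blast
    then show ?thesis using that by (simp add: rlz_def)
  qed
  have gs: "gs = us @ us" "hs = as"
  proof -
    have "g (pr a0 @ pr a0) = Some (h (pr a0) (pr a0))" using h(4) a0 by blast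
    then have "sorts M (pr a0 @ pr a0) = gs" "sorts M (h (pr a0) (pr a0)) = hs"
      using g(1) unfolding definable_pfun_def by blast+
    then show "gs = us @ us" "hs = as" using sO sA h(1) a0 by auto
  qed
  define pi_graph where "pi_graph = {x @ y |x y. \<pi> x = Some y}"
  define g_graph where "g_graph = {x @ y |x y. g x = Some y}"
  have pi_graph: "definable M {} (fst q @ us) pi_graph" using us unfolding definable_pfun_def pi_graph_def by blast
  have g_graph: "definable M {} (us @ us @ as) g_graph" using g(1) gs unfolding definable_pfun_def g_graph_def by simp
  have pi_graph_mem: "x @ u \<in> pi_graph \<longleftrightarrow> \<pi> x = Some u" if "sorts M x = fst q" for x u
    unfolding pi_graph_def by (rule pfun_graph[OF us that])
  have g_graph_mem: "x @ k \<in> g_graph \<longleftrightarrow> g x = Some k" if "sorts M x = gs" for x k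
    unfolding g_graph_def by (rule pfun_graph[OF g(1) that])
  obtain D where D: "definable M {} (as @ fst q @ fst q) D"
    "{h @ x @ fst (snd (F h)) x |h x. h \<in> Ar G \<and> x \<in> rlz M (fibre_type M \<pi> q (src G h))} =
     {h @ x @ y |h x y. h \<in> Ar G \<and> x \<in> rlz M q \<and> y \<in> rlz M q} \<inter> D"
    using act unfolding rel_definable_def by blast
  have Dmem: "h c d @ x @ y \<in> D \<longleftrightarrow> y = A c d x"
    if cd: "c \<in> ?O" "d \<in> ?O" and x: "x \<in> Q" "pr x = c" and y: "y \<in> Q" for c d x y
  proof
    have fib: "x \<in> rlz M (fibre_type M \<pi> q (src G (h c d)))"
      using x by (simp add: h[OF cd] rlz_fibre[OF cd(1)])
    {
      assume "y = A c d x"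
      then have "h c d @ x @ y \<in> {h @ x @ fst (snd (F h)) x |h x. h \<in> Ar G \<and> x \<in> rlz M (fibre_type M \<pi> q (src G h))}"
        using h(1)[OF cd] fib unfolding A_def by blast
      then show "h c d @ x @ y \<in> D" unfolding D(2) by blast
    next
      assume "h c d @ x @ y \<in> D"
      then have "h c d @ x @ y \<in> {h @ x @ y |h x y. h \<in> Ar G \<and> x \<in> rlz M q \<and> y \<in> rlz M q} \<inter> D"
        using h(1)[OF cd] x(1) y by blast
      then obtain k z where kz: "h c d @ x @ y = k @ z @ fst (snd (F k)) z" "k \<in> Ar G"
        "z \<in> rlz M (fibre_type M \<pi> q (src G k))" unfolding D(2)[symmetric] by blast
      have "length (h c d) = length k" using sA h(1)[OF cd] kz(2) by (metis length_map)
      then have k: "k = h c d" "x @ y = z @ fst (snd (F k)) z" using kz(1) by auto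
      have "z \<in> Q" using kz(3) unfolding k h(2)[OF cd] rlz_fibre[OF cd(1)] by simp
      then have "length x = length z" using Q_sorts x(1) by (metis length_map)
      then show "y = A c d x" using k by (simp add: A_def)
    }
  qed
  define \<Gamma> where "\<Gamma> = (\<lambda>_::nat. [])(0 := fst q, 1 := fst q, 2 := us, 3 := us, 4 := as)"
  define E where "E = ex_block \<Gamma> 2 (ex_block \<Gamma> 3 (ex_block \<Gamma> 4 (\<lambda>v :: nat \<Rightarrow> 'm list. (v 0 @ v 2 \<in> pi_graph \<and> v 1 @ v 3 \<in> pi_graph) \<and>
      v 2 @ v 3 @ v 4 \<in> g_graph \<and> v 4 @ v 0 @ v 1 \<in> D)))"
  have "definable_pred \<Gamma> [4, 3, 2, 0, 1] (\<lambda>v. (v 0 @ v 2 \<in> pi_graph \<and> v 1 @ v 3 \<in> pi_graph) \<and>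
      v 2 @ v 3 @ v 4 \<in> g_graph \<and> v 4 @ v 0 @ v 1 \<in> D)"
    by (intro definable_pred_conj; (rule definable_pred_mem2 definable_pred_mem3)) (use pi_graph g_graph D(1) in \<open>simp_all add: \<Gamma>_def\<close>)
  then have "definable_pred \<Gamma> [0, 1] E" unfolding E_def by (intro definable_pred_ex_block) simp_all
  define \<epsilon> where "\<epsilon> = {x @ y |x y. sorts M x = \<Gamma> 0 \<and> sorts M y = \<Gamma> 1 \<and> E ((\<lambda>_. [])(0 := x, 1 := y))}"
  have "definable M {} (\<Gamma> 0 @ \<Gamma> 1) \<epsilon>"
    unfolding \<epsilon>_def by (rule definable_two_blocks[OF \<open>definable_pred \<Gamma> [0, 1] E\<close>]) simp
  then have "definable M {} (fst q @ fst q) \<epsilon>" by (simp add: \<Gamma>_def)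
  moreover have "x @ y \<in> \<epsilon> \<longleftrightarrow> y = A (pr x) (pr y) x" if x: "x \<in> Q" and y: "y \<in> Q" for x y
  proof -
    note sx = Q_sorts[OF x] and sy = Q_sorts[OF y]
    have cd: "pr x \<in> ?O" "pr y \<in> ?O" using x y by auto
    have "x @ y \<in> \<epsilon> \<longleftrightarrow> E ((\<lambda>_. [])(0 := x, 1 := y))"
    proof
      assume "x @ y \<in> \<epsilon>"
      then obtain x' y' where *: "x @ y = x' @ y'" "sorts M x' = fst q" "E ((\<lambda>_. [])(0 := x', 1 := y'))"
        unfolding \<epsilon>_def by (auto simp: \<Gamma>_def)
      have "length x = length x'" using sx *(2) by (metis length_map)
      then show "E ((\<lambda>_. [])(0 := x, 1 := y))" using * by simp
    qed (use sx sy in \<open>auto simp: \<epsilon>_def \<Gamma>_def\<close>)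
    also have "\<dots> \<longleftrightarrow> (\<exists>u. sorts M u = us \<and> (\<exists>w. sorts M w = us \<and> (\<exists>k. sorts M k = as \<and>
        (\<pi> x = Some u \<and> \<pi> y = Some w) \<and> u @ w @ k \<in> g_graph \<and> k @ x @ y \<in> D)))"
      unfolding E_def ex_block_def using pi_graph_mem[OF sx] pi_graph_mem[OF sy] by (simp add: \<Gamma>_def)
    also have "\<dots> \<longleftrightarrow> (\<exists>k. sorts M k = as \<and> (pr x @ pr y) @ k \<in> g_graph \<and> k @ x @ y \<in> D)"
      using sO[OF cd(1)] sO[OF cd(2)] pi_pr[OF x] pi_pr[OF y] by auto
    also have "\<dots> \<longleftrightarrow> (\<exists>k. sorts M k = as \<and> g (pr x @ pr y) = Some k \<and> k @ x @ y \<in> D)"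
      using g_graph_mem[of "pr x @ pr y"] sO cd gs(1) by simp
    also have "\<dots> \<longleftrightarrow> y = A (pr x) (pr y) x"
      using h[OF cd] sA[OF h(1)[OF cd]] Dmem[OF cd x refl y] by auto
    finally show ?thesis .
  qed
  ultimately show ?thesis using Aaut Acmp
    by (intro exI[of _ A] exI[of _ \<epsilon>], unfold definable_transport_def, intro conjI ballI impI) auto
qed

section \<open>Splitting the type\<close>

text \<open>Such an \<open>f\<close> is a second coordinate on \<open>Q\<close>: the pair of \<open>f\<close> and \<open>pr\<close> maps \<open>Q\<close> bijectively onto the
product of their images.\<close>

definition complements_projection :: "'s list \<Rightarrow> ('m list \<rightharpoonup> 'm list) \<Rightarrow> bool" where
  "complements_projection ts f \<longleftrightarrow> definable_pfun M {} (fst q) ts f \<and> Q \<subseteq> dom f \<and>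
    (\<forall>x\<in>Q. \<forall>y\<in>Q. f x = f y \<and> pr x = pr y \<longrightarrow> x = y) \<and>
    (\<forall>x\<in>Q. \<forall>c\<in>pr ` Q. \<exists>y\<in>Q. f y = f x \<and> pr y = c)"

text \<open>The coordinate of \<open>x\<close> is a name for its orbit under the transport.  The arrow from an object to itself
acts as an idempotent bijection, hence trivially; so the cocycle identity gives an
equivalence relation on \<open>Q\<close> whose classes meet each fibre once.\<close>

lemma complement_of_retraction:
  assumes EI: "eliminates_imaginaries M"
    and rep: "represents_binding_groupoid M P q \<pi> G" and ret: "retractable M G"
  shows "\<exists>ts f. complements_projection ts f"
proof -
  let ?ss = "fst q"
  obtain A \<epsilon> where T: "definable_transport A \<epsilon>" using retraction_transport[OF rep ret] by blast
  have \<epsilon>: "definable M {} (?ss @ ?ss) \<epsilon>"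
    and mem: "\<And>x y. x \<in> Q \<Longrightarrow> y \<in> Q \<Longrightarrow> x @ y \<in> \<epsilon> \<longleftrightarrow> y = A (pr x) (pr y) x"
    and aut: "\<And>c d. c \<in> pr ` Q \<Longrightarrow> d \<in> pr ` Q \<Longrightarrow> \<exists>\<sigma>\<in>automorphisms M. map \<sigma> c = d \<and>
       (\<forall>x\<in>Q. pr x = c \<longrightarrow> A c d x = map \<sigma> x)"
    and cocycle: "\<And>c d e x. c \<in> pr ` Q \<Longrightarrow> d \<in> pr ` Q \<Longrightarrow> e \<in> pr ` Q \<Longrightarrow> x \<in> Q \<Longrightarrow> pr x = c \<Longrightarrow>
       A d e (A c d x) = A c e x"
    using T unfolding definable_transport_def by blast+
  have AQ: "A (pr x) d x \<in> Q" "pr (A (pr x) d x) = d" if x: "x \<in> Q" "d \<in> pr ` Q" for x d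
  proof -
    obtain \<sigma> where \<sigma>: "\<sigma> \<in> automorphisms M" "map \<sigma> (pr x) = d" "A (pr x) d x = map \<sigma> x"
      using aut[of "pr x" d] x by blast
    show "A (pr x) d x \<in> Q" unfolding \<sigma>(3) using Q_orbit[OF x(1)] \<sigma>(1) by blast
    show "pr (A (pr x) d x) = d" unfolding \<sigma>(3) pr_automorphism[OF x(1) \<sigma>(1)] by (rule \<sigma>(2))
  qed
  \<comment> \<open>\<open>A c c\<close> is idempotent by the cocycle identity, and injective as the restriction of an automorphism.\<close>
  have Aid: "A (pr x) (pr x) x = x" if x: "x \<in> Q" for x
  proof -
    let ?c = "pr x"
    have c: "?c \<in> pr ` Q" using x by blast
    obtain \<sigma> where \<sigma>: "\<sigma> \<in> automorphisms M" "\<And>z. z \<in> Q \<Longrightarrow> pr z = ?c \<Longrightarrow> A ?c ?c z = map \<sigma> z"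
      using aut[OF c c] by blast
    have "A ?c ?c (A ?c ?c x) = A ?c ?c x" using cocycle[OF c c c x refl] .
    then have "map \<sigma> (A ?c ?c x) = map \<sigma> x" using \<sigma>(2) AQ[OF x c] x by simp
    then show ?thesis using automorphisms_inj[OF \<sigma>(1)] by blast
  qed
  have eps_refl: "x @ x \<in> \<epsilon>" if "x \<in> Q" for x using mem[OF that that] Aid[OF that] by simp
  have eps_sym: "y @ x \<in> \<epsilon>" if x: "x \<in> Q" and y: "y \<in> Q" and xy: "x @ y \<in> \<epsilon>" for x y
  proof -
    have "A (pr y) (pr x) (A (pr x) (pr y) x) = A (pr x) (pr x) x" by (rule cocycle) (use x y in auto)
    then show ?thesis using xy mem[OF x y] mem[OF y x] Aid[OF x] by simp
  qed
  have eps_trans: "x @ z \<in> \<epsilon>" if x: "x \<in> Q" and y: "y \<in> Q" and z: "z \<in> Q"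
    and xy: "x @ y \<in> \<epsilon>" and yz: "y @ z \<in> \<epsilon>" for x y z
  proof -
    have "A (pr y) (pr z) (A (pr x) (pr y) x) = A (pr x) (pr z) x" by (rule cocycle) (use x y z in auto)
    then show ?thesis using xy yz mem[OF x y] mem[OF y z] mem[OF x z] by simp
  qed
  \<comment> \<open>The relation is an equivalence on \<open>Q\<close> only.  Related elements have the same neighbours in \<open>Q\<close>,
    and this persists on some definable set containing \<open>Q\<close>.\<close>
  define R where "R v \<longleftrightarrow> (v 0 @ v 1 \<in> \<epsilon> \<longrightarrow> (v 0 @ v 2 \<in> \<epsilon> \<longleftrightarrow> v 1 @ v 2 \<in> \<epsilon>))" for v :: "nat \<Rightarrow> 'm list"
  have "definable_pred (\<lambda>_. ?ss) [0, 1, 2] R"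
    unfolding R_def by (intro definable_pred_imp definable_pred_iff definable_pred_mem2) (use \<epsilon> in auto)
  moreover have "R v" if v: "\<forall>n\<in>set [0, 1, 2]. v n \<in> Q" for v
  proof -
    have v': "v 0 \<in> Q" "v 1 \<in> Q" "v 2 \<in> Q" using v by simp_all
    show ?thesis unfolding R_def
      using eps_trans[OF v'] eps_trans[OF v'(2,1,3)] eps_sym[OF v'(1,2)] by blast
  qed
  ultimately obtain \<Theta> where \<Theta>: "definable M {} ?ss \<Theta>" "Q \<subseteq> \<Theta>"
    "\<And>v. (\<forall>n\<in>set [0, 1, 2]. v n \<in> \<Theta>) \<Longrightarrow> R v"
    using uniform_neighbourhood[OF complete, of "\<lambda>_. ?ss" "[0, 1, 2]" R] by auto
  have R\<Theta>: "x @ z \<in> \<epsilon> \<longleftrightarrow> y @ z \<in> \<epsilon>" if "x \<in> \<Theta>" "y \<in> \<Theta>" "z \<in> \<Theta>" "x @ y \<in> \<epsilon>" for x y z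
    using \<Theta>(3)[of "(\<lambda>_. [])(0 := x, 1 := y, 2 := z)"] that by (simp add: R_def)
  define E where "E = {(x, y). sorts M x = ?ss \<and> sorts M y = ?ss \<and> (\<forall>z\<in>\<Theta>. x @ z \<in> \<epsilon> \<longleftrightarrow> y @ z \<in> \<epsilon>)}"
  have equiv: "equiv {x. sorts M x = ?ss} E"
    by (auto simp: equiv_def refl_on_def sym_def trans_def E_def)
  define T where "T = ex_block (\<lambda>_. ?ss) 2 (\<lambda>v :: nat \<Rightarrow> 'm list. v 2 \<in> \<Theta> \<and> \<not> (v 0 @ v 2 \<in> \<epsilon> \<longleftrightarrow> v 1 @ v 2 \<in> \<epsilon>))"
  have "definable_pred (\<lambda>_. ?ss) [0, 1] (\<lambda>v. \<not> T v)" unfolding T_def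
    by (intro definable_pred_neg definable_pred_ex_block definable_pred_conj definable_pred_iff definable_pred_mem2 definable_pred_mem1) (use \<epsilon> \<Theta>(1) in auto)
  from definable_two_blocks[OF this, of "\<lambda>_. []"]
  have "definable M {} (?ss @ ?ss) {x @ y |x y. sorts M x = ?ss \<and> sorts M y = ?ss \<and>
      \<not> T ((\<lambda>_. [])(0 := x, 1 := y))}" by simp
  moreover have "(x, y) \<in> E \<longleftrightarrow> sorts M x = ?ss \<and> sorts M y = ?ss \<and> \<not> T ((\<lambda>_. [])(0 := x, 1 := y))" for x y
    using definable_sorts[OF \<Theta>(1)] by (auto simp: E_def T_def ex_block_def)
  ultimately have "definable M {} (?ss @ ?ss) {x @ y |x y. (x, y) \<in> E}" by simp
  from definable_quotient[OF EI complete equiv this] obtain ts f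
    where f: "definable_pfun M {} ?ss ts f" "Q \<subseteq> dom f"
      "\<And>x y. x \<in> Q \<Longrightarrow> y \<in> Q \<Longrightarrow> f x = f y \<longleftrightarrow> (x, y) \<in> E" by blast
  have EQ: "(x, y) \<in> E \<longleftrightarrow> x @ y \<in> \<epsilon>" if x: "x \<in> Q" and y: "y \<in> Q" for x y
  proof
    assume "(x, y) \<in> E"
    then have "x @ x \<in> \<epsilon> \<longleftrightarrow> y @ x \<in> \<epsilon>" using x \<Theta>(2) by (auto simp: E_def)
    then show "x @ y \<in> \<epsilon>" using eps_refl[OF x] eps_sym[OF y x] by simp
  next
    assume "x @ y \<in> \<epsilon>"
    then show "(x, y) \<in> E" using R\<Theta> x y \<Theta>(2) Q_sorts unfolding E_def by blast
  qed
  have "x = y" if x: "x \<in> Q" and y: "y \<in> Q" and xy: "f x = f y" "pr x = pr y" for x y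
  proof -
    have "x @ y \<in> \<epsilon>" using f(3)[OF x y] EQ[OF x y] xy(1) by blast
    then have "y = A (pr x) (pr y) x" using mem[OF x y] by blast
    also have "\<dots> = x" unfolding xy(2)[symmetric] by (rule Aid[OF x])
    finally show ?thesis by (rule sym)
  qed
  moreover have "\<exists>y\<in>Q. f y = f x \<and> pr y = c" if x: "x \<in> Q" and c: "c \<in> pr ` Q" for x c
  proof -
    let ?y = "A (pr x) c x"
    have y: "?y \<in> Q" "pr ?y = c" using AQ[OF x c] by simp_all
    then have "x @ ?y \<in> \<epsilon>" using mem[OF x y(1)] by simp
    then have "f x = f ?y" using f(3)[OF x y(1)] EQ[OF x y(1)] by simp
    then show ?thesis using y by metis
  qed
  ultimately have "complements_projection ts f"
    unfolding complements_projection_def using f(1,2) by blast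
  then show ?thesis by blast
qed

text \<open>The coordinates determine the point on \<open>Q\<close> only, but by compactness they do so on a definable
set \<open>\<Theta> \<supseteq> Q\<close>, and restricted to \<open>\<Theta>\<close> the inverse of the coordinate map is a definable function.\<close>

lemma point_definable_from_coordinates:
  assumes split: "complements_projection ts f" and us: "definable_pfun M {} (fst q) us \<pi>"
  shows "\<exists>H. definable M {} (ts @ fst q @ us) H \<and>
    (\<forall>z x x' u. sorts M z = ts \<and> sorts M x = fst q \<and> sorts M x' = fst q \<and> sorts M u = us \<and>
       z @ x @ u \<in> H \<and> z @ x' @ u \<in> H \<longrightarrow> x = x') \<and>
    (\<forall>x\<in>Q. \<forall>d. f x = Some d \<longrightarrow> d @ x @ pr x \<in> H)"
proof -
  let ?ss = "fst q"
  have f: "definable_pfun M {} ?ss ts f" "Q \<subseteq> dom f"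
    and inj: "\<And>x y. x \<in> Q \<Longrightarrow> y \<in> Q \<Longrightarrow> f x = f y \<Longrightarrow> pr x = pr y \<Longrightarrow> x = y"
    using split unfolding complements_projection_def by blast+
  define pi_graph where "pi_graph = {x @ y |x y. \<pi> x = Some y}"
  define f_graph where "f_graph = {x @ y |x y. f x = Some y}"
  have pi_graph: "definable M {} (?ss @ us) pi_graph" using us unfolding definable_pfun_def pi_graph_def by blast
  have f_graph: "definable M {} (?ss @ ts) f_graph" using f(1) unfolding definable_pfun_def f_graph_def by blast
  have pi_mem: "x @ u \<in> pi_graph \<longleftrightarrow> \<pi> x = Some u" if "sorts M x = ?ss" for x u
    unfolding pi_graph_def by (rule pfun_graph[OF us that])
  have f_mem: "x @ u \<in> f_graph \<longleftrightarrow> f x = Some u" if "sorts M x = ?ss" for x u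
    unfolding f_graph_def by (rule pfun_graph[OF f(1) that])
  define \<Gamma> where "\<Gamma> = (\<lambda>_::nat. [])(0 := ?ss, 1 := ?ss, 2 := ts, 3 := us)"
  \<comment> \<open>\<open>S\<close> says that the points in blocks \<open>0\<close> and \<open>1\<close> have the same pair of coordinates.\<close>
  define S where "S = ex_block \<Gamma> 2 (ex_block \<Gamma> 3 (\<lambda>v :: nat \<Rightarrow> 'm list. (v 0 @ v 2 \<in> f_graph \<and> v 1 @ v 2 \<in> f_graph) \<and>
      v 0 @ v 3 \<in> pi_graph \<and> v 1 @ v 3 \<in> pi_graph))"
  have S: "S v" if "sorts M (v 0) = ?ss" "sorts M (v 1) = ?ss" "f (v 0) = Some b" "f (v 1) = Some b"
      "\<pi> (v 0) = Some u" "\<pi> (v 1) = Some u" for v b u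
  proof -
    have "sorts M b = ts" "sorts M u = us" using that f(1) us unfolding definable_pfun_def by blast+
    then show ?thesis unfolding S_def ex_block_def using that f_mem pi_mem
      by (intro exI[of _ b] conjI exI[of _ u]) (simp_all add: \<Gamma>_def)
  qed
  have SQ: "v 0 = v 1" if v: "v 0 \<in> Q" "v 1 \<in> Q" and "S v" for v
  proof -
    obtain b u where "f (v 0) = Some b" "f (v 1) = Some b" "\<pi> (v 0) = Some u" "\<pi> (v 1) = Some u"
      using \<open>S v\<close> f_mem[OF Q_sorts[OF v(1)]] f_mem[OF Q_sorts[OF v(2)]]
        pi_mem[OF Q_sorts[OF v(1)]] pi_mem[OF Q_sorts[OF v(2)]]
      unfolding S_def ex_block_def by (auto simp: \<Gamma>_def)
    then show ?thesis using inj[OF v] by (simp add: pr_def)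
  qed
  have "definable_pred \<Gamma> [0, 1] (\<lambda>v. S v \<longrightarrow> v 0 = v 1)"
    unfolding S_def by (intro definable_pred_imp definable_pred_ex_block definable_pred_conj definable_pred_mem2 definable_pred_eq) (use pi_graph f_graph in \<open>simp_all add: \<Gamma>_def\<close>)
  then have "\<exists>\<Theta>. definable M {} ?ss \<Theta> \<and> Q \<subseteq> \<Theta> \<and> (\<forall>v. (\<forall>n\<in>set [0, 1]. v n \<in> \<Theta>) \<longrightarrow> (S v \<longrightarrow> v 0 = v 1))"
    by (rule uniform_neighbourhood[OF complete]) (use SQ in \<open>auto simp: \<Gamma>_def\<close>)
  then obtain \<Theta> where \<Theta>: "definable M {} ?ss \<Theta>" "Q \<subseteq> \<Theta>"
    "\<And>v. v 0 \<in> \<Theta> \<Longrightarrow> v 1 \<in> \<Theta> \<Longrightarrow> S v \<Longrightarrow> v 0 = v 1" by auto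
  define \<Delta> where "\<Delta> = (\<lambda>_::nat. [])(0 := ts, 1 := ?ss, 2 := us)"
  define h where "h v \<longleftrightarrow> (v 1 @ v 0 \<in> f_graph \<and> v 1 @ v 2 \<in> pi_graph) \<and> v 1 \<in> \<Theta>" for v :: "nat \<Rightarrow> 'm list"
  have hd: "definable_pred \<Delta> [0, 1, 2] h" unfolding h_def
    by (intro definable_pred_conj definable_pred_mem2 definable_pred_mem1) (use pi_graph f_graph \<Theta>(1) in \<open>simp_all add: \<Delta>_def\<close>)
  define H where "H = {concat (map v [0, 1, 2]) |v. (\<forall>n\<in>set [0, 1, 2]. sorts M (v n) = \<Delta> n) \<and> h v}"
  have "definable M {} (concat (map \<Delta> [0, 1, 2])) H" unfolding H_def by (rule definable_blocks[OF hd]) simp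
  then have H: "definable M {} (ts @ ?ss @ us) H" by (simp add: \<Delta>_def)
  have Hm: "z @ x @ u \<in> H \<longleftrightarrow> f x = Some z \<and> \<pi> x = Some u \<and> x \<in> \<Theta>"
    if s: "sorts M z = ts" "sorts M x = ?ss" "sorts M u = us" for z x u
  proof -
    have "z @ x @ u \<in> H \<longleftrightarrow> h ((\<lambda>_. [])(0 := z, 1 := x, 2 := u))"
    proof
      assume "z @ x @ u \<in> H"
      then obtain v where v: "z @ x @ u = v 0 @ v 1 @ v 2" "sorts M (v 0) = ts" "sorts M (v 1) = ?ss"
        "sorts M (v 2) = us" "h v" unfolding H_def by (auto simp: \<Delta>_def)
      have "length z = length (v 0)" "length x = length (v 1)" using s v(2,3) by (metis length_map)+
      then have "v 0 = z" "v 1 = x" "v 2 = u" using v(1) by auto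
      then show "h ((\<lambda>_. [])(0 := z, 1 := x, 2 := u))" using v(5) by (simp add: h_def)
    next
      assume "h ((\<lambda>_. [])(0 := z, 1 := x, 2 := u))"
      then show "z @ x @ u \<in> H" unfolding H_def using s
        by (intro CollectI exI[of _ "(\<lambda>_. [])(0 := z, 1 := x, 2 := u)"]) (simp add: \<Delta>_def)
    qed
    then show ?thesis using f_mem[OF s(2)] pi_mem[OF s(2)] by (simp add: h_def)
  qed
  have uniq: "x = x'" if s: "sorts M z = ts" "sorts M x = ?ss" "sorts M x' = ?ss" "sorts M u = us"
    and zxu: "z @ x @ u \<in> H" "z @ x' @ u \<in> H" for z x x' u
  proof -
    have *: "f x = Some z" "\<pi> x = Some u" "x \<in> \<Theta>" "f x' = Some z" "\<pi> x' = Some u" "x' \<in> \<Theta>"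
      using Hm s zxu by blast+
    let ?v = "(\<lambda>_. [])(0 := x, 1 := x') :: nat \<Rightarrow> 'm list"
    have "S ?v" by (rule S[where b = z and u = u]) (use * s in auto)
    then show ?thesis using \<Theta>(3)[of ?v] * by simp
  qed
  have "d @ x @ pr x \<in> H" if x: "x \<in> Q" and d: "f x = Some d" for x d
  proof -
    have "sorts M d = ts" "sorts M (pr x) = us"
      using f(1) d us pi_pr[OF x] unfolding definable_pfun_def by blast+
    then show ?thesis using Hm Q_sorts[OF x] d pi_pr[OF x] x \<Theta>(2) by blast
  qed
  then show ?thesis using H uniq by (intro exI[of _ H] conjI allI impI ballI) blast+
qed

text \<open>Move a nonforking realization \<open>d\<close> back to the point \<open>y\<close> of \<open>Q\<close> above \<open>c\<close>, where stationarity of the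
fibre type compares it with the given witness \<open>a\<close> of internality; an automorphism over \<open>B\<close> then
carries the tuples \<open>cs\<close> to realizations of \<open>P\<close> that work for \<open>y\<close>, and so for \<open>d\<close>.\<close>

lemma internal_coordinate:
  assumes stable: "stable_theory M" and PT: "\<forall>\<Phi>\<in>P. partial_type M {} \<Phi>"
    and split: "complements_projection ts f" and a0: "a0 \<in> Q" "f a0 = Some d0"
  shows "internal \<kappa> M P {} (tp M {} d0)"
proof -
  let ?ss = "fst q"
  have f: "definable_pfun M {} ?ss ts f" "Q \<subseteq> dom f"
    and sur: "\<And>x c. x \<in> Q \<Longrightarrow> c \<in> pr ` Q \<Longrightarrow> \<exists>y\<in>Q. f y = f x \<and> pr y = c"
    using split unfolding complements_projection_def by blast+
  define c where "c = pr a0"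
  define C where "C = set c"
  have rel: "stationary \<kappa> M C (tp M C a0)" "internal \<kappa> M P C (tp M C a0)"
    using rel_int a0(1) unfolding relatively_internal_def C_def c_def pr_def by (auto simp: Let_def)
  obtain B a cs where B: "small \<kappa> B" "C \<subseteq> B" "a \<in> rlz M (tp M C a0)" "indep M a C B"
    "set cs \<subseteq> family_rlz M P" "set a \<subseteq> dcl M (set (concat cs) \<union> B)"
    using rel(2) unfolding internal_def by blast
  obtain d where d: "tp M {} d = tp M {} d0" "indep M d {} B"
    using nonforking_extension[OF stable B(1)] by blast
  obtain \<tau> where \<tau>: "\<tau> \<in> automorphisms M" "d = map \<tau> d0" using d(1) unfolding tp_eq_iff by blast
  have x: "map \<tau> a0 \<in> Q" "f (map \<tau> a0) = Some d"
    using Q_orbit[OF a0(1)] \<tau> pfun_automorphism[OF f(1) \<tau>(1) a0(2)] by auto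
  obtain y where y: "y \<in> Q" "f y = Some d" "pr y = c"
    using sur[OF x(1), of c] x(2) a0(1) unfolding c_def by auto
  have sd: "sorts M d = ts" using f(1) y(2) unfolding definable_pfun_def by blast
  have sy: "sorts M y = ?ss" using Q_sorts[OF y(1)] .
  obtain us where us: "definable_pfun M {} ?ss us \<pi>" using pi_pfun by blast
  have sc: "sorts M c = us" using us pi_pr[OF y(1)] y(3) unfolding definable_pfun_def by blast
  obtain H where H: "definable M {} (ts @ ?ss @ us) H"
    "\<forall>z x x' u. sorts M z = ts \<and> sorts M x = ?ss \<and> sorts M x' = ?ss \<and> sorts M u = us \<and>
       z @ x @ u \<in> H \<and> z @ x' @ u \<in> H \<longrightarrow> x = x'"
    "\<forall>x\<in>Q. \<forall>d. f x = Some d \<longrightarrow> d @ x @ pr x \<in> H"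
    using point_definable_from_coordinates[OF split us] by (elim exE conjE)
  have "indep M y C B"
  proof (rule indep_definable_image[OF B(1,2)])
    show "definable M {} (sorts M d @ sorts M y @ sorts M c) H" using H(1) sd sy sc by simp
    show "set c \<subseteq> C" by (simp add: C_def)
    show "d @ y @ c \<in> H" using H(3) y by blast
    show "indep M d C B" by (rule indep_over_larger_base[OF d(2) B(2)])
    show "\<forall>z x x'. sorts M z = sorts M d \<and> sorts M x = sorts M y \<and> sorts M x' = sorts M y \<and>
        z @ x @ c \<in> H \<and> z @ x' @ c \<in> H \<longrightarrow> x = x'" unfolding sd sy using H(2) sc by blast
  qed
  moreover have "y \<in> rlz M (tp M C a0)" using fibre_tp[OF a0(1)] y unfolding C_def c_def by blast
  ultimately have "tp M B a = tp M B y"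
    using rel(1) B(1-4) unfolding stationary_def by blast
  then obtain \<sigma> where \<sigma>: "\<sigma> \<in> automorphisms M" "\<forall>b\<in>B. \<sigma> b = b" "map \<sigma> a = y"
    using homogeneous_over[OF B(1)] by blast
  have im: "\<sigma> ` (set (concat cs) \<union> B) = set (concat (map (map \<sigma>) cs)) \<union> B"
  proof -
    have "\<sigma> ` B = B" using \<sigma>(2) by force
    then show ?thesis by (simp add: image_Un image_UN)
  qed
  have "set y \<subseteq> dcl M (set (concat (map (map \<sigma>) cs)) \<union> B)"
  proof
    fix k assume "k \<in> set y"
    then obtain m where m: "m \<in> set a" "k = \<sigma> m" using \<sigma>(3) by auto
    then have "m \<in> dcl M (set (concat cs) \<union> B)" using B(6) by blast
    from dcl_automorphism[OF this \<sigma>(1)]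
    show "k \<in> dcl M (set (concat (map (map \<sigma>) cs)) \<union> B)" unfolding im m(2) .
  qed
  then have "set d \<subseteq> dcl M (set (concat (map (map \<sigma>) cs)) \<union> B)"
    by (rule dcl_definable_pfun[OF f(1) y(2)])
  moreover have "set (map (map \<sigma>) cs) \<subseteq> family_rlz M P"
  proof
    fix t assume "t \<in> set (map (map \<sigma>) cs)"
    then obtain s where s: "s \<in> set cs" "t = map \<sigma> s" by auto
    then obtain \<Phi> where \<Phi>: "\<Phi> \<in> P" "s \<in> rlz M \<Phi>" using B(5) unfolding family_rlz_def by blast
    have "psat M t \<chi>" if "\<chi> \<in> snd \<Phi>" for \<chi>
    proof -
      have "\<chi> \<in> snd (tp M {} s)"
        using PT \<Phi> that unfolding partial_type_def by (auto simp: tp_def rlz_def)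
      moreover have "tp M {} t = tp M {} s" unfolding s(2) by (rule tp_automorphism[OF \<sigma>(1)]) simp
      ultimately have "\<chi> \<in> snd (tp M {} t)" by simp
      then show ?thesis by (simp add: tp_def)
    qed
    then have "t \<in> rlz M \<Phi>" using \<Phi>(2) \<sigma>(1) s(2) by (simp add: rlz_def)
    then show "t \<in> family_rlz M P" using \<Phi>(1) unfolding family_rlz_def by blast
  qed
  moreover have "d \<in> rlz M (tp M {} d0)" using d(1) by (simp add: rlz_tp_iff)
  ultimately show ?thesis unfolding internal_def using B(1) d(2) by blast
qed

text \<open>Let \<open>r\<close> be the type of one pair of coordinates.  Its realizations are the coordinate pairs of points
of \<open>Q\<close>, and these are all pairs of realizations of \<open>p\<close> and \<open>\<pi>(q)\<close>.\<close>

lemma splitting: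
  assumes stable: "stable_theory M" and PT: "\<forall>\<Phi>\<in>P. partial_type M {} \<Phi>"
    and EI: "eliminates_imaginaries M"
    and rep: "represents_binding_groupoid M P q \<pi> G" and ret: "retractable M G"
  shows "\<exists>p. complete_type M {} p \<and> internal \<kappa> M P {} p \<and>
    weakly_orthogonal M p (pushforward M \<pi> q) \<and>
    definable_bijection_between M {} (rlz M q) (rlz M (tensor M {} p (pushforward M \<pi> q)))"
proof -
  let ?ss = "fst q" and ?s = "pushforward M \<pi> q"
  obtain ts f where split: "complements_projection ts f"
    using complement_of_retraction[OF EI rep ret] by blast
  then have f: "definable_pfun M {} ?ss ts f" "Q \<subseteq> dom f"
    and inj: "\<And>x y. x \<in> Q \<Longrightarrow> y \<in> Q \<Longrightarrow> f x = f y \<Longrightarrow> pr x = pr y \<Longrightarrow> x = y"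
    and sur: "\<And>x c. x \<in> Q \<Longrightarrow> c \<in> pr ` Q \<Longrightarrow> \<exists>y\<in>Q. f y = f x \<and> pr y = c"
    unfolding complements_projection_def by blast+
  obtain a0 where a0: "a0 \<in> Q" using ex_Q by blast
  obtain d0 where d0: "f a0 = Some d0" using f(2) a0 by blast
  define c0 where "c0 = pr a0"
  define p where "p = tp M {} d0"
  define r where "r = tp M {} (d0 @ c0)"
  have s: "?s = tp M {} c0" using pushforward_eq[OF a0] by (simp add: c0_def)
  have p_iff: "d \<in> rlz M p \<longleftrightarrow> (\<exists>x\<in>Q. f x = Some d)" for d
  proof
    assume "d \<in> rlz M p"
    then obtain \<sigma> where \<sigma>: "\<sigma> \<in> automorphisms M" "d = map \<sigma> d0"
      unfolding p_def rlz_tp_iff tp_eq_iff by blast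
    have "map \<sigma> a0 \<in> Q" using Q_orbit[OF a0] \<sigma>(1) by blast
    moreover have "f (map \<sigma> a0) = Some d" using pfun_automorphism[OF f(1) \<sigma>(1) d0] \<sigma>(2) by simp
    ultimately show "\<exists>x\<in>Q. f x = Some d" by blast
  next
    assume "\<exists>x\<in>Q. f x = Some d"
    then obtain x where x: "x \<in> Q" "f x = Some d" by blast
    obtain \<sigma> where \<sigma>: "\<sigma> \<in> automorphisms M" "x = map \<sigma> a0" using Q_orbit[OF a0] x(1) by blast
    have "d = map \<sigma> d0" using pfun_automorphism[OF f(1) \<sigma>(1) d0] \<sigma>(2) x(2) by simp
    then show "d \<in> rlz M p" unfolding p_def rlz_tp_iff tp_eq_iff using \<sigma>(1) by blast
  qed
  have r_iff: "z \<in> rlz M r \<longleftrightarrow> (\<exists>x\<in>Q. \<exists>d. f x = Some d \<and> z = d @ pr x)" for z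
  proof
    assume "z \<in> rlz M r"
    then obtain \<sigma> where \<sigma>: "\<sigma> \<in> automorphisms M" "z = map \<sigma> (d0 @ c0)"
      unfolding r_def rlz_tp_iff tp_eq_iff by blast
    have "map \<sigma> a0 \<in> Q" using Q_orbit[OF a0] \<sigma>(1) by blast
    moreover have "f (map \<sigma> a0) = Some (map \<sigma> d0)" using pfun_automorphism[OF f(1) \<sigma>(1) d0] .
    moreover have "z = map \<sigma> d0 @ pr (map \<sigma> a0)"
      using \<sigma>(2) pr_automorphism[OF a0 \<sigma>(1)] by (simp add: c0_def)
    ultimately show "\<exists>x\<in>Q. \<exists>d. f x = Some d \<and> z = d @ pr x" by blast
  next
    assume "\<exists>x\<in>Q. \<exists>d. f x = Some d \<and> z = d @ pr x"
    then obtain x d where x: "x \<in> Q" "f x = Some d" "z = d @ pr x" by blast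
    obtain \<sigma> where \<sigma>: "\<sigma> \<in> automorphisms M" "x = map \<sigma> a0" using Q_orbit[OF a0] x(1) by blast
    have "d = map \<sigma> d0" using pfun_automorphism[OF f(1) \<sigma>(1) d0] \<sigma>(2) x(2) by simp
    then have "z = map \<sigma> (d0 @ c0)" using pr_automorphism[OF a0 \<sigma>(1)] \<sigma>(2) x(3) by (simp add: c0_def)
    then show "z \<in> rlz M r" unfolding r_def rlz_tp_iff tp_eq_iff using \<sigma>(1) by blast
  qed
  have pair: "d @ c \<in> rlz M r" if dc: "d \<in> rlz M p" "c \<in> rlz M ?s" for d c
  proof -
    obtain x where x: "x \<in> Q" "f x = Some d" using dc(1) p_iff by blast
    obtain y where "y \<in> Q" "f y = f x" "pr y = c" using sur[OF x(1)] dc(2) rlz_pushforward by blast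
    then show ?thesis unfolding r_iff using x(2) by auto
  qed
  have "weakly_orthogonal M p ?s"
    unfolding weakly_orthogonal_def
  proof (intro exI[of _ r] conjI)
    show "complete_type M {} r" unfolding r_def by (rule complete_type_tp)
    show "fst r = fst p @ fst ?s" unfolding r_def p_def s by simp
    show "rlz M r = {a @ b |a b. a \<in> rlz M p \<and> b \<in> rlz M ?s}"
    proof
      show "rlz M r \<subseteq> {a @ b |a b. a \<in> rlz M p \<and> b \<in> rlz M ?s}"
        unfolding rlz_pushforward using r_iff p_iff by blast
      show "{a @ b |a b. a \<in> rlz M p \<and> b \<in> rlz M ?s} \<subseteq> rlz M r" using pair by blast
    qed
  qed
  moreover have "tensor M {} p ?s = r"
    unfolding tensor_def
  proof (rule the_equality)
    obtain d where d: "tp M {} d = tp M {} d0" "indep M d {} (set c0)"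
      using nonforking_extension[OF stable small_finite[OF finite_set]] by blast
    have dp: "d \<in> rlz M p" using d(1) by (simp add: p_def rlz_tp_iff)
    have cs: "c0 \<in> rlz M ?s" unfolding s by simp
    have "r = tp M {} (d @ c0)" using pair[OF dp cs] unfolding r_def rlz_tp_iff by simp
    then show "\<exists>a\<in>rlz M p. \<exists>b\<in>rlz M ?s. indep M a {} (set b) \<and> r = tp M {} (a @ b)"
      using dp cs d(2) by blast
    fix t assume "\<exists>a\<in>rlz M p. \<exists>b\<in>rlz M ?s. indep M a {} (set b) \<and> t = tp M {} (a @ b)"
    then obtain a b where "a \<in> rlz M p" "b \<in> rlz M ?s" "t = tp M {} (a @ b)" by blast
    then show "t = r" using pair[of a b] unfolding r_def rlz_tp_iff by simp
  qed
  moreover have "definable_bijection_between M {} Q (rlz M r)"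
  proof -
    obtain us where us: "definable_pfun M {} ?ss us \<pi>" using pi_pfun by blast
    define g where "g x = (case f x of None \<Rightarrow> None | Some d \<Rightarrow> map_option ((@) d) (\<pi> x))" for x
    have "definable_pfun M {} ?ss (ts @ us) g"
      unfolding g_def by (rule definable_pfun_append[OF f(1) us])
    moreover have gQ: "g x = Some (the (f x) @ pr x)" if "x \<in> Q" for x
      using f(2) pi_pr[OF that] that by (auto simp: g_def)
    then have "Q \<subseteq> dom g" by blast
    moreover have "bij_betw (\<lambda>x. the (g x)) Q (rlz M r)"
      unfolding bij_betw_def
    proof
      show "inj_on (\<lambda>x. the (g x)) Q"
      proof (rule inj_onI)
        fix x y assume x: "x \<in> Q" and y: "y \<in> Q" and "the (g x) = the (g y)"
        then have eq: "the (f x) @ pr x = the (f y) @ pr y" using gQ by simp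
        obtain d e where de: "f x = Some d" "f y = Some e" using f(2) x y by blast
        have "sorts M d = ts" "sorts M e = ts" using f(1) de unfolding definable_pfun_def by blast+
        then have "length d = length e" by (metis length_map)
        then have "f x = f y" "pr x = pr y" using eq de by simp_all
        then show "x = y" by (rule inj[OF x y])
      qed
      have "the (g x) \<in> rlz M r" if "x \<in> Q" for x
        unfolding r_iff using gQ[OF that] f(2) that by force
      moreover have "z \<in> (\<lambda>x. the (g x)) ` Q" if z: "z \<in> rlz M r" for z
      proof -
        obtain x d where "x \<in> Q" "f x = Some d" "z = d @ pr x" using z r_iff by blast
        then have "z = the (g x)" using gQ by simp
        then show ?thesis using \<open>x \<in> Q\<close> by blast
      qed
      ultimately show "(\<lambda>x. the (g x)) ` Q = rlz M r" by blast
    qed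
    ultimately show ?thesis unfolding definable_bijection_between_def by blast
  qed
  moreover have "internal \<kappa> M P {} p"
    unfolding p_def by (rule internal_coordinate[OF stable PT split a0 d0])
  moreover have "complete_type M {} p" unfolding p_def by (rule complete_type_tp)
  ultimately show ?thesis by metis
qed

end

theorem proposition4p3:
  fixes \<kappa> :: "'k rel"
    and M :: "('f, 'r, 's, 'm) fo_struct"
    and P :: "('f, 'r, 's, 'm) ptype set"
    and q :: "('f, 'r, 's, 'm) ptype"
    and \<pi> :: "'m list \<rightharpoonup> 'm list"
    and G :: "('m list, 'm list) grpd"
  assumes "monster_model \<kappa> M"
    and "stable_theory M"
    and "eliminates_imaginaries M"
    and "acl M {} = dcl M {}"
    and "\<forall>\<Phi>\<in>P. partial_type M {} \<Phi>"
    and "complete_type M {} q"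
    and "relatively_internal \<kappa> M P q \<pi>"
    and "represents_binding_groupoid M P q \<pi> G"
    and "retractable M G"
  shows "\<exists>p. complete_type M {} p \<and> internal \<kappa> M P {} p \<and>
           weakly_orthogonal M p (pushforward M \<pi> q) \<and>
           definable_bijection_between M {} (rlz M q) (rlz M (tensor M {} p (pushforward M \<pi> q)))"
proof -
  interpret relatively_internal_type \<kappa> M P q \<pi>
    by unfold_locales (use assms in blast)+
  show ?thesis by (rule splitting[OF assms(2,5,3,8,9)])
qed

end
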